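(* Let $S$ and $T$ be pseudogroups. Then there is an $(S,T)$-equivalence bimodule if and only if $S$ and $T$ have a joint sup-enlargement.
   Context: **Pseudogroups.** For an inverse semigroup $S$, $\mathsf{E}(S)$ denotes its set of idempotents and $\le$ its natural partial order ($s\le t$ iff $s=et$ for some $e\in\mathsf{E}(S)$). Elements $s,t$ are compatible if both $s^{-1}t$ and $st^{-1}$ are idempotents. A subset is compatible if it is empty or its elements are pairwise compatible. A *pseudogroup* is an inverse semigroup $S$ in which every compatible subset has a join (the join of the empty set is the zero $0$) and multiplication distributes on both sides over such joins. Then $\mathsf{E}(S)$ is a frame whose top element $e_S$ is the identity of $S$. For a subset $X$ of a pseudogroup, $X^{\vee}$ is the set of all joins of compatible subsets of $X$. **Biactions and bimodules.** An *$(S,T)$-biaction* is a set $X$ with a left action of $S$ and a right action of $T$ such that $(sx)t=s(xt)$, and functions $\langle-,-\rangle\colon X\times X\to S$, $[-,-]\colon X\times X\to T$ such that for all $x,y,z\in X$, $s\in S$, $t\in T$: $\langle sx,y\rangle=s\langle x,y\rangle$; $\langle y,x\rangle=\langle x,y\rangle^{-1}$; $\langle x,x\rangle x=x$; $[x,yt]=[x,y]t$; $[y,x]=[x,y]^{-1}$; $x[x,x]=x$; $\langle x,y\rangle z=x[y,z]$. Then $p(x)=\langle x,x\rangle$ and $q(x)=[x,x]$ are idempotents. The order on $X$ is $x\le y$ iff $x=p(x)y$ (equivalently $x=yq(x)$). Elements $x,y\in X$ are compatible if $p(x)y=p(y)x$ and $xq(y)=yq(x)$; a subset of $X$ is compatible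 if its elements are pairwise compatible (the empty set included). For pseudogroups $S,T$, an *$(S,T)$-bimodule* is an $(S,T)$-biaction $X$ such that: every compatible subset of $X$ has a join; for all $x\in X$, $s\in S$, $t\in T$ and all compatible families $(x_i)$ in $X$, $(s_i)$ in $S$, $(t_i)$ in $T$ one has $s(\bigvee x_i)=\bigvee sx_i$, $(\bigvee s_i)x=\bigvee s_ix$, $(\bigvee x_i)t=\bigvee x_it$, $x(\bigvee t_i)=\bigvee xt_i$; and $\langle\bigvee x_i,y\rangle=\bigvee\langle x_i,y\rangle$ and $[y,\bigvee x_i]=\bigvee[y,x_i]$ for all $y\in X$ and all compatible families $(x_i)$ in $X$ (empty families included, so $\langle 0,y\rangle=0$, $[y,0]=0$). An *$(S,T)$-equivalence bimodule* is an $(S,T)$-bimodule $X$ satisfying the covering conditions $\bigvee_{x\in X}\langle x,x\rangle=e_S$ and $\bigvee_{x\in X}[x,x]=e_T$. **Enlargements.** If $U$ is a pseudogroup and $e\in\mathsf{E}(U)$ then $eUe$ is a pseudogroup with identity $e$ under the inherited operations. $U$ is a *sup-enlargement* of $S'=eUe$ if $S'=S'US'$ and $U=(US'U)^{\vee}$. A *joint sup-enlargement* of pseudogroups $S$ and $T$ is a pseudogroup $U$ which is a sup-enlargement of both $S$ and $T$, where $S$ and $T$ are identified up to isomorphism with local pseudogroups: there are $e,f\in\mathsf{E}(U)$ with $S\cong eUe$, $T\cong fUf$ and $U$ a sup-enlargement of both $eUe$ and $fUf$. *)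

theory Defs
  imports "HOL-Algebra.Congruence"
begin

section \<open>Inverse semigroups and pseudogroups\<close>

text \<open>Unlike the monoid records of HOL-Algebra, this one has no unit: the identity of a
  pseudogroup is a derived notion, the top idempotent.\<close>

record 'a semigrp = "'a partial_object" +
  sprod :: "['a, 'a] \<Rightarrow> 'a" (infixl \<open>\<cdot>\<index>\<close> 70)

definition sg_inv :: "('a, 'm) semigrp_scheme \<Rightarrow> 'a \<Rightarrow> 'a" where
  "sg_inv S s = (THE t. t \<in> carrier S \<and> s \<cdot>\<^bsub>S\<^esub> t \<cdot>\<^bsub>S\<^esub> s = s \<and> t \<cdot>\<^bsub>S\<^esub> s \<cdot>\<^bsub>S\<^esub> t = t)"

definition idems :: "('a, 'm) semigrp_scheme \<Rightarrow> 'a set" where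
  "idems S = {e \<in> carrier S. e \<cdot>\<^bsub>S\<^esub> e = e}"

definition sg_le :: "('a, 'm) semigrp_scheme \<Rightarrow> 'a \<Rightarrow> 'a \<Rightarrow> bool" where
  "sg_le S s t \<longleftrightarrow> s \<in> carrier S \<and> t \<in> carrier S \<and> (\<exists>e\<in>idems S. s = e \<cdot>\<^bsub>S\<^esub> t)"

definition sg_compatible :: "('a, 'm) semigrp_scheme \<Rightarrow> 'a set \<Rightarrow> bool" where
  "sg_compatible S A \<longleftrightarrow> A \<subseteq> carrier S \<and>
     (\<forall>s\<in>A. \<forall>t\<in>A. sg_inv S s \<cdot>\<^bsub>S\<^esub> t \<in> idems S \<and> s \<cdot>\<^bsub>S\<^esub> sg_inv S t \<in> idems S)"

definition sg_join :: "('a, 'm) semigrp_scheme \<Rightarrow> 'a set \<Rightarrow> 'a \<Rightarrow> bool" where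
  "sg_join S A j \<longleftrightarrow> j \<in> carrier S \<and> (\<forall>a\<in>A. sg_le S a j) \<and>
     (\<forall>u\<in>carrier S. (\<forall>a\<in>A. sg_le S a u) \<longrightarrow> sg_le S j u)"

definition sg_ident :: "('a, 'm) semigrp_scheme \<Rightarrow> 'a" where
  "sg_ident S = (THE e. e \<in> idems S \<and> (\<forall>f\<in>idems S. sg_le S f e))"

locale inverse_semigroup =
  fixes S :: "('a, 'm) semigrp_scheme" (structure)
  assumes prod_closed: "\<lbrakk>s \<in> carrier S; t \<in> carrier S\<rbrakk> \<Longrightarrow> s \<cdot> t \<in> carrier S"
    and prod_assoc: "\<lbrakk>s \<in> carrier S; t \<in> carrier S; u \<in> carrier S\<rbrakk> \<Longrightarrow> (s \<cdot> t) \<cdot> u = s \<cdot> (t \<cdot> u)"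
    and ex1_inverse: "s \<in> carrier S \<Longrightarrow> \<exists>!t. t \<in> carrier S \<and> s \<cdot> t \<cdot> s = s \<and> t \<cdot> s \<cdot> t = t"

text \<open>Joins are treated relationally: that \<open>f j\<close> is a join of \<open>f ` A\<close> whenever \<open>j\<close> is a
  join of \<open>A\<close> says both that the join of \<open>f ` A\<close> exists and that it equals \<open>f j\<close>.
  The case \<open>A = {}\<close> is included and makes the least element a zero.\<close>

locale pseudogroup = inverse_semigroup +
  assumes join_exists: "sg_compatible S A \<Longrightarrow> \<exists>j. sg_join S A j"
    and join_distrib_left: "\<lbrakk>sg_compatible S A; sg_join S A j; s \<in> carrier S\<rbrakk>
           \<Longrightarrow> sg_join S ((\<lambda>a. s \<cdot> a) ` A) (s \<cdot> j)"
    and join_distrib_right: "\<lbrakk>sg_compatible S A; sg_join S A j; s \<in> carrier S\<rbrakk>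
           \<Longrightarrow> sg_join S ((\<lambda>a. a \<cdot> s) ` A) (j \<cdot> s)"

definition join_closure :: "('a, 'm) semigrp_scheme \<Rightarrow> 'a set \<Rightarrow> 'a set" where
  "join_closure S A = {j. \<exists>B\<subseteq>A. sg_compatible S B \<and> sg_join S B j}"

section \<open>Biactions and bimodules\<close>

text \<open>\<open>linn\<close> and \<open>rinn\<close> are the pairings
  \<open>\<langle>-,-\<rangle>\<close> and \<open>[-,-]\<close> with values in \<open>S\<close> and \<open>T\<close> respectively.\<close>

record ('a, 'b, 'x) biact = "'x partial_object" +
  lact :: "'a \<Rightarrow> 'x \<Rightarrow> 'x"
  ract :: "'x \<Rightarrow> 'b \<Rightarrow> 'x"
  linn :: "'x \<Rightarrow> 'x \<Rightarrow> 'a"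
  rinn :: "'x \<Rightarrow> 'x \<Rightarrow> 'b"

locale biaction = S: inverse_semigroup S + T: inverse_semigroup T
  for S :: "('a, 'm) semigrp_scheme" and T :: "('b, 'n) semigrp_scheme" +
  fixes X :: "('a, 'b, 'x, 'k) biact_scheme"
  assumes lact_closed: "\<lbrakk>s \<in> carrier S; x \<in> carrier X\<rbrakk> \<Longrightarrow> lact X s x \<in> carrier X"
    and lact_prod: "\<lbrakk>s \<in> carrier S; s' \<in> carrier S; x \<in> carrier X\<rbrakk>
           \<Longrightarrow> lact X (s \<cdot>\<^bsub>S\<^esub> s') x = lact X s (lact X s' x)"
    and ract_closed: "\<lbrakk>x \<in> carrier X; t \<in> carrier T\<rbrakk> \<Longrightarrow> ract X x t \<in> carrier X"
    and ract_prod: "\<lbrakk>x \<in> carrier X; t \<in> carrier T; t' \<in> carrier T\<rbrakk>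
           \<Longrightarrow> ract X x (t \<cdot>\<^bsub>T\<^esub> t') = ract X (ract X x t) t'"
    and lact_ract: "\<lbrakk>s \<in> carrier S; x \<in> carrier X; t \<in> carrier T\<rbrakk>
           \<Longrightarrow> ract X (lact X s x) t = lact X s (ract X x t)"
    and linn_closed: "\<lbrakk>x \<in> carrier X; y \<in> carrier X\<rbrakk> \<Longrightarrow> linn X x y \<in> carrier S"
    and rinn_closed: "\<lbrakk>x \<in> carrier X; y \<in> carrier X\<rbrakk> \<Longrightarrow> rinn X x y \<in> carrier T"
    and linn_lact: "\<lbrakk>s \<in> carrier S; x \<in> carrier X; y \<in> carrier X\<rbrakk>
           \<Longrightarrow> linn X (lact X s x) y = s \<cdot>\<^bsub>S\<^esub> linn X x y"
    and linn_swap: "\<lbrakk>x \<in> carrier X; y \<in> carrier X\<rbrakk> \<Longrightarrow> linn X y x = sg_inv S (linn X x y)"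
    and linn_self: "x \<in> carrier X \<Longrightarrow> lact X (linn X x x) x = x"
    and rinn_ract: "\<lbrakk>x \<in> carrier X; y \<in> carrier X; t \<in> carrier T\<rbrakk>
           \<Longrightarrow> rinn X x (ract X y t) = rinn X x y \<cdot>\<^bsub>T\<^esub> t"
    and rinn_swap: "\<lbrakk>x \<in> carrier X; y \<in> carrier X\<rbrakk> \<Longrightarrow> rinn X y x = sg_inv T (rinn X x y)"
    and rinn_self: "x \<in> carrier X \<Longrightarrow> ract X x (rinn X x x) = x"
    and linn_rinn: "\<lbrakk>x \<in> carrier X; y \<in> carrier X; z \<in> carrier X\<rbrakk>
           \<Longrightarrow> lact X (linn X x y) z = ract X x (rinn X y z)"

definition bi_le :: "('a, 'b, 'x, 'k) biact_scheme \<Rightarrow> 'x \<Rightarrow> 'x \<Rightarrow> bool" where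
  "bi_le X x y \<longleftrightarrow> x \<in> carrier X \<and> y \<in> carrier X \<and> x = lact X (linn X x x) y"

definition bi_compatible :: "('a, 'b, 'x, 'k) biact_scheme \<Rightarrow> 'x set \<Rightarrow> bool" where
  "bi_compatible X A \<longleftrightarrow> A \<subseteq> carrier X \<and>
     (\<forall>x\<in>A. \<forall>y\<in>A. lact X (linn X x x) y = lact X (linn X y y) x \<and>
                     ract X x (rinn X y y) = ract X y (rinn X x x))"

definition bi_join :: "('a, 'b, 'x, 'k) biact_scheme \<Rightarrow> 'x set \<Rightarrow> 'x \<Rightarrow> bool" where
  "bi_join X A j \<longleftrightarrow> j \<in> carrier X \<and> (\<forall>a\<in>A. bi_le X a j) \<and>
     (\<forall>u\<in>carrier X. (\<forall>a\<in>A. bi_le X a u) \<longrightarrow> bi_le X j u)"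

locale bimodule = biaction S T X + S: pseudogroup S + T: pseudogroup T
  for S :: "('a, 'm) semigrp_scheme" and T :: "('b, 'n) semigrp_scheme"
    and X :: "('a, 'b, 'x, 'k) biact_scheme" +
  assumes bi_join_exists: "bi_compatible X A \<Longrightarrow> \<exists>j. bi_join X A j"
    and lact_join: "\<lbrakk>s \<in> carrier S; bi_compatible X A; bi_join X A j\<rbrakk>
           \<Longrightarrow> bi_join X ((\<lambda>x. lact X s x) ` A) (lact X s j)"
    and join_lact: "\<lbrakk>sg_compatible S B; sg_join S B s; x \<in> carrier X\<rbrakk>
           \<Longrightarrow> bi_join X ((\<lambda>b. lact X b x) ` B) (lact X s x)"
    and join_ract: "\<lbrakk>bi_compatible X A; bi_join X A j; t \<in> carrier T\<rbrakk>
           \<Longrightarrow> bi_join X ((\<lambda>x. ract X x t) ` A) (ract X j t)"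
    and ract_join: "\<lbrakk>x \<in> carrier X; sg_compatible T C; sg_join T C t\<rbrakk>
           \<Longrightarrow> bi_join X ((\<lambda>c. ract X x c) ` C) (ract X x t)"
    and linn_join: "\<lbrakk>bi_compatible X A; bi_join X A j; y \<in> carrier X\<rbrakk>
           \<Longrightarrow> sg_join S ((\<lambda>x. linn X x y) ` A) (linn X j y)"
    and rinn_join: "\<lbrakk>bi_compatible X A; bi_join X A j; y \<in> carrier X\<rbrakk>
           \<Longrightarrow> sg_join T ((\<lambda>x. rinn X y x) ` A) (rinn X y j)"

locale equivalence_bimodule = bimodule S T X
  for S :: "('a, 'm) semigrp_scheme" and T :: "('b, 'n) semigrp_scheme"
    and X :: "('a, 'b, 'x, 'k) biact_scheme" +
  assumes linn_cover: "sg_join S ((\<lambda>x. linn X x x) ` carrier X) (sg_ident S)"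
    and rinn_cover: "sg_join T ((\<lambda>x. rinn X x x) ` carrier X) (sg_ident T)"

section \<open>Enlargements\<close>

definition set_prod :: "('a, 'm) semigrp_scheme \<Rightarrow> 'a set \<Rightarrow> 'a set \<Rightarrow> 'a set" where
  "set_prod S A B = {a \<cdot>\<^bsub>S\<^esub> b |a b. a \<in> A \<and> b \<in> B}"

definition local_sg :: "('a, 'm) semigrp_scheme \<Rightarrow> 'a \<Rightarrow> ('a, 'm) semigrp_scheme" where
  "local_sg U e = U\<lparr>carrier := {e \<cdot>\<^bsub>U\<^esub> u \<cdot>\<^bsub>U\<^esub> e |u. u \<in> carrier U}\<rparr>"

definition sup_enlargement :: "('a, 'm) semigrp_scheme \<Rightarrow> 'a \<Rightarrow> bool" where
  "sup_enlargement U e \<longleftrightarrow> pseudogroup U \<and> e \<in> idems U \<and>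
     (let S' = carrier (local_sg U e) in
        S' = set_prod U (set_prod U S' (carrier U)) S' \<and>
        carrier U = join_closure U (set_prod U (set_prod U (carrier U) S') (carrier U)))"

text \<open>Semigroup isomorphisms automatically preserve inverses, order, joins and identities.\<close>

definition sg_isomorphic :: "('a, 'm) semigrp_scheme \<Rightarrow> ('b, 'n) semigrp_scheme \<Rightarrow> bool" where
  "sg_isomorphic S T \<longleftrightarrow> (\<exists>h. bij_betw h (carrier S) (carrier T) \<and>
     (\<forall>s\<in>carrier S. \<forall>t\<in>carrier S. h (s \<cdot>\<^bsub>S\<^esub> t) = h s \<cdot>\<^bsub>T\<^esub> h t))"

definition joint_sup_enlargement ::
    "('a, 'm) semigrp_scheme \<Rightarrow> ('b, 'n) semigrp_scheme \<Rightarrow> ('u, 'k) semigrp_scheme \<Rightarrow> bool" where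
  "joint_sup_enlargement S T U \<longleftrightarrow> pseudogroup U \<and>
     (\<exists>e\<in>idems U. \<exists>f\<in>idems U.
        sg_isomorphic S (local_sg U e) \<and> sg_isomorphic T (local_sg U f) \<and>
        sup_enlargement U e \<and> sup_enlargement U f)"

section \<open>Carrier types\<close>

text \<open>HOL cannot quantify existentially over types, so ``there is an equivalence bimodule''
  and ``there is a joint sup-enlargement'' need carrier types that are large enough.
  In a biaction, if \<open>p x = p y\<close> and \<open>q x = q y\<close> then \<open>x = \<langle>x,y\<rangle>y\<close>. Choosing one
  element \<open>r\<close> for each pair of idempotents \<open>(p x, q x)\<close> therefore makes
  \<open>x \<mapsto> (p x, q x, \<langle>x,r\<rangle>)\<close> injective, so \<open>bimod_univ\<close> can host every biaction.
  Joint sup-enlargements of \<open>S\<close> and \<open>T\<close> have no bound on their size, but from a bimodule \<open>X\<close>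
  one is obtained as a pseudogroup of \<open>2 \<times> 2\<close> matrices with entries in \<open>S\<close>, \<open>X\<close>, \<open>X\<close> and
  \<open>T\<close>, whence \<open>enl_univ\<close>. A claim of existence on these types should be accompanied by
  the claim that it follows from existence on an arbitrary type.\<close>

type_synonym ('a, 'b) bimod_univ = "'a \<times> 'b \<times> 'a"

type_synonym ('a, 'b) enl_univ =
  "'a \<times> ('a, 'b) bimod_univ \<times> ('a, 'b) bimod_univ \<times> 'b"

end

theory Submission
  imports Defs
begin

text \<open>From a joint sup-enlargement \<open>U\<close> with corners \<open>eUe\<close> and \<open>fUf\<close> one takes the bimodule
  \<open>eUf\<close> with pairings \<open>xy\<^sup>-\<^sup>1\<close> and \<open>x\<^sup>-\<^sup>1y\<close>; since \<open>U = (UfU)\<^sup>\<or>\<close>, the idempotent \<open>e\<close> is a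
  join of elements \<open>xx\<^sup>-\<^sup>1\<close>. Conversely, \<open>S\<close>, \<open>X\<close>, the dual of \<open>X\<close> and \<open>T\<close> are the four hom-sets
  of a category with two objects in which every arrow has an inverse in the sense of inverse
  semigroups, and \<open>U\<close> consists of the matrices over it whose rows and columns are orthogonal
  families. Matrices form a semigroup with an involution such that \<open>mm\<^sup>\<star>m = m\<close> and the
  projections \<open>mm\<^sup>\<star>\<close>, being diagonal, commute; this forces it to be an inverse semigroup. Its
  order and its joins are computed entrywise, and the covering conditions say that the
  identity matrix is a join of elements of \<open>UeU\<close> and of \<open>UfU\<close>.\<close>

section \<open>Inverse categories\<close>

text \<open>Inverse categories, with total operations and composability expressed through
  \<open>src\<close> and \<open>tgt\<close>, are the common ground. Every pseudogroup is one with a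
  single object, the category of a biaction has two objects, and matrices again form one with a
  single object; so order, compatibility and joins are developed once. Asking for an involution with
  commuting projections, rather than for unique inverses, is what makes the matrix case checkable: a
  matrix has an evident adjoint, while uniqueness of inverses is awkward to verify entrywise.

  The algebraic obstacle is that entries of a matrix product are joins, and joins are available only
  for compatible families. Orthogonality of rows and columns secures this, and it has to survive
  products and joins of matrices.

  The other obstacle is the carrier type. An enlargement on an arbitrary type cannot be re-encoded
  directly. It is traded for its corner bimodule, whose elements can be coded in
  \<open>bimod_univ\<close>, and the matrices over that bimodule form a new enlargement on
  \<open>enl_univ\<close>.\<close>

locale inverse_category =
  fixes C :: "'w set" and src tgt :: "'w \<Rightarrow> 'i"
    and comp :: "'w \<Rightarrow> 'w \<Rightarrow> 'w" (infixl \<open>\<odot>\<close> 70)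
    and star :: "'w \<Rightarrow> 'w" (\<open>_\<^sup>\<star>\<close> [1000] 1000)
  assumes comp_in [simp, intro]: "\<lbrakk>a \<in> C; b \<in> C; tgt a = src b\<rbrakk> \<Longrightarrow> a \<odot> b \<in> C"
    and src_comp: "\<lbrakk>a \<in> C; b \<in> C; tgt a = src b\<rbrakk> \<Longrightarrow> src (a \<odot> b) = src a"
    and tgt_comp: "\<lbrakk>a \<in> C; b \<in> C; tgt a = src b\<rbrakk> \<Longrightarrow> tgt (a \<odot> b) = tgt b"
    and comp_assoc: "\<lbrakk>a \<in> C; b \<in> C; c \<in> C; tgt a = src b; tgt b = src c\<rbrakk>
          \<Longrightarrow> a \<odot> b \<odot> c = a \<odot> (b \<odot> c)"
    and star_in [simp, intro]: "a \<in> C \<Longrightarrow> a\<^sup>\<star> \<in> C"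
    and src_star: "a \<in> C \<Longrightarrow> src (a\<^sup>\<star>) = tgt a"
    and tgt_star: "a \<in> C \<Longrightarrow> tgt (a\<^sup>\<star>) = src a"
    and star_star [simp]: "a \<in> C \<Longrightarrow> a\<^sup>\<star>\<^sup>\<star> = a"
    and star_comp: "\<lbrakk>a \<in> C; b \<in> C; tgt a = src b\<rbrakk> \<Longrightarrow> (a \<odot> b)\<^sup>\<star> = b\<^sup>\<star> \<odot> a\<^sup>\<star>"
    and comp_star_comp: "a \<in> C \<Longrightarrow> a \<odot> a\<^sup>\<star> \<odot> a = a"
    and range_commute: "\<lbrakk>a \<in> C; b \<in> C; src a = src b\<rbrakk>
          \<Longrightarrow> (a \<odot> a\<^sup>\<star>) \<odot> (b \<odot> b\<^sup>\<star>) = (b \<odot> b\<^sup>\<star>) \<odot> (a \<odot> a\<^sup>\<star>)"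
begin

context
  notes [simp] = src_comp tgt_comp src_star tgt_star
begin

definition hom :: "'i \<Rightarrow> 'i \<Rightarrow> 'w set" where
  "hom i j = {a \<in> C. src a = i \<and> tgt a = j}"

definition idem :: "'w \<Rightarrow> bool" where
  "idem e \<longleftrightarrow> e \<in> C \<and> src e = tgt e \<and> e \<odot> e = e"

definition le :: "'w \<Rightarrow> 'w \<Rightarrow> bool" where
  "le a b \<longleftrightarrow> a \<in> C \<and> b \<in> C \<and> src a = src b \<and> tgt a = tgt b \<and> a = a \<odot> a\<^sup>\<star> \<odot> b"

definition compat :: "'w \<Rightarrow> 'w \<Rightarrow> bool" where
  "compat a b \<longleftrightarrow> a \<in> C \<and> b \<in> C \<and> src a = src b \<and> tgt a = tgt b \<and>
     idem (a\<^sup>\<star> \<odot> b) \<and> idem (a \<odot> b\<^sup>\<star>)"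

definition coherent :: "'w set \<Rightarrow> bool" where
  "coherent A \<longleftrightarrow> (\<forall>a\<in>A. \<forall>b\<in>A. compat a b)"

text \<open>Bounds are compared inside the hom-set of \<open>j\<close>. Every hom-set has its own
  empty join, so a family determines its join only once source and target are fixed; hence the extra
  premises of \<open>is_join_unique\<close>.\<close>

definition is_join :: "'w set \<Rightarrow> 'w \<Rightarrow> bool" where
  "is_join A j \<longleftrightarrow> j \<in> C \<and> (\<forall>a\<in>A. le a j) \<and>
     (\<forall>u\<in>C. src u = src j \<longrightarrow> tgt u = tgt j \<longrightarrow> (\<forall>a\<in>A. le a u) \<longrightarrow> le j u)"

lemma hom_iff: "a \<in> hom i j \<longleftrightarrow> a \<in> C \<and> src a = i \<and> tgt a = j"
  by (simp add: hom_def)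

lemma comp_star_comp' [simp]: "a \<in> C \<Longrightarrow> a \<odot> (a\<^sup>\<star> \<odot> a) = a"
  using comp_star_comp[of a] by (simp add: comp_assoc)

lemma comp_star_comp_comp [simp]:
  "\<lbrakk>a \<in> C; b \<in> C; tgt a = src b\<rbrakk> \<Longrightarrow> a \<odot> (a\<^sup>\<star> \<odot> (a \<odot> b)) = a \<odot> b"
  using comp_assoc[of "a \<odot> a\<^sup>\<star>" a b] comp_assoc[of a "a\<^sup>\<star>" "a \<odot> b"] comp_star_comp[of a] by simp

lemma star_comp_star [simp]: "a \<in> C \<Longrightarrow> a\<^sup>\<star> \<odot> (a \<odot> a\<^sup>\<star>) = a\<^sup>\<star>"
  using comp_star_comp'[of "a\<^sup>\<star>"] by simp

lemma star_comp_star_comp [simp]: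
  "\<lbrakk>a \<in> C; b \<in> C; src a = src b\<rbrakk> \<Longrightarrow> a\<^sup>\<star> \<odot> (a \<odot> (a\<^sup>\<star> \<odot> b)) = a\<^sup>\<star> \<odot> b"
  using comp_star_comp_comp[of "a\<^sup>\<star>" b] by simp

section \<open>Idempotents and the projections of an arrow\<close>

lemma idemD: assumes "idem e" shows "e \<in> C" "src e = tgt e" "e \<odot> e = e"
  using assms by (auto simp: idem_def)

lemma idem_range [simp]: "a \<in> C \<Longrightarrow> idem (a \<odot> a\<^sup>\<star>)"
  by (simp add: idem_def comp_assoc)

lemma idem_domain [simp]: "a \<in> C \<Longrightarrow> idem (a\<^sup>\<star> \<odot> a)"
  by (simp add: idem_def comp_assoc)

text \<open>With \<open>p = e e\<^sup>\<star>\<close> and \<open>q = e\<^sup>\<star> e\<close> one has \<open>e = p q\<close> and \<open>e\<^sup>\<star> = q p\<close>.\<close>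

lemma idem_star: assumes "idem e" shows "e\<^sup>\<star> = e"
proof -
  note e = idemD[OF assms]
  have st: "e\<^sup>\<star> \<odot> e\<^sup>\<star> = e\<^sup>\<star>" using star_comp[of e e] e by simp
  have "(e \<odot> e\<^sup>\<star>) \<odot> (e\<^sup>\<star> \<odot> e) = e \<odot> (e\<^sup>\<star> \<odot> e\<^sup>\<star>) \<odot> e" using e by (simp add: comp_assoc)
  then have 1: "(e \<odot> e\<^sup>\<star>) \<odot> (e\<^sup>\<star> \<odot> e) = e" using e by (simp add: st comp_assoc)
  have "(e\<^sup>\<star> \<odot> e) \<odot> (e \<odot> e\<^sup>\<star>) = e\<^sup>\<star> \<odot> (e \<odot> e) \<odot> e\<^sup>\<star>"
    by (simp only: comp_assoc comp_in src_comp tgt_comp star_in src_star tgt_star e(1,2))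
  then have 2: "(e\<^sup>\<star> \<odot> e) \<odot> (e \<odot> e\<^sup>\<star>) = e\<^sup>\<star>" using e by (simp add: comp_assoc)
  show ?thesis using range_commute[of e "e\<^sup>\<star>"] e 1 2 by simp
qed

lemma idem_commute: assumes "idem e" "idem f" "src e = src f" shows "e \<odot> f = f \<odot> e"
  using range_commute[of e f] assms by (simp add: idemD idem_star)

lemma idem_left_commute:
  assumes "idem e" "idem f" "src e = src f" "a \<in> C" "src a = src f"
  shows "e \<odot> (f \<odot> a) = f \<odot> (e \<odot> a)"
  using assms idemD[OF assms(1)] idemD[OF assms(2)]
  by (metis comp_assoc idem_commute)

lemma idem_comp: assumes "idem e" "idem f" "src e = src f" shows "idem (e \<odot> f)"
proof -
  note e = idemD[OF assms(1)] and f = idemD[OF assms(2)]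
  have "e \<odot> f \<odot> (e \<odot> f) = e \<odot> (f \<odot> (e \<odot> f))" using e f assms(3) by (simp add: comp_assoc)
  also have "\<dots> = e \<odot> (e \<odot> (f \<odot> f))"
    using idem_left_commute[OF assms(2,1), of f] e f assms(3) by simp
  also have "\<dots> = e \<odot> f" using e f assms(3) by (metis comp_assoc)
  finally show ?thesis using e f assms(3) by (simp add: idem_def)
qed

lemma idem_idem_comp: "\<lbrakk>idem e; a \<in> C; src a = tgt e\<rbrakk> \<Longrightarrow> e \<odot> (e \<odot> a) = e \<odot> a"
  by (metis comp_assoc idemD)

section \<open>The natural partial order\<close>

lemma leD: assumes "le a b"
  shows "a \<in> C" "b \<in> C" "src a = src b" "tgt a = tgt b" "a \<odot> a\<^sup>\<star> \<odot> b = a"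
  using assms by (auto simp: le_def)

text \<open>The projection \<open>b \<odot> b\<^sup>\<star>\<close> commutes with \<open>e\<close>
  and is absorbed by \<open>b\<close>.\<close>

lemma le_left: assumes "idem e" "b \<in> C" "tgt e = src b" shows "le (e \<odot> b) b"
proof -
  note e = idemD[OF assms(1)]
  have "(e \<odot> b) \<odot> (e \<odot> b)\<^sup>\<star> \<odot> b = e \<odot> ((b \<odot> b\<^sup>\<star>) \<odot> (e \<odot> b))"
    using e assms by (simp add: star_comp idem_star comp_assoc)
  also have "\<dots> = e \<odot> (e \<odot> ((b \<odot> b\<^sup>\<star>) \<odot> b))"
    by (subst idem_left_commute[of "b \<odot> b\<^sup>\<star>" e b]) (use e assms in simp_all)
  also have "\<dots> = e \<odot> b" using e assms by (simp add: idem_idem_comp comp_star_comp)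
  finally show ?thesis using e assms by (simp add: le_def)
qed

text \<open>Left-right symmetry of the order. Taking adjoints in
  \<open>a = a \<odot> a\<^sup>\<star> \<odot> b\<close> gives \<open>a\<^sup>\<star> =
  b\<^sup>\<star> \<odot> (a \<odot> a\<^sup>\<star>)\<close>, and commuting the two range
  projections leads back to \<open>a\<close>. Through \<open>le_star\<close> this yields
  right-handed versions such as \<open>le_right\<close>.\<close>

lemma le_right_eq: assumes "le a b" shows "b \<odot> (a\<^sup>\<star> \<odot> a) = a"
proof -
  note a = leD[OF assms]
  have *: "a\<^sup>\<star> = b\<^sup>\<star> \<odot> (a \<odot> a\<^sup>\<star>)"
    using star_comp[of "a \<odot> a\<^sup>\<star>" b] a by (simp add: star_comp)
  have "b \<odot> (a\<^sup>\<star> \<odot> a) = b \<odot> (b\<^sup>\<star> \<odot> (a \<odot> a\<^sup>\<star>) \<odot> a)"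
    by (subst * ) (simp add: a)
  also have "\<dots> = b \<odot> (b\<^sup>\<star> \<odot> a)"
    using a by (simp add: comp_assoc)
  also have "\<dots> = (b \<odot> b\<^sup>\<star>) \<odot> ((a \<odot> a\<^sup>\<star>) \<odot> b)" using a by (simp add: comp_assoc)
  also have "\<dots> = (a \<odot> a\<^sup>\<star>) \<odot> ((b \<odot> b\<^sup>\<star>) \<odot> b)"
    by (subst idem_left_commute[of "b \<odot> b\<^sup>\<star>" "a \<odot> a\<^sup>\<star>" b]) (use a in simp_all)
  also have "\<dots> = a" using a by (simp add: comp_star_comp)
  finally show ?thesis .
qed

lemma le_star: assumes "le a b" shows "le (a\<^sup>\<star>) (b\<^sup>\<star>)"
proof -
  note a = leD[OF assms]
  have "a\<^sup>\<star> \<odot> a\<^sup>\<star>\<^sup>\<star> \<odot> b\<^sup>\<star> = a\<^sup>\<star>"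
    using arg_cong[OF le_right_eq[OF assms], of star] a by (simp add: star_comp comp_assoc)
  then show ?thesis using a by (simp add: le_def)
qed

lemma le_right: assumes "idem e" "b \<in> C" "src e = tgt b" shows "le (b \<odot> e) b"
  using le_star[OF le_left[of e "b\<^sup>\<star>"]] assms by (simp add: star_comp idem_star idemD)

lemma le_refl: "a \<in> C \<Longrightarrow> le a a"
  by (simp add: le_def comp_star_comp)

lemma le_antisym: assumes "le a b" "le b a" shows "a = b"
proof -
  note a = leD[OF assms(1)] and b = leD[OF assms(2)]
  have "a = (a \<odot> a\<^sup>\<star>) \<odot> ((b \<odot> b\<^sup>\<star>) \<odot> a)" using a b by simp
  also have "\<dots> = (b \<odot> b\<^sup>\<star>) \<odot> ((a \<odot> a\<^sup>\<star>) \<odot> a)"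
    by (subst idem_left_commute[of "a \<odot> a\<^sup>\<star>" "b \<odot> b\<^sup>\<star>" a]) (use a in simp_all)
  also have "\<dots> = b" using a b by (simp add: comp_star_comp)
  finally show ?thesis .
qed

lemma le_trans: assumes "le a b" "le b c" shows "le a c"
proof -
  note a = leD[OF assms(1)] and b = leD[OF assms(2)]
  have "a = a \<odot> a\<^sup>\<star> \<odot> (b \<odot> b\<^sup>\<star> \<odot> c)" using a b by simp
  also have "\<dots> = ((a \<odot> a\<^sup>\<star>) \<odot> (b \<odot> b\<^sup>\<star>)) \<odot> c" using a b by (simp add: comp_assoc)
  finally have "a = ((a \<odot> a\<^sup>\<star>) \<odot> (b \<odot> b\<^sup>\<star>)) \<odot> c" .
  then show ?thesis
    using le_left[OF idem_comp[of "a \<odot> a\<^sup>\<star>" "b \<odot> b\<^sup>\<star>"], of c] a b by simp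
qed

text \<open>Writing \<open>a\<close> as a restriction of \<open>b\<close> on the left and
  \<open>c\<close> as a restriction of \<open>d\<close> on the right moves both projections to the
  outside of \<open>b \<odot> d\<close>.\<close>

lemma le_comp: assumes "le a b" "le c d" "tgt a = src c" shows "le (a \<odot> c) (b \<odot> d)"
proof -
  note a = leD[OF assms(1)] and c = leD[OF assms(2)]
  have 1: "a \<odot> a\<^sup>\<star> \<odot> b \<odot> (d \<odot> (c\<^sup>\<star> \<odot> c)) = (a \<odot> a\<^sup>\<star>) \<odot> ((b \<odot> d) \<odot> (c\<^sup>\<star> \<odot> c))"
    using a(1-4) c(1-4) assms(3) by (simp add: comp_assoc)
  have "le ((a \<odot> a\<^sup>\<star>) \<odot> ((b \<odot> d) \<odot> (c\<^sup>\<star> \<odot> c))) ((b \<odot> d) \<odot> (c\<^sup>\<star> \<odot> c))"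
    by (rule le_left) (use a(1-4) c(1-4) assms(3) in simp_all)
  moreover have "le ((b \<odot> d) \<odot> (c\<^sup>\<star> \<odot> c)) (b \<odot> d)"
    by (rule le_right) (use a(1-4) c(1-4) assms(3) in simp_all)
  ultimately have "le (a \<odot> a\<^sup>\<star> \<odot> b \<odot> (d \<odot> (c\<^sup>\<star> \<odot> c))) (b \<odot> d)"
    unfolding 1 by (rule le_trans)
  then show ?thesis by (simp only: a(5) le_right_eq[OF assms(2)])
qed

lemma le_idem: assumes "le a e" "idem e" shows "idem a"
proof -
  note a = leD[OF assms(1)] and e = idemD[OF assms(2)]
  have "idem ((a \<odot> a\<^sup>\<star>) \<odot> e)" by (rule idem_comp) (use a e assms in simp_all)
  then show ?thesis using a by simp
qed

lemma le_idem_eq: assumes "le e f" "idem f" shows "f \<odot> e = e" "e \<odot> f = e"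
proof -
  have i: "idem e" using assms by (rule le_idem)
  show "f \<odot> e = e" using le_right_eq[OF assms(1)] idem_star[OF i] idemD[OF i] by simp
  then show "e \<odot> f = e" using idem_commute[OF i assms(2)] leD[OF assms(1)] by simp
qed

lemma le_of_idem_eq: assumes "idem e" "idem f" "src e = src f" "e \<odot> f = e" shows "le e f"
  using le_left[of e f] assms by (simp add: idemD)

section \<open>Compatible arrows\<close>

lemma compatD: assumes "compat a b"
  shows "a \<in> C" "b \<in> C" "src a = src b" "tgt a = tgt b" "idem (a\<^sup>\<star> \<odot> b)" "idem (a \<odot> b\<^sup>\<star>)"
  using assms by (auto simp: compat_def)

lemma compat_star: assumes "compat a b" shows "compat (a\<^sup>\<star>) (b\<^sup>\<star>)"
  using compatD[OF assms] by (simp add: compat_def)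

text \<open>The product \<open>a\<^sup>\<star> \<odot> b\<close> lies below the idempotent
  \<open>c\<^sup>\<star> \<odot> c\<close>, and whatever lies below an idempotent is idempotent; the
  other product is treated alike.\<close>

lemma compat_of_le: assumes "le a c" "le b c" shows "compat a b"
proof -
  note a = leD[OF assms(1)] and b = leD[OF assms(2)]
  have "le (a\<^sup>\<star> \<odot> b) (c\<^sup>\<star> \<odot> c)" using assms a b by (intro le_comp le_star) simp_all
  moreover have "le (a \<odot> b\<^sup>\<star>) (c \<odot> c\<^sup>\<star>)" using assms a b by (intro le_comp le_star) simp_all
  ultimately show ?thesis using a b unfolding compat_def
    by (metis idem_domain idem_range le_idem)
qed

lemma compat_refl: "a \<in> C \<Longrightarrow> compat a a"
  by (rule compat_of_le[OF le_refl le_refl])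

text \<open>Compatibility is defined in semigroups by idempotency of products, in biactions by
  equality of restrictions; this lemma, \<open>compat_eq'\<close> and \<open>compat_of_eq\<close>
  convert between the two. Self-adjointness gives
  \<open>a\<^sup>\<star> \<odot> b = b\<^sup>\<star> \<odot> a\<close> and
  \<open>a \<odot> b\<^sup>\<star> = b \<odot> a\<^sup>\<star>\<close>; the idempotent
  \<open>a \<odot> b\<^sup>\<star>\<close> is doubled so that one copy can be reversed.\<close>

lemma compat_eq: assumes "compat a b" shows "a \<odot> a\<^sup>\<star> \<odot> b = b \<odot> b\<^sup>\<star> \<odot> a"
proof -
  note a = compatD[OF assms]
  have 1: "a\<^sup>\<star> \<odot> b = b\<^sup>\<star> \<odot> a" using idem_star[OF a(5)] a by (simp add: star_comp)
  have 2: "a \<odot> b\<^sup>\<star> = b \<odot> a\<^sup>\<star>" using idem_star[OF a(6)] a by (simp add: star_comp)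
  have "a \<odot> a\<^sup>\<star> \<odot> b = (a \<odot> b\<^sup>\<star>) \<odot> a" using 1 a by (simp add: comp_assoc)
  also have "\<dots> = (a \<odot> b\<^sup>\<star>) \<odot> ((a \<odot> b\<^sup>\<star>) \<odot> a)"
    using idem_idem_comp[OF a(6), of a] a by simp
  also have "\<dots> = (b \<odot> a\<^sup>\<star>) \<odot> ((a \<odot> b\<^sup>\<star>) \<odot> a)" using 2 by simp
  also have "\<dots> = b \<odot> ((a\<^sup>\<star> \<odot> a) \<odot> (b\<^sup>\<star> \<odot> a))" using a by (simp add: comp_assoc)
  also have "\<dots> = b \<odot> (a\<^sup>\<star> \<odot> (a \<odot> (a\<^sup>\<star> \<odot> b)))" using 1 a by (simp add: comp_assoc)
  also have "\<dots> = b \<odot> (a\<^sup>\<star> \<odot> b)" using a by simp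
  also have "\<dots> = b \<odot> b\<^sup>\<star> \<odot> a" using 1 a by (simp add: comp_assoc)
  finally show ?thesis .
qed

lemma compat_eq': assumes "compat a b" shows "a \<odot> (b\<^sup>\<star> \<odot> b) = b \<odot> (a\<^sup>\<star> \<odot> a)"
  using arg_cong[OF compat_eq[OF compat_star[OF assms]], of star] compatD[OF assms]
  by (simp add: star_comp comp_assoc)

text \<open>Substituting the two equations exhibits \<open>a\<^sup>\<star> \<odot> b\<close> and
  \<open>a \<odot> b\<^sup>\<star>\<close> as projections of the form
  \<open>w \<odot> w\<^sup>\<star>\<close>.\<close>

lemma compat_of_eq:
  assumes "a \<in> C" "b \<in> C" "src a = src b" "tgt a = tgt b"
    and "a \<odot> a\<^sup>\<star> \<odot> b = b \<odot> b\<^sup>\<star> \<odot> a" and "a \<odot> (b\<^sup>\<star> \<odot> b) = b \<odot> (a\<^sup>\<star> \<odot> a)"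
  shows "compat a b"
proof -
  have "a\<^sup>\<star> \<odot> b = a\<^sup>\<star> \<odot> (a \<odot> a\<^sup>\<star> \<odot> b)" using assms(1-4) by (simp add: comp_assoc)
  also have "\<dots> = (a\<^sup>\<star> \<odot> b) \<odot> (a\<^sup>\<star> \<odot> b)\<^sup>\<star>"
    unfolding assms(5) using assms(1-4) by (simp add: comp_assoc star_comp)
  finally have "idem (a\<^sup>\<star> \<odot> b)" using idem_range[of "a\<^sup>\<star> \<odot> b"] assms(1-4) by simp
  moreover have "a \<odot> b\<^sup>\<star> = a \<odot> (b\<^sup>\<star> \<odot> b) \<odot> b\<^sup>\<star>" using assms(1-4) by (simp add: comp_assoc)
  then have "a \<odot> b\<^sup>\<star> = (b \<odot> a\<^sup>\<star>) \<odot> (b \<odot> a\<^sup>\<star>)\<^sup>\<star>"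
    unfolding assms(6) using assms(1-4) by (simp add: comp_assoc star_comp)
  then have "idem (a \<odot> b\<^sup>\<star>)" using idem_range[of "b \<odot> a\<^sup>\<star>"] assms(1-4) by simp
  ultimately show ?thesis using assms(1-4) by (simp add: compat_def)
qed

lemma compat_idem: assumes "idem e" "idem f" "src e = src f" shows "compat e f"
  using assms idem_comp[OF assms] by (simp add: compat_def idem_star idemD)

lemma coherentD: "\<lbrakk>coherent A; a \<in> A; b \<in> A\<rbrakk> \<Longrightarrow> compat a b"
  by (simp add: coherent_def)

lemma coherent_star: "coherent A \<Longrightarrow> coherent (star ` A)"
  by (auto simp: coherent_def intro: compat_star)

section \<open>Joins of arrows\<close>

lemma is_joinD: assumes "is_join A j"
  shows "j \<in> C" "a \<in> A \<Longrightarrow> le a j"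
    "\<lbrakk>u \<in> C; src u = src j; tgt u = tgt j; \<And>a. a \<in> A \<Longrightarrow> le a u\<rbrakk> \<Longrightarrow> le j u"
  using assms by (auto simp: is_join_def)

lemma is_joinI:
  assumes "j \<in> C" "\<And>a. a \<in> A \<Longrightarrow> le a j"
    "\<And>u. \<lbrakk>u \<in> C; src u = src j; tgt u = tgt j; \<And>a. a \<in> A \<Longrightarrow> le a u\<rbrakk> \<Longrightarrow> le j u"
  shows "is_join A j"
  using assms by (auto simp: is_join_def)

text \<open>The members of \<open>A\<close> share the upper bound \<open>j\<close>. Compatibility
  premises of the pseudogroup and bimodule axioms can thus be discharged from a join alone.\<close>

lemma is_join_coherent: "is_join A j \<Longrightarrow> coherent A"
  by (auto simp: coherent_def intro: compat_of_le is_joinD)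

lemma is_join_unique:
  assumes "is_join A j" "is_join A k" "src j = src k" "tgt j = tgt k" shows "j = k"
  using assms by (auto intro!: le_antisym simp: is_join_def)

lemma is_join_star: assumes "is_join A j" shows "is_join (star ` A) (j\<^sup>\<star>)"
proof (rule is_joinI)
  show "j\<^sup>\<star> \<in> C" using is_joinD(1)[OF assms] by simp
  show "le a (j\<^sup>\<star>)" if "a \<in> star ` A" for a
    using that is_joinD(2)[OF assms] le_star by auto
next
  fix u assume u: "u \<in> C" "src u = src (j\<^sup>\<star>)" "tgt u = tgt (j\<^sup>\<star>)" "\<And>a. a \<in> star ` A \<Longrightarrow> le a u"
  have "le j (u\<^sup>\<star>)"
  proof (rule is_joinD(3)[OF assms])
    fix a assume a: "a \<in> A"
    then have "le (a\<^sup>\<star>) u" using u(4) by simp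
    then show "le a (u\<^sup>\<star>)" using le_star[of "a\<^sup>\<star>" u] leD(1)[OF is_joinD(2)[OF assms a]] by simp
  qed (use u is_joinD(1)[OF assms] in simp_all)
  then show "le (j\<^sup>\<star>) u" using le_star u(1) by fastforce
qed

lemma is_join_greatest:
  assumes "j \<in> A" "\<And>a. a \<in> A \<Longrightarrow> le a j" shows "is_join A j"
  using assms leD(1) by (intro is_joinI) auto

text \<open>Both families have the same upper bounds in the hom-set of \<open>j\<close>. This
  regroups double joins, in the associativity of the matrix product and in its distributivity over
  joins.\<close>

lemma is_join_UN_iff:
  assumes "\<And>k. k \<in> K \<Longrightarrow> is_join (G k) (f k)"
    and "j \<in> C" "\<And>k. k \<in> K \<Longrightarrow> src (f k) = src j" "\<And>k. k \<in> K \<Longrightarrow> tgt (f k) = tgt j"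
  shows "is_join (\<Union>k\<in>K. G k) j \<longleftrightarrow> is_join (f ` K) j"
proof -
  have "(\<forall>a\<in>\<Union>k\<in>K. G k. le a u) \<longleftrightarrow> (\<forall>a\<in>f ` K. le a u)"
    if "u \<in> C" "src u = src j" "tgt u = tgt j" for u
    using is_joinD(2,3)[OF assms(1)] that assms(3,4) le_trans by (auto; metis)
  then show ?thesis using assms(2) by (auto simp: is_join_def)
qed

end

end

section \<open>Joins in hom-sets\<close>

locale join_category = inverse_category C src tgt comp star
  for C :: "'w set" and src tgt :: "'w \<Rightarrow> 'i"
    and comp :: "'w \<Rightarrow> 'w \<Rightarrow> 'w" (infixl \<open>\<odot>\<close> 70)
    and star :: "'w \<Rightarrow> 'w" (\<open>_\<^sup>\<star>\<close> [1000] 1000) +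
  assumes join_ex: "\<lbrakk>A \<subseteq> hom i j; coherent A\<rbrakk> \<Longrightarrow> \<exists>a\<in>hom i j. is_join A a"
    and comp_join: "\<lbrakk>is_join A a; w \<in> C; tgt w = src a\<rbrakk> \<Longrightarrow> is_join ((\<odot>) w ` A) (w \<odot> a)"
begin

context
  notes [simp] = src_comp tgt_comp src_star tgt_star
begin

text \<open>Conjugate \<open>comp_join\<close> by the involution.\<close>

lemma join_comp: assumes "is_join A a" "w \<in> C" "src w = tgt a"
  shows "is_join ((\<lambda>x. x \<odot> w) ` A) (a \<odot> w)"
proof -
  have a: "a \<in> C" using assms by (simp add: is_joinD)
  have A: "x \<in> C" "tgt x = tgt a" if "x \<in> A" for x using is_joinD(2)[OF assms(1) that] leD by auto
  have "is_join (star ` (\<odot>) (w\<^sup>\<star>) ` star ` A) ((w\<^sup>\<star> \<odot> a\<^sup>\<star>)\<^sup>\<star>)"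
    by (intro is_join_star comp_join) (use a assms in simp_all)
  moreover have "star ` (\<odot>) (w\<^sup>\<star>) ` star ` A = (\<lambda>x. x \<odot> w) ` A"
    unfolding image_image by (rule image_cong) (use A a assms in \<open>simp_all add: star_comp\<close>)
  ultimately show ?thesis using a assms by (simp add: star_comp)
qed

text \<open>Since \<open>a \<odot> e = e\<close> for every \<open>e \<in> A\<close>, left
  multiplication by \<open>a\<close> maps \<open>A\<close> onto itself; so
  \<open>a \<odot> a\<close> is a join of \<open>A\<close> as well and equals
  \<open>a\<close>.\<close>

lemma idem_join: assumes "is_join A a" "src a = tgt a" "\<And>e. e \<in> A \<Longrightarrow> idem e" shows "idem a"
proof -
  have a: "a \<in> C" using assms by (simp add: is_joinD)
  have "a \<odot> e = e" if "e \<in> A" for e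
    using le_right_eq[OF is_joinD(2)[OF assms(1) that]] idem_star[OF assms(3)[OF that]]
      idemD[OF assms(3)[OF that]] by simp
  then have "(\<odot>) a ` A = A" by (simp add: image_def)
  then have "is_join A (a \<odot> a)" using comp_join[OF assms(1) a] assms(2) by simp
  then have "a \<odot> a = a" using is_join_unique[OF _ assms(1)] a assms(2) by simp
  then show ?thesis using a assms(2) by (simp add: idem_def)
qed

section \<open>Chosen joins and zero arrows\<close>

definition Join :: "'i \<Rightarrow> 'i \<Rightarrow> 'w set \<Rightarrow> 'w" where
  "Join i j A = (SOME a. a \<in> hom i j \<and> is_join A a)"

definition zero :: "'i \<Rightarrow> 'i \<Rightarrow> 'w" where
  "zero i j = Join i j {}"

lemma Join: assumes "A \<subseteq> hom i j" "coherent A"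
  shows "Join i j A \<in> hom i j" "is_join A (Join i j A)"
  using someI_ex[of "\<lambda>a. a \<in> hom i j \<and> is_join A a"] join_ex[OF assms]
  unfolding Join_def by auto

lemma Join_eq: assumes "is_join A a" "a \<in> hom i j" shows "Join i j A = a"
proof -
  have "A \<subseteq> hom i j" using is_joinD(2)[OF assms(1)] leD assms(2) by (fastforce simp: hom_iff)
  then show ?thesis
    using Join[of A i j] is_join_coherent[OF assms(1)] is_join_unique[OF _ assms(1)] assms(2)
    by (simp add: hom_iff)
qed

lemma is_join_zero: "is_join {} (zero i j)"
  unfolding zero_def by (rule Join(2)) (simp_all add: coherent_def)

lemma zero_in [simp]: "zero i j \<in> C" and src_zero: "src (zero i j) = i"
  and tgt_zero: "tgt (zero i j) = j"
  using Join(1)[of "{}" i j] by (simp_all add: zero_def coherent_def hom_iff)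

context
  notes [simp] = src_zero tgt_zero
begin

lemma zero_le: "\<lbrakk>a \<in> C; src a = i; tgt a = j\<rbrakk> \<Longrightarrow> le (zero i j) a"
  using is_joinD(3)[OF is_join_zero, of a i j] by simp

text \<open>Zeros are empty joins; a composite with a zero, or with a join whose terms all give
  zero, is computed by distributing and then applying this lemma.\<close>

lemma is_join_zeros: assumes "is_join A a" "\<And>x. x \<in> A \<Longrightarrow> x = zero (src a) (tgt a)"
  shows "a = zero (src a) (tgt a)"
proof (rule le_antisym)
  show "le a (zero (src a) (tgt a))"
  proof (rule is_joinD(3)[OF assms(1)])
    show "le x (zero (src a) (tgt a))" if "x \<in> A" for x
      using assms(2)[OF that] le_refl[of "zero (src a) (tgt a)"] by simp
  qed simp_all
  show "le (zero (src a) (tgt a)) a" by (rule zero_le) (use assms in \<open>auto simp: is_joinD\<close>)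
qed

lemma le_zero: "le a (zero i j) \<Longrightarrow> a = zero i j"
  using leD[of a "zero i j"] by (auto intro!: le_antisym zero_le)

lemma star_zero [simp]: "(zero i j)\<^sup>\<star> = zero j i"
  using is_join_zeros[OF is_join_star[OF is_join_zero[of i j]]] by simp

lemma comp_zero [simp]: "\<lbrakk>w \<in> C; tgt w = i\<rbrakk> \<Longrightarrow> w \<odot> zero i j = zero (src w) j"
  using is_join_zeros[OF comp_join[OF is_join_zero[of i j], of w]] by simp

lemma zero_comp [simp]: "\<lbrakk>w \<in> C; src w = j\<rbrakk> \<Longrightarrow> zero i j \<odot> w = zero i (tgt w)"
  using is_join_zeros[OF join_comp[OF is_join_zero[of i j], of w]] by simp

lemma idem_zero [simp]: "idem (zero i i)"
  by (simp add: idem_def)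

text \<open>Orthogonality passes from two families to their joins, by distributing first over
  \<open>B\<close> and then over \<open>A\<close>.\<close>

lemma comp_join_zero:
  assumes "is_join A a" "is_join B b" "tgt a = src b"
    and "\<And>x y. \<lbrakk>x \<in> A; y \<in> B\<rbrakk> \<Longrightarrow> x \<odot> y = zero (src a) (tgt b)"
  shows "a \<odot> b = zero (src a) (tgt b)"
proof -
  have ab: "a \<in> C" "b \<in> C" using assms by (auto simp: is_joinD)
  have "x \<odot> b = zero (src a) (tgt b)" if x: "x \<in> A" for x
  proof -
    have "x \<in> C" "src x = src a" "tgt x = tgt a" using is_joinD(2)[OF assms(1) x] leD by auto
    then show ?thesis
      using is_join_zeros[OF comp_join[OF assms(2), of x]] assms(3,4) ab x by auto
  qed
  then show ?thesis
    using is_join_zeros[OF join_comp[OF assms(1), of b]] assms(3) ab by auto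
qed

lemma compat_of_orthogonal:
  assumes "a \<in> C" "b \<in> C" "src a = src b" "tgt a = tgt b"
    and "a\<^sup>\<star> \<odot> b = zero (tgt a) (tgt a)" "a \<odot> b\<^sup>\<star> = zero (src a) (src a)"
  shows "compat a b"
  using assms by (simp add: compat_def)

end

end

end

section \<open>Inverse semigroups as inverse categories with one object\<close>

context inverse_semigroup
begin

lemma sg_inv_closed [simp]: "s \<in> carrier S \<Longrightarrow> sg_inv S s \<in> carrier S"
  and sg_inv_right: "s \<in> carrier S \<Longrightarrow> s \<cdot> sg_inv S s \<cdot> s = s"
  and sg_inv_left: "s \<in> carrier S \<Longrightarrow> sg_inv S s \<cdot> s \<cdot> sg_inv S s = sg_inv S s"
  using theI'[OF ex1_inverse, of s] by (simp_all add: sg_inv_def)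

lemma sg_inv_eq:
  "\<lbrakk>s \<in> carrier S; t \<in> carrier S; s \<cdot> t \<cdot> s = s; t \<cdot> s \<cdot> t = t\<rbrakk> \<Longrightarrow> sg_inv S s = t"
  unfolding sg_inv_def by (rule the1_equality[OF ex1_inverse]) simp_all

lemma sg_inv_inv [simp]: "s \<in> carrier S \<Longrightarrow> sg_inv S (sg_inv S s) = s"
  by (intro sg_inv_eq) (simp_all add: sg_inv_right sg_inv_left)

lemma sg_inv_idem: "e \<in> idems S \<Longrightarrow> sg_inv S e = e"
  by (intro sg_inv_eq) (simp_all add: idems_def)

text \<open>The inverse \<open>x\<close> of \<open>e \<cdot> f\<close> must equal
  \<open>f \<cdot> (x \<cdot> e)\<close>, since the latter is also an inverse; this makes
  \<open>x\<close> idempotent. An idempotent is its own inverse, hence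
  \<open>x = e \<cdot> f\<close>.\<close>

lemma idems_prod: assumes "e \<in> idems S" "f \<in> idems S" shows "e \<cdot> f \<in> idems S"
proof -
  have e: "e \<in> carrier S" "e \<cdot> e = e" and f: "f \<in> carrier S" "f \<cdot> f = f"
    using assms by (auto simp: idems_def)
  have e': "e \<cdot> (e \<cdot> u) = e \<cdot> u" if "u \<in> carrier S" for u
    using that e prod_assoc[of e e u] by simp
  have f': "f \<cdot> (f \<cdot> u) = f \<cdot> u" if "u \<in> carrier S" for u
    using that f prod_assoc[of f f u] by simp
  define x where "x = sg_inv S (e \<cdot> f)"
  have x: "x \<in> carrier S" using e f by (simp add: x_def prod_closed)
  have x1: "e \<cdot> (f \<cdot> (x \<cdot> (e \<cdot> f))) = e \<cdot> f" and x2: "x \<cdot> (e \<cdot> (f \<cdot> x)) = x"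
    using sg_inv_right[of "e \<cdot> f"] sg_inv_left[of "e \<cdot> f"] x e f
    unfolding x_def[symmetric] by (simp_all add: prod_closed prod_assoc)
  have x3: "x \<cdot> (e \<cdot> (f \<cdot> (x \<cdot> u))) = x \<cdot> u" if "u \<in> carrier S" for u
    using arg_cong[OF x2, of "\<lambda>z. z \<cdot> u"] x e f that by (simp add: prod_closed prod_assoc)
  have "sg_inv S (e \<cdot> f) = f \<cdot> (x \<cdot> e)"
    by (rule sg_inv_eq) (use x e f in \<open>simp_all add: prod_closed prod_assoc e' f' x1 x3\<close>)
  then have fxe: "f \<cdot> (x \<cdot> e) = x" by (simp add: x_def)
  have "x \<cdot> x = f \<cdot> (x \<cdot> e) \<cdot> (f \<cdot> (x \<cdot> e))" by (simp add: fxe)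
  also have "\<dots> = f \<cdot> (x \<cdot> e)" using x e f by (simp add: prod_closed prod_assoc x3)
  finally have "x \<cdot> x = x" by (simp add: fxe)
  then have "x \<in> idems S" using x by (simp add: idems_def)
  moreover from this have "x = e \<cdot> f"
    using sg_inv_idem[of x] e f by (simp add: x_def prod_closed)
  ultimately show ?thesis by simp
qed

text \<open>Both products are idempotent, which makes \<open>f \<cdot> e\<close> an inverse of
  \<open>e \<cdot> f\<close>; but \<open>e \<cdot> f\<close> is its own inverse.\<close>

lemma idems_commute: assumes "e \<in> idems S" "f \<in> idems S" shows "e \<cdot> f = f \<cdot> e"
proof -
  have e: "e \<in> carrier S" "e \<cdot> e = e" and f: "f \<in> carrier S" "f \<cdot> f = f"
    using assms by (auto simp: idems_def)
  have e': "e \<cdot> (e \<cdot> u) = e \<cdot> u" if "u \<in> carrier S" for u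
    using that e prod_assoc[of e e u] by simp
  have f': "f \<cdot> (f \<cdot> u) = f \<cdot> u" if "u \<in> carrier S" for u
    using that f prod_assoc[of f f u] by simp
  have ef: "e \<cdot> (f \<cdot> (e \<cdot> f)) = e \<cdot> f" and fe: "f \<cdot> (e \<cdot> (f \<cdot> e)) = f \<cdot> e"
    using idems_prod[OF assms] idems_prod[OF assms(2,1)] e f
    by (simp_all add: idems_def prod_assoc prod_closed)
  have "sg_inv S (e \<cdot> f) = f \<cdot> e"
    by (rule sg_inv_eq) (use e f in \<open>simp_all add: prod_closed prod_assoc e' f' ef fe\<close>)
  then show ?thesis using sg_inv_idem[OF idems_prod[OF assms]] by simp
qed

lemma idems_range: "s \<in> carrier S \<Longrightarrow> s \<cdot> sg_inv S s \<in> idems S"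
  and idems_domain: "s \<in> carrier S \<Longrightarrow> sg_inv S s \<cdot> s \<in> idems S"
  using sg_inv_right[of s] sg_inv_left[of s]
  by (simp_all add: idems_def prod_closed prod_assoc)

lemma sg_inv_prod: assumes "s \<in> carrier S" "t \<in> carrier S"
  shows "sg_inv S (s \<cdot> t) = sg_inv S t \<cdot> sg_inv S s"
proof -
  let ?s = "sg_inv S s" and ?t = "sg_inv S t"
  note c = prod_closed prod_assoc
  have comm: "(?s \<cdot> s) \<cdot> (t \<cdot> ?t) = (t \<cdot> ?t) \<cdot> (?s \<cdot> s)"
    using assms by (intro idems_commute idems_range idems_domain)
  have "s \<cdot> t \<cdot> (?t \<cdot> ?s) \<cdot> (s \<cdot> t) = s \<cdot> ((t \<cdot> ?t) \<cdot> (?s \<cdot> s)) \<cdot> t" using assms by (simp add: c)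
  also have "\<dots> = (s \<cdot> ?s \<cdot> s) \<cdot> (t \<cdot> ?t \<cdot> t)" unfolding comm[symmetric] using assms by (simp add: c)
  finally have 1: "s \<cdot> t \<cdot> (?t \<cdot> ?s) \<cdot> (s \<cdot> t) = s \<cdot> t" using assms by (simp add: sg_inv_right)
  have "?t \<cdot> ?s \<cdot> (s \<cdot> t) \<cdot> (?t \<cdot> ?s) = ?t \<cdot> ((?s \<cdot> s) \<cdot> (t \<cdot> ?t)) \<cdot> ?s" using assms by (simp add: c)
  also have "\<dots> = (?t \<cdot> t \<cdot> ?t) \<cdot> (?s \<cdot> s \<cdot> ?s)" unfolding comm using assms by (simp add: c)
  finally have 2: "?t \<cdot> ?s \<cdot> (s \<cdot> t) \<cdot> (?t \<cdot> ?s) = ?t \<cdot> ?s" using assms by (simp add: sg_inv_left)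
  show ?thesis by (rule sg_inv_eq) (use assms 1 2 in \<open>simp_all add: prod_closed\<close>)
qed

end

sublocale inverse_semigroup \<subseteq> cat: inverse_category "carrier S" "\<lambda>_. ()" "\<lambda>_. ()" "sprod S" "sg_inv S"
proof
  fix a b assume ab: "a \<in> carrier S" "b \<in> carrier S"
  show "a \<cdot> sg_inv S a \<cdot> (b \<cdot> sg_inv S b) = b \<cdot> sg_inv S b \<cdot> (a \<cdot> sg_inv S a)"
    by (intro idems_commute idems_range ab)
  show "sg_inv S (a \<cdot> b) = sg_inv S b \<cdot> sg_inv S a" using ab by (rule sg_inv_prod)
qed (simp_all add: prod_closed prod_assoc[symmetric] sg_inv_right)

context inverse_semigroup
begin

lemma idems_iff: "e \<in> idems S \<longleftrightarrow> cat.idem e"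
  by (simp add: idems_def cat.idem_def)

lemma sg_le_iff: "sg_le S s t \<longleftrightarrow> cat.le s t"
proof
  assume "sg_le S s t"
  then show "cat.le s t" by (auto simp: sg_le_def idems_iff intro: cat.le_left)
next
  assume "cat.le s t"
  note s = cat.leD[OF this]
  then show "sg_le S s t" unfolding sg_le_def
    by (metis cat.idem_range idems_iff)
qed

lemma sg_compatible_iff: "sg_compatible S A \<longleftrightarrow> cat.coherent A"
  by (auto simp: sg_compatible_def cat.coherent_def cat.compat_def idems_iff)

lemma sg_join_iff: "sg_join S A j \<longleftrightarrow> cat.is_join A j"
  by (simp add: sg_join_def cat.is_join_def sg_le_iff)

end

sublocale pseudogroup \<subseteq> cat: join_category "carrier S" "\<lambda>_. ()" "\<lambda>_. ()" "sprod S" "sg_inv S"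
proof
  fix A i j
  assume "cat.coherent A"
  then obtain a where a: "cat.is_join A a"
    using join_exists[of A] by (auto simp: sg_compatible_iff sg_join_iff)
  then show "\<exists>a\<in>cat.hom i j. cat.is_join A a"
    using cat.is_joinD(1)[OF a] by (intro bexI[of _ a]) (simp_all add: cat.hom_def)
next
  fix A a w
  assume "cat.is_join A a" "w \<in> carrier S"
  then show "cat.is_join ((\<cdot>) w ` A) (w \<cdot> a)"
    using join_distrib_left[of A a w] cat.is_join_coherent
    by (auto simp: sg_compatible_iff sg_join_iff)
qed

text \<open>The point is uniqueness. For any inverse \<open>t\<close> of \<open>s\<close> the
  products \<open>s t\<close> and \<open>t s\<close> are idempotent. Commuting \<open>s t\<close>
  with the range projection of \<open>s\<close> turns \<open>t\<close> into
  \<open>t s (star s)\<close>, and commuting \<open>t s\<close> with its domain projection turns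
  this into \<open>star s\<close>.\<close>

lemma inverse_semigroup_of_category:
  assumes "inverse_category C (\<lambda>_. ()) (\<lambda>_. ()) mul star"
  shows "inverse_semigroup \<lparr>carrier = C, sprod = mul\<rparr>"
    and "a \<in> C \<Longrightarrow> sg_inv \<lparr>carrier = C, sprod = mul\<rparr> a = star a"
proof -
  interpret inverse_category C "\<lambda>_. ()" "\<lambda>_. ()" mul star by fact
  show *: "inverse_semigroup \<lparr>carrier = C, sprod = mul\<rparr>"
  proof
    fix s assume "s \<in> carrier \<lparr>carrier = C, sprod = mul\<rparr>"
    then have s: "s \<in> C" by simp
    have uniq: "t = star s" if t: "t \<in> C" "mul (mul s t) s = s" "mul (mul t s) t = t" for t
    proof -
      have i: "idem (mul s t)" "idem (mul t s)"
        using s t by (simp_all add: idem_def comp_assoc[symmetric])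
      have "t = mul t (mul (mul s (star s)) (mul s t))" using s t by (simp add: comp_assoc)
      also have "\<dots> = mul t (mul (mul s t) (mul s (star s)))"
        by (subst idem_commute[OF idem_range i(1)]) (use s t in simp_all)
      also have "\<dots> = mul (mul t s) (star s)"
        using s t(1) arg_cong[OF t(3), of "\<lambda>z. mul z (mul s (star s))"] by (simp add: comp_assoc)
      also have "\<dots> = mul (mul t s) (mul (mul (star s) s) (star s))"
        using s t(1) by (simp add: comp_assoc)
      also have "\<dots> = mul (mul (mul (star s) s) (mul t s)) (star s)"
        by (subst idem_commute[OF idem_domain i(2)]) (use s t(1) in \<open>simp_all add: comp_assoc\<close>)
      also have "\<dots> = mul (star s) (mul (mul (mul s t) s) (star s))"
        using s t(1) by (simp add: comp_assoc)
      also have "\<dots> = star s" using s unfolding t(2) by simp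
      finally show ?thesis .
    qed
    show "\<exists>!t. t \<in> carrier \<lparr>carrier = C, sprod = mul\<rparr> \<and>
        s \<cdot>\<^bsub>\<lparr>carrier = C, sprod = mul\<rparr>\<^esub> t \<cdot>\<^bsub>\<lparr>carrier = C, sprod = mul\<rparr>\<^esub> s = s \<and>
        t \<cdot>\<^bsub>\<lparr>carrier = C, sprod = mul\<rparr>\<^esub> s \<cdot>\<^bsub>\<lparr>carrier = C, sprod = mul\<rparr>\<^esub> t = t"
    proof (rule ex1I[of _ "star s"])
      show "star s \<in> carrier \<lparr>carrier = C, sprod = mul\<rparr> \<and>
        s \<cdot>\<^bsub>\<lparr>carrier = C, sprod = mul\<rparr>\<^esub> star s \<cdot>\<^bsub>\<lparr>carrier = C, sprod = mul\<rparr>\<^esub> s = s \<and>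
        star s \<cdot>\<^bsub>\<lparr>carrier = C, sprod = mul\<rparr>\<^esub> s \<cdot>\<^bsub>\<lparr>carrier = C, sprod = mul\<rparr>\<^esub> star s = star s"
        using s by (simp add: comp_assoc)
    qed (use uniq in auto)
  qed (simp_all add: comp_assoc)
  show "sg_inv \<lparr>carrier = C, sprod = mul\<rparr> a = star a" if "a \<in> C"
    by (rule inverse_semigroup.sg_inv_eq[OF *]) (use that in \<open>simp_all add: comp_assoc\<close>)
qed

text \<open>The semigroup notions refer to an inverse given by a definite description; once it is
  identified with \<open>star\<close>, each reduces to its categorical counterpart.\<close>

lemma one_object_iff:
  assumes "inverse_category C (\<lambda>_. ()) (\<lambda>_. ()) mul star"
  shows "e \<in> idems \<lparr>carrier = C, sprod = mul\<rparr> \<longleftrightarrow>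
      inverse_category.idem C (\<lambda>_. ()) (\<lambda>_. ()) mul e"
    and "sg_compatible \<lparr>carrier = C, sprod = mul\<rparr> A \<longleftrightarrow>
      inverse_category.coherent C (\<lambda>_. ()) (\<lambda>_. ()) mul star A"
    and "sg_join \<lparr>carrier = C, sprod = mul\<rparr> A j \<longleftrightarrow>
      inverse_category.is_join C (\<lambda>_. ()) (\<lambda>_. ()) mul star A j"
proof -
  let ?U = "\<lparr>carrier = C, sprod = mul\<rparr>"
  interpret inverse_category C "\<lambda>_. ()" "\<lambda>_. ()" mul star by fact
  interpret U: inverse_semigroup ?U by (rule inverse_semigroup_of_category(1)[OF assms])
  note inv = inverse_semigroup_of_category(2)[OF assms]
  have idem: "U.cat.idem e \<longleftrightarrow> idem e" for e
    unfolding U.cat.idem_def idem_def by simp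
  have le: "U.cat.le a b \<longleftrightarrow> le a b" for a b
    unfolding U.cat.le_def le_def by (auto simp: inv)
  show "e \<in> idems ?U \<longleftrightarrow> idem e" unfolding U.idems_iff idem ..
  show "sg_compatible ?U A \<longleftrightarrow> coherent A"
    unfolding U.sg_compatible_iff U.cat.coherent_def U.cat.compat_def idem coherent_def compat_def
    by (simp add: inv cong: conj_cong)
  show "sg_join ?U A j \<longleftrightarrow> is_join A j"
    unfolding U.sg_join_iff U.cat.is_join_def le is_join_def by simp
qed

lemma pseudogroup_of_category:
  assumes "join_category C (\<lambda>_. ()) (\<lambda>_. ()) mul star"
  shows "pseudogroup \<lparr>carrier = C, sprod = mul\<rparr>"
proof -
  interpret join_category C "\<lambda>_. ()" "\<lambda>_. ()" mul star by fact
  interpret U: inverse_semigroup "\<lparr>carrier = C, sprod = mul\<rparr>"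
    by (rule inverse_semigroup_of_category(1)) unfold_locales
  note iff = one_object_iff[OF inverse_category_axioms]
  show ?thesis
  proof
    fix A assume "sg_compatible \<lparr>carrier = C, sprod = mul\<rparr> A"
    then have A: "coherent A" by (simp add: iff)
    then have "A \<subseteq> hom () ()" by (auto simp: hom_def dest: coherentD compatD(1))
    from join_ex[OF this A] show "\<exists>j. sg_join \<lparr>carrier = C, sprod = mul\<rparr> A j"
      by (auto simp: iff)
  qed (simp_all add: iff comp_join join_comp)
qed

section \<open>The identity of a pseudogroup\<close>

context pseudogroup
begin

text \<open>Idempotents are pairwise compatible and their join is idempotent by
  \<open>idem_join\<close>, so it is the top idempotent that \<open>sg_ident\<close>
  describes.\<close>

lemma sg_ident: "cat.idem (sg_ident S)" "cat.is_join (Collect cat.idem) (sg_ident S)"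
proof -
  have "cat.coherent (Collect cat.idem)" by (simp add: cat.coherent_def cat.compat_idem)
  then obtain a where a: "cat.is_join (Collect cat.idem) a"
    using cat.join_ex[of "Collect cat.idem" "()" "()"] cat.idemD(1)
    by (auto simp: cat.hom_def)
  have i: "cat.idem a" by (rule cat.idem_join[OF a]) simp_all
  have "sg_ident S = a" unfolding sg_ident_def
  proof (rule the_equality)
    show "a \<in> idems S \<and> (\<forall>f\<in>idems S. sg_le S f a)"
      using i cat.is_joinD(2)[OF a] by (simp add: idems_iff sg_le_iff)
    show "e = a" if "e \<in> idems S \<and> (\<forall>f\<in>idems S. sg_le S f e)" for e
      using that i cat.is_joinD(2)[OF a] by (auto simp: idems_iff sg_le_iff intro: cat.le_antisym)
  qed
  then show "cat.idem (sg_ident S)" "cat.is_join (Collect cat.idem) (sg_ident S)"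
    using a i by simp_all
qed

lemma sg_ident_closed [simp]: "sg_ident S \<in> carrier S"
  using sg_ident(1) cat.idemD by auto

lemma idem_le_ident: "cat.idem e \<Longrightarrow> cat.le e (sg_ident S)"
  using cat.is_joinD(2)[OF sg_ident(2)] by simp

text \<open>The top idempotent fixes the range projection of \<open>s\<close>, and \<open>s\<close>
  absorbs that projection.\<close>

lemma ident_prod [simp]: assumes "s \<in> carrier S" shows "sg_ident S \<cdot> s = s"
proof -
  have "sg_ident S \<cdot> (s \<cdot> sg_inv S s) = s \<cdot> sg_inv S s"
    using cat.le_idem_eq(1)[OF idem_le_ident sg_ident(1)] assms by simp
  then show ?thesis using assms cat.comp_assoc[of "sg_ident S" "s \<cdot> sg_inv S s" s]
    by (simp add: cat.comp_star_comp)
qed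

lemma prod_ident [simp]: assumes "s \<in> carrier S" shows "s \<cdot> sg_ident S = s"
  using cat.star_comp[of "sg_ident S" "sg_inv S s"] cat.idem_star[OF sg_ident(1)] assms by simp

lemma sg_ident_eq: assumes "cat.idem e" "\<And>f. cat.idem f \<Longrightarrow> cat.le f e" shows "sg_ident S = e"
  using assms sg_ident(1) idem_le_ident by (blast intro: cat.le_antisym)

end

section \<open>Matrices over a category with joins\<close>

context join_category
begin

text \<open>Distinct entries in a row have orthogonal ranges, distinct entries in a column orthogonal
  domains; so all joins in a matrix product are joins of orthogonal families.\<close>

definition is_mat :: "('i \<Rightarrow> 'i \<Rightarrow> 'w) \<Rightarrow> bool" where
  "is_mat f \<longleftrightarrow> (\<forall>i j. f i j \<in> hom i j) \<and>
     (\<forall>i j k. j \<noteq> k \<longrightarrow> (f i j)\<^sup>\<star> \<odot> f i k = zero j k) \<and>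
     (\<forall>i j k. i \<noteq> k \<longrightarrow> f i j \<odot> (f k j)\<^sup>\<star> = zero i k)"

definition mprod :: "('i \<Rightarrow> 'i \<Rightarrow> 'w) \<Rightarrow> ('i \<Rightarrow> 'i \<Rightarrow> 'w) \<Rightarrow> 'i \<Rightarrow> 'i \<Rightarrow> 'w" where
  "mprod f g i k = Join i k (range (\<lambda>j. f i j \<odot> g j k))"

definition mstar :: "('i \<Rightarrow> 'i \<Rightarrow> 'w) \<Rightarrow> 'i \<Rightarrow> 'i \<Rightarrow> 'w" where
  "mstar f i j = (f j i)\<^sup>\<star>"

definition single :: "'i \<Rightarrow> 'i \<Rightarrow> 'w \<Rightarrow> 'i \<Rightarrow> 'i \<Rightarrow> 'w" where
  "single i k a i' k' = (if i' = i \<and> k' = k then a else zero i' k')"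

context
  notes [simp] = src_comp tgt_comp src_star tgt_star src_zero tgt_zero
begin

section \<open>Product and adjoint of matrices\<close>

lemma matD: assumes "is_mat f"
  shows "f i j \<in> C" "src (f i j) = i" "tgt (f i j) = j"
    "j \<noteq> k \<Longrightarrow> (f i j)\<^sup>\<star> \<odot> f i k = zero j k" "i \<noteq> k \<Longrightarrow> f i j \<odot> (f k j)\<^sup>\<star> = zero i k"
  using assms by (auto simp: is_mat_def hom_iff)

lemma mat_mstar: "is_mat f \<Longrightarrow> is_mat (mstar f)"
  by (simp add: is_mat_def mstar_def hom_iff)

lemma mstar_mstar: "is_mat f \<Longrightarrow> mstar (mstar f) = f"
  by (intro ext) (simp add: mstar_def matD)

text \<open>Terms with distinct middle indices are orthogonal: in one mixed product the inner factor
  vanishes by row orthogonality of \<open>f\<close>, in the other by column orthogonality of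
  \<open>g\<close>.\<close>

lemma mprod_coherent: assumes "is_mat f" "is_mat g" shows "coherent (range (\<lambda>j. f i j \<odot> g j k))"
proof -
  note f = matD[OF assms(1)] and g = matD[OF assms(2)]
  have "compat (f i j \<odot> g j k) (f i j' \<odot> g j' k)" for j j'
  proof (cases "j = j'")
    case True
    then show ?thesis using f g by (simp add: compat_refl)
  next
    case False
    have "(f i j \<odot> g j k)\<^sup>\<star> \<odot> (f i j' \<odot> g j' k) = (g j k)\<^sup>\<star> \<odot> ((f i j)\<^sup>\<star> \<odot> f i j' \<odot> g j' k)"
      using f(1-3) g(1-3) by (simp add: star_comp comp_assoc)
    then have 1: "(f i j \<odot> g j k)\<^sup>\<star> \<odot> (f i j' \<odot> g j' k) = zero k k"
      using False f g by simp
    have "(f i j \<odot> g j k) \<odot> (f i j' \<odot> g j' k)\<^sup>\<star> = f i j \<odot> (g j k \<odot> (g j' k)\<^sup>\<star> \<odot> (f i j')\<^sup>\<star>)"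
      using f(1-3) g(1-3) by (simp add: star_comp comp_assoc)
    then have 2: "(f i j \<odot> g j k) \<odot> (f i j' \<odot> g j' k)\<^sup>\<star> = zero i i"
      using False f g by simp
    show ?thesis by (rule compat_of_orthogonal) (use f g 1 2 in simp_all)
  qed
  then show ?thesis by (auto simp: coherent_def)
qed

lemma mprod: assumes "is_mat f" "is_mat g"
  shows "is_join (range (\<lambda>j. f i j \<odot> g j k)) (mprod f g i k)"
    and "mprod f g i k \<in> C" "src (mprod f g i k) = i" "tgt (mprod f g i k) = k"
proof -
  have "range (\<lambda>j. f i j \<odot> g j k) \<subseteq> hom i k"
    using matD[OF assms(1)] matD[OF assms(2)] by (auto simp: hom_iff)
  note J = Join[OF this mprod_coherent[OF assms]]
  then show "is_join (range (\<lambda>j. f i j \<odot> g j k)) (mprod f g i k)"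
    and "mprod f g i k \<in> C" "src (mprod f g i k) = i" "tgt (mprod f g i k) = k"
    by (simp_all add: mprod_def hom_iff)
qed

lemma mprod_eq:
  "\<lbrakk>is_join (range (\<lambda>j. f i j \<odot> g j k)) a; a \<in> C; src a = i; tgt a = k\<rbrakk> \<Longrightarrow> mprod f g i k = a"
  unfolding mprod_def by (rule Join_eq) (simp_all add: hom_iff)

lemma mprod_single:
  assumes "is_mat f" "is_mat g" "\<And>j. j \<noteq> j0 \<Longrightarrow> f i j \<odot> g j k = zero i k"
  shows "mprod f g i k = f i j0 \<odot> g j0 k"
proof (rule mprod_eq)
  note f = matD[OF assms(1)] and g = matD[OF assms(2)]
  show "is_join (range (\<lambda>j. f i j \<odot> g j k)) (f i j0 \<odot> g j0 k)"
  proof (rule is_join_greatest)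
    fix a assume "a \<in> range (\<lambda>j. f i j \<odot> g j k)"
    then obtain j where "a = f i j \<odot> g j k" by auto
    then show "le a (f i j0 \<odot> g j0 k)"
      using assms(3)[of j] f g by (cases "j = j0") (simp_all add: le_refl zero_le)
  qed auto
qed (use matD[OF assms(1)] matD[OF assms(2)] in simp_all)

lemma mstar_mprod: assumes "is_mat f" "is_mat g"
  shows "mstar (mprod f g) = mprod (mstar g) (mstar f)"
proof (intro ext)
  fix i k
  note f = matD[OF assms(1)] and g = matD[OF assms(2)]
  have "star ` range (\<lambda>j. f k j \<odot> g j i) = range (\<lambda>j. mstar g i j \<odot> mstar f j k)"
    unfolding image_image by (rule image_cong) (use f g in \<open>simp_all add: mstar_def star_comp\<close>)
  then have "is_join (range (\<lambda>j. mstar g i j \<odot> mstar f j k)) (mstar (mprod f g) i k)"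
    using is_join_star[OF mprod(1)[OF assms, of k i]] by (simp add: mstar_def)
  then show "mstar (mprod f g) i k = mprod (mstar g) (mstar f) i k"
    by (rule mprod_eq[symmetric]) (use mprod[OF assms] in \<open>simp_all add: mstar_def\<close>)
qed

text \<open>Terms with distinct middle indices vanish by row orthogonality of \<open>f\<close>. For
  equal ones the inner factor is a projection, so the term lies below
  \<open>(g j k)\<^sup>\<star> \<odot> g j l\<close>, which is zero by row orthogonality of
  \<open>g\<close>.\<close>

lemma mprod_row_orthogonal: assumes "is_mat f" "is_mat g" "k \<noteq> l"
  shows "(mprod f g i k)\<^sup>\<star> \<odot> mprod f g i l = zero k l"
proof -
  note f = matD[OF assms(1)] and g = matD[OF assms(2)]
  note p = mprod[OF assms(1,2)]
  have orth: "(f i j \<odot> g j k)\<^sup>\<star> \<odot> (f i j' \<odot> g j' l) = zero k l" for j j'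
  proof -
    have eq: "(f i j \<odot> g j k)\<^sup>\<star> \<odot> (f i j' \<odot> g j' l) = (g j k)\<^sup>\<star> \<odot> ((f i j)\<^sup>\<star> \<odot> f i j' \<odot> g j' l)"
      using f(1-3) g(1-3) by (simp add: star_comp comp_assoc)
    show ?thesis
    proof (cases "j = j'")
      case True
      have "le ((g j k)\<^sup>\<star> \<odot> ((f i j)\<^sup>\<star> \<odot> f i j \<odot> g j l)) ((g j k)\<^sup>\<star> \<odot> g j l)"
        using f(1-3) g(1-3) by (intro le_comp le_left le_refl) simp_all
      then show ?thesis unfolding eq using True g(4)[OF assms(3), of j] le_zero by simp
    next
      case False
      then show ?thesis unfolding eq using f g by simp
    qed
  qed
  have "(mprod f g i k)\<^sup>\<star> \<odot> mprod f g i l =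
      zero (src ((mprod f g i k)\<^sup>\<star>)) (tgt (mprod f g i l))"
    by (rule comp_join_zero[OF is_join_star[OF p(1)] p(1)]) (use p(2-4) orth in auto)
  then show ?thesis using p(2-4) by simp
qed

lemma mat_mprod: assumes "is_mat f" "is_mat g" shows "is_mat (mprod f g)"
proof -
  \<comment> \<open>Column orthogonality is row orthogonality of the adjoint product.\<close>
  have "mprod f g i j \<odot> (mprod f g k j)\<^sup>\<star> = zero i k" if "i \<noteq> k" for i j k
    using mprod_row_orthogonal[OF mat_mstar[OF assms(2)] mat_mstar[OF assms(1)] that, of j]
    unfolding mstar_mprod[OF assms, symmetric] mstar_def by (simp add: mprod[OF assms])
  then show ?thesis
    using mprod[OF assms] mprod_row_orthogonal[OF assms] by (simp add: is_mat_def hom_iff)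
qed

text \<open>Both sides are the join of the double family
  \<open>f i j \<odot> g j k \<odot> h k l\<close>, grouped by \<open>k\<close> or by
  \<open>j\<close>.\<close>

lemma mprod_assoc: assumes "is_mat f" "is_mat g" "is_mat h"
  shows "mprod (mprod f g) h = mprod f (mprod g h)"
proof (intro ext)
  fix i l
  note f = matD(1-3)[OF assms(1)] and g = matD(1-3)[OF assms(2)] and h = matD(1-3)[OF assms(3)]
  note fg = mat_mprod[OF assms(1,2)] and gh = mat_mprod[OF assms(2,3)]
  note p = mprod[OF assms(1,2)] and q = mprod[OF assms(2,3)]
  note r = mprod[OF fg assms(3)] and s = mprod[OF assms(1) gh]
  have "is_join (\<Union>k\<in>UNIV. (\<lambda>x. x \<odot> h k l) ` range (\<lambda>j. f i j \<odot> g j k)) (mprod (mprod f g) h i l)"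
    by (subst is_join_UN_iff[where f = "\<lambda>k. mprod f g i k \<odot> h k l"])
      (use p r h in \<open>simp_all add: join_comp\<close>)
  moreover have "is_join (\<Union>j\<in>UNIV. (\<odot>) (f i j) ` range (\<lambda>k. g j k \<odot> h k l)) (mprod f (mprod g h) i l)"
    by (subst is_join_UN_iff[where f = "\<lambda>j. f i j \<odot> mprod g h j l"])
      (use q s f in \<open>simp_all add: comp_join\<close>)
  moreover have "(\<Union>k\<in>UNIV. (\<lambda>x. x \<odot> h k l) ` range (\<lambda>j. f i j \<odot> g j k)) =
      (\<Union>j\<in>UNIV. (\<odot>) (f i j) ` range (\<lambda>k. g j k \<odot> h k l))"
  proof -
    have "f i j \<odot> g j k \<odot> h k l = f i j \<odot> (g j k \<odot> h k l)" for j k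
      using f g h by (simp add: comp_assoc)
    then show ?thesis by (simp only: image_image) blast
  qed
  ultimately show "mprod (mprod f g) h i l = mprod f (mprod g h) i l"
    by (intro is_join_unique[of _ "mprod (mprod f g) h i l"]) (simp_all add: r(3,4) s(3,4))
qed

text \<open>Off the diagonal every term vanishes by column orthogonality; on it the terms are range
  projections, whose join is idempotent.\<close>

lemma mprod_mstar: assumes "is_mat f"
  shows "i \<noteq> j \<Longrightarrow> mprod f (mstar f) i j = zero i j" and "idem (mprod f (mstar f) i i)"
proof -
  note f = matD[OF assms] and p = mprod[OF assms mat_mstar[OF assms]]
  show "mprod f (mstar f) i j = zero i j" if "i \<noteq> j"
    using is_join_zeros[OF p(1)[of i j]] p(3,4) f(5)[OF that] by (simp add: mstar_def image_iff)
  show "idem (mprod f (mstar f) i i)"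
    by (rule idem_join[OF p(1)]) (use p(2-4) f in \<open>auto simp: mstar_def\<close>)
qed

lemma mprod_diag: assumes "is_mat f" "is_mat g" "\<And>i j. i \<noteq> j \<Longrightarrow> f i j = zero i j"
  shows "mprod f g i k = f i i \<odot> g i k"
  by (rule mprod_single[OF assms(1,2)]) (use assms(3) matD[OF assms(2)] in simp)

text \<open>The case \<open>f = g\<close> is the law that makes \<open>mstar\<close> an inverse.
  After distributing, the term with middle index \<open>j \<noteq> k\<close> vanishes because
  \<open>(f i j)\<^sup>\<star> \<odot> g i k\<close> lies below
  \<open>(g i j)\<^sup>\<star> \<odot> g i k = zero j k\<close>; the term \<open>j = k\<close> is
  \<open>f i k\<close>.\<close>

lemma mprod_mstar_mprod_eq: assumes "is_mat f" "is_mat g" "\<And>i j. le (f i j) (g i j)"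
  shows "mprod (mprod f (mstar f)) g = f"
proof (intro ext)
  fix i k
  note f = matD[OF assms(1)] and g = matD[OF assms(2)]
  note ff = mat_mprod[OF assms(1) mat_mstar[OF assms(1)]]
  note p = mprod[OF assms(1) mat_mstar[OF assms(1)]]
  have "is_join ((\<lambda>x. x \<odot> g i k) ` range (\<lambda>j. f i j \<odot> mstar f j i)) (mprod f (mstar f) i i \<odot> g i k)"
    by (rule join_comp) (use p g in simp_all)
  moreover have "is_join ((\<lambda>x. x \<odot> g i k) ` range (\<lambda>j. f i j \<odot> mstar f j i)) (f i k)"
  proof (rule is_join_greatest)
    have k: "f i k \<odot> mstar f k i \<odot> g i k = f i k"
      using leD(5)[OF assms(3)[of i k]] by (simp add: mstar_def)
    then show "f i k \<in> (\<lambda>x. x \<odot> g i k) ` range (\<lambda>j. f i j \<odot> mstar f j i)"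
      unfolding image_image by (intro image_eqI[of _ _ k]) simp_all
    fix a assume "a \<in> (\<lambda>x. x \<odot> g i k) ` range (\<lambda>j. f i j \<odot> mstar f j i)"
    then obtain j where j: "a = f i j \<odot> mstar f j i \<odot> g i k" by auto
    show "le a (f i k)"
    proof (cases "j = k")
      case True
      then show ?thesis using j k f le_refl by simp
    next
      case False
      have "le ((f i j)\<^sup>\<star> \<odot> g i k) ((g i j)\<^sup>\<star> \<odot> g i k)"
        using assms(3) f g by (intro le_comp le_star le_refl) simp_all
      then have "(f i j)\<^sup>\<star> \<odot> g i k = zero j k" using g(4)[OF False] le_zero by simp
      then have "a = zero i k" using j f g by (simp add: mstar_def comp_assoc)
      then show ?thesis using f by (simp add: zero_le)
    qed
  qed
  ultimately have "mprod f (mstar f) i i \<odot> g i k = f i k"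
    by (rule is_join_unique) (use p f g in simp_all)
  then show "mprod (mprod f (mstar f)) g i k = f i k"
    using mprod_diag[OF ff assms(2)] mprod_mstar(1)[OF assms(1)] by simp
qed

lemma mprod_mstar_commute: assumes "is_mat f" "is_mat g"
  shows "mprod (mprod f (mstar f)) (mprod g (mstar g)) = mprod (mprod g (mstar g)) (mprod f (mstar f))"
proof (intro ext)
  fix i k
  note ff = mat_mprod[OF assms(1) mat_mstar[OF assms(1)]]
    and gg = mat_mprod[OF assms(2) mat_mstar[OF assms(2)]]
  note f = mprod_mstar[OF assms(1)] and g = mprod_mstar[OF assms(2)]
  have 1: "mprod (mprod f (mstar f)) (mprod g (mstar g)) i k =
      mprod f (mstar f) i i \<odot> mprod g (mstar g) i k"
    by (rule mprod_diag[OF ff gg f(1)])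
  have 2: "mprod (mprod g (mstar g)) (mprod f (mstar f)) i k =
      mprod g (mstar g) i i \<odot> mprod f (mstar f) i k"
    by (rule mprod_diag[OF gg ff g(1)])
  show "mprod (mprod f (mstar f)) (mprod g (mstar g)) i k =
      mprod (mprod g (mstar g)) (mprod f (mstar f)) i k"
  proof (cases "i = k")
    case True
    then show ?thesis using 1 2 idem_commute[OF f(2) g(2), of i i] matD[OF ff] matD[OF gg] by simp
  next
    case False
    then show ?thesis using 1 2 f(1) g(1) matD[OF ff] matD[OF gg] by simp
  qed
qed

section \<open>Matrices with one prescribed entry\<close>

lemma mat_single: assumes "a \<in> C" "src a = i" "tgt a = k" shows "is_mat (single i k a)"
  using assms by (auto simp: is_mat_def single_def hom_iff)

lemma single_mprod_single:
  assumes "a \<in> C" "src a = i" "tgt a = k" "b \<in> C" "src b = k" "tgt b = l"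
  shows "mprod (single i k a) (single k l b) = single i l (a \<odot> b)"
proof (intro ext)
  fix i' l'
  have "mprod (single i k a) (single k l b) i' l' = single i k a i' k \<odot> single k l b k l'"
    by (rule mprod_single) (use assms in \<open>simp_all add: mat_single\<close>, simp_all add: single_def)
  then show "mprod (single i k a) (single k l b) i' l' = single i l (a \<odot> b) i' l'"
    using assms by (simp add: single_def)
qed

lemma single_mprod:
  assumes "a \<in> C" "src a = i" "tgt a = k" "is_mat f"
  shows "mprod (single i k a) f i' l = (if i' = i then a \<odot> f k l else zero i' l)"
proof -
  have "mprod (single i k a) f i' l = single i k a i' k \<odot> f k l"
    by (rule mprod_single) (use assms matD[OF assms(4)] in \<open>simp_all add: mat_single\<close>, simp_all add: single_def)
  then show ?thesis using assms matD[OF assms(4)] by (simp add: single_def)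
qed

lemma mprod_single_right:
  assumes "a \<in> C" "src a = i" "tgt a = k" "is_mat f"
  shows "mprod f (single i k a) l k' = (if k' = k then f l i \<odot> a else zero l k')"
proof -
  have "mprod f (single i k a) l k' = f l i \<odot> single i k a i k'"
    by (rule mprod_single) (use assms matD[OF assms(4)] in \<open>simp_all add: mat_single\<close>, simp_all add: single_def)
  then show ?thesis using assms matD[OF assms(4)] by (simp add: single_def)
qed

end

end

text \<open>\<open>ent\<close> reads the entries of an encoded matrix and \<open>mk\<close> encodes a family of entries.\<close>

locale matrices = join_category C src tgt comp star
  for C :: "'w set" and src tgt :: "'w \<Rightarrow> 'i"
    and comp :: "'w \<Rightarrow> 'w \<Rightarrow> 'w" (infixl \<open>\<odot>\<close> 70)
    and star :: "'w \<Rightarrow> 'w" (\<open>_\<^sup>\<star>\<close> [1000] 1000) +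
  fixes ent :: "'m \<Rightarrow> 'i \<Rightarrow> 'i \<Rightarrow> 'w" and mk :: "('i \<Rightarrow> 'i \<Rightarrow> 'w) \<Rightarrow> 'm"
  assumes ent_mk: "(\<And>i j. f i j \<in> hom i j) \<Longrightarrow> ent (mk f) = f"
    and mk_ent [simp]: "mk (ent m) = m"
begin

definition mats :: "'m set" where "mats = {m. is_mat (ent m)}"

definition mult :: "'m \<Rightarrow> 'm \<Rightarrow> 'm" (infixl \<open>\<otimes>\<close> 70) where
  "m \<otimes> n = mk (mprod (ent m) (ent n))"

definition adj :: "'m \<Rightarrow> 'm" where "adj m = mk (mstar (ent m))"

lemma ent_mk_mat [simp]: "is_mat f \<Longrightarrow> ent (mk f) = f"
  by (rule ent_mk) (simp add: is_mat_def)

lemma mk_mats: "is_mat f \<Longrightarrow> mk f \<in> mats"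
  by (simp add: mats_def)

lemma ent_mult: "\<lbrakk>m \<in> mats; n \<in> mats\<rbrakk> \<Longrightarrow> ent (m \<otimes> n) = mprod (ent m) (ent n)"
  by (simp add: mats_def mult_def mat_mprod)

lemma ent_adj: "m \<in> mats \<Longrightarrow> ent (adj m) = mstar (ent m)"
  by (simp add: mats_def adj_def mat_mstar)

lemma mat_eqI: "ent m = ent n \<Longrightarrow> m = n"
  by (metis mk_ent)

lemma mult_in: "\<lbrakk>m \<in> mats; n \<in> mats\<rbrakk> \<Longrightarrow> m \<otimes> n \<in> mats"
  by (simp add: mats_def mult_def mat_mprod)

lemma adj_in: "m \<in> mats \<Longrightarrow> adj m \<in> mats"
  by (simp add: mats_def adj_def mat_mstar)

end

sublocale matrices \<subseteq> mat: inverse_category mats "\<lambda>_. ()" "\<lambda>_. ()" mult adj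
proof
  fix a b c assume a: "a \<in> mats"
  then have ma: "is_mat (ent a)" by (simp add: mats_def)
  show "adj (adj a) = a" using a ma by (intro mat_eqI) (simp add: ent_adj adj_in mstar_mstar)
  show "a \<otimes> adj a \<otimes> a = a"
    using a ma mprod_mstar_mprod_eq[OF ma ma] matD[OF ma]
    by (intro mat_eqI) (simp add: ent_mult ent_adj adj_in mult_in le_refl)
  assume b: "b \<in> mats"
  then have mb: "is_mat (ent b)" by (simp add: mats_def)
  show "adj (a \<otimes> b) = adj b \<otimes> adj a"
    using a b ma mb by (intro mat_eqI) (simp add: ent_mult ent_adj adj_in mult_in mstar_mprod)
  show "a \<otimes> adj a \<otimes> (b \<otimes> adj b) = b \<otimes> adj b \<otimes> (a \<otimes> adj a)"
    using a b ma mb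
    by (intro mat_eqI) (simp add: ent_mult ent_adj adj_in mult_in mprod_mstar_commute)
  assume c: "c \<in> mats"
  then have mc: "is_mat (ent c)" by (simp add: mats_def)
  show "a \<otimes> b \<otimes> c = a \<otimes> (b \<otimes> c)"
    using a b c ma mb mc by (intro mat_eqI) (simp add: ent_mult mult_in mprod_assoc)
qed (auto simp: mult_in adj_in)

context matrices
begin

context
  notes [simp] = src_comp tgt_comp src_star tgt_star src_zero tgt_zero
begin

section \<open>Order, compatibility and joins of matrices\<close>

lemma matsD: "m \<in> mats \<Longrightarrow> is_mat (ent m)"
  by (simp add: mats_def)

text \<open>The projection \<open>m \<otimes> adj m\<close> is diagonal with idempotent entries, so
  multiplying by it restricts each entry of \<open>n\<close> separately; the converse is
  \<open>mprod_mstar_mprod_eq\<close>.\<close>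

lemma mat_le_iff: assumes "m \<in> mats" "n \<in> mats"
  shows "mat.le m n \<longleftrightarrow> (\<forall>i j. le (ent m i j) (ent n i j))"
proof
  note m = matsD[OF assms(1)] and n = matsD[OF assms(2)]
  assume "mat.le m n"
  then have "ent m = mprod (mprod (ent m) (mstar (ent m))) (ent n)"
    using arg_cong[OF mat.leD(5), of m n ent] assms by (simp add: ent_mult ent_adj adj_in mult_in)
  then have eq: "ent m i j = mprod (ent m) (mstar (ent m)) i i \<odot> ent n i j" for i j
    using mprod_diag[OF mat_mprod[OF m mat_mstar[OF m]] n] mprod_mstar(1)[OF m] by metis
  have "le (mprod (ent m) (mstar (ent m)) i i \<odot> ent n i j) (ent n i j)" for i j
    by (rule le_left[OF mprod_mstar(2)[OF m]]) (use matD[OF n] mprod[OF m mat_mstar[OF m]] in simp_all)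
  then show "\<forall>i j. le (ent m i j) (ent n i j)" by (simp add: eq[symmetric])
next
  note m = matsD[OF assms(1)] and n = matsD[OF assms(2)]
  assume "\<forall>i j. le (ent m i j) (ent n i j)"
  then have "ent (m \<otimes> adj m \<otimes> n) = ent m"
    using mprod_mstar_mprod_eq[OF m n] assms by (simp add: ent_mult ent_adj adj_in mult_in)
  then show "mat.le m n" using assms mat_eqI by (metis mat.le_def)
qed

text \<open>Idempotents are self-adjoint, so \<open>p = p \<otimes> adj p\<close> and
  \<open>mprod_mstar\<close> applies.\<close>

lemma mat_idem_entries: assumes "mat.idem p"
  shows "i \<noteq> j \<Longrightarrow> ent p i j = zero i j" "idem (ent p i i)"
proof -
  have p: "p \<in> mats" using mat.idemD[OF assms] by simp
  have "p = p \<otimes> adj p" using mat.idem_star[OF assms] mat.idemD[OF assms] by simp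
  then have e: "ent p = mprod (ent p) (mstar (ent p))"
    using ent_mult[OF p adj_in[OF p]] ent_adj[OF p] by simp
  show "ent p i j = zero i j" if "i \<noteq> j"
    by (subst e) (rule mprod_mstar(1)[OF matsD[OF p] that])
  show "idem (ent p i i)"
    by (subst e) (rule mprod_mstar(2)[OF matsD[OF p]])
qed

text \<open>The composite is one term of the join that forms the entry \<open>j k\<close> of
  \<open>adj m \<otimes> n\<close>. That matrix is idempotent by compatibility, hence diagonal with
  idempotent entries.\<close>

lemma mat_compat_row: assumes "mat.compat m n"
  shows "j \<noteq> k \<Longrightarrow> (ent m i j)\<^sup>\<star> \<odot> ent n i k = zero j k" "idem ((ent m i j)\<^sup>\<star> \<odot> ent n i j)"
proof -
  note mn = mat.compatD[OF assms]
  note m = matsD[OF mn(1)] and n = matsD[OF mn(2)]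
  have le: "le ((ent m i j)\<^sup>\<star> \<odot> ent n i k) (ent (adj m \<otimes> n) j k)" for k
    using is_joinD(2)[OF mprod(1)[OF mat_mstar[OF m] n, of j k]] mn(1,2)
    by (auto simp: mstar_def ent_mult ent_adj adj_in)
  show "(ent m i j)\<^sup>\<star> \<odot> ent n i k = zero j k" if "j \<noteq> k"
    using le[of k] mat_idem_entries(1)[OF mn(5) that] le_zero by simp
  show "idem ((ent m i j)\<^sup>\<star> \<odot> ent n i j)"
    using le_idem[OF le[of j] mat_idem_entries(2)[OF mn(5)]] .
qed

text \<open>The column statements are the row statements for the adjoint matrices.\<close>

lemma mat_compat_entries: assumes "mat.compat m n"
  shows "i \<noteq> k \<Longrightarrow> ent m i j \<odot> (ent n k j)\<^sup>\<star> = zero i k" "compat (ent m i j) (ent n i j)"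
proof -
  note mn = mat.compatD[OF assms]
  note m = matD[OF matsD[OF mn(1)]] and n = matD[OF matsD[OF mn(2)]]
  note * = mat_compat_row[OF mat.compat_star[OF assms]]
  show "ent m i j \<odot> (ent n k j)\<^sup>\<star> = zero i k" if "i \<noteq> k"
    using *(1)[OF that, of j] mn m by (simp add: ent_adj mstar_def)
  have "idem (ent m i j \<odot> (ent n i j)\<^sup>\<star>)"
    using *(2)[of j i] mn m by (simp add: ent_adj mstar_def)
  then show "compat (ent m i j) (ent n i j)"
    using mat_compat_row(2)[OF assms] m n by (simp add: compat_def)
qed

lemma mat_join_of_entries:
  assumes "a \<in> mats" "A \<subseteq> mats" "\<And>i j. is_join ((\<lambda>m. ent m i j) ` A) (ent a i j)"
  shows "mat.is_join A a"
proof (rule mat.is_joinI)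
  show "mat.le m a" if "m \<in> A" for m
    using is_joinD(2)[OF assms(3)] that assms(1,2) by (auto simp: mat_le_iff)
  fix u assume u: "u \<in> mats" "\<And>m. m \<in> A \<Longrightarrow> mat.le m u"
  note a = matD[OF matsD[OF assms(1)]] and u' = matD[OF matsD[OF u(1)]]
  have "le (ent a i j) (ent u i j)" for i j
    by (rule is_joinD(3)[OF assms(3)]) (use u assms(2) a u' in \<open>auto simp: mat_le_iff subset_iff\<close>)
  then show "mat.le a u" using u assms(1) by (simp add: mat_le_iff)
qed (fact assms(1))

text \<open>The entrywise joins \<open>J\<close> form a matrix because compatible matrices are
  orthogonal across each other: an entry of one member of \<open>A\<close> against a differently
  placed entry in the same row or column of another gives zero, and \<open>comp_join_zero\<close>
  passes this to joins.\<close>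

lemma mat_join_ex: assumes "mat.coherent A"
  shows "\<exists>a\<in>mats. mat.is_join A a \<and> (\<forall>i j. is_join ((\<lambda>m. ent m i j) ` A) (ent a i j))"
proof -
  have A: "A \<subseteq> mats" using mat.coherentD[OF assms] mat.compatD(1) by auto
  define J where "J = (\<lambda>i j. Join i j ((\<lambda>m. ent m i j) ` A))"
  have J: "J i j \<in> C" "src (J i j) = i" "tgt (J i j) = j" "is_join ((\<lambda>m. ent m i j) ` A) (J i j)" for i j
  proof -
    have "(\<lambda>m. ent m i j) ` A \<subseteq> hom i j" using matD[OF matsD] A by (auto simp: hom_iff)
    moreover have "coherent ((\<lambda>m. ent m i j) ` A)"
      using mat_compat_entries(2) mat.coherentD[OF assms] by (auto simp: coherent_def)
    ultimately show "J i j \<in> C" "src (J i j) = i" "tgt (J i j) = j" "is_join ((\<lambda>m. ent m i j) ` A) (J i j)"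
      using Join by (auto simp: J_def hom_iff)
  qed
  have "(J i j)\<^sup>\<star> \<odot> J i k = zero j k" if "j \<noteq> k" for i j k
  proof -
    have "(J i j)\<^sup>\<star> \<odot> J i k = zero (src ((J i j)\<^sup>\<star>)) (tgt (J i k))"
      by (rule comp_join_zero[OF is_join_star[OF J(4)] J(4)])
        (use J(1-3) mat_compat_row(1)[OF mat.coherentD[OF assms] that] in auto)
    then show ?thesis using J(1-3) by simp
  qed
  moreover have "J i j \<odot> (J k j)\<^sup>\<star> = zero i k" if "i \<noteq> k" for i j k
  proof -
    have "J i j \<odot> (J k j)\<^sup>\<star> = zero (src (J i j)) (tgt ((J k j)\<^sup>\<star>))"
      by (rule comp_join_zero[OF J(4) is_join_star[OF J(4)]])
        (use J(1-3) mat_compat_entries(1)[OF mat.coherentD[OF assms] that] in auto)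
    then show ?thesis using J(1-3) by simp
  qed
  ultimately have "is_mat J" using J(1-3) by (simp add: is_mat_def hom_iff)
  then show ?thesis
    using J(4) mat_join_of_entries[OF mk_mats A, of J] by (intro bexI[of _ "mk J"] mk_mats) auto
qed

text \<open>The entrywise join exists and is a join, so by uniqueness it is
  \<open>a\<close>.\<close>

lemma mat_is_joinD: assumes "mat.is_join A a" shows "is_join ((\<lambda>m. ent m i j) ` A) (ent a i j)"
  using mat_join_ex[OF mat.is_join_coherent[OF assms]] mat.is_join_unique[OF _ assms] by auto

end

end

sublocale matrices \<subseteq> mat: join_category mats "\<lambda>_. ()" "\<lambda>_. ()" mult adj
proof
  fix A i j assume "mat.coherent A"
  then show "\<exists>a\<in>mat.hom i j. mat.is_join A a"
    using mat_join_ex[of A] by (auto simp: mat.hom_def)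
next
  fix A a w assume A: "mat.is_join A a" and w: "w \<in> mats"
  have a: "a \<in> mats" and sub: "A \<subseteq> mats"
    using mat.is_joinD(1,2)[OF A] mat.leD(1) by auto
  note ma = matD[OF matsD[OF a]] and mw = matD[OF matsD[OF w]]
  note p = mprod[OF matsD[OF w]]
  show "mat.is_join ((\<otimes>) w ` A) (w \<otimes> a)"
  proof (rule mat_join_of_entries)
    fix i k
    \<comment> \<open>The double family indexed by a member \<open>m\<close> of \<open>A\<close> and
      a middle index \<open>j\<close>: grouped by \<open>j\<close> it gives the product with
      \<open>a\<close>, grouped by \<open>m\<close> the join of the products with the
      members.\<close>
    have *: "(\<Union>m\<in>A. range (\<lambda>j. ent w i j \<odot> ent m j k)) =
        (\<Union>j\<in>UNIV. (\<odot>) (ent w i j) ` (\<lambda>m. ent m j k) ` A)" by auto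
    have "is_join (\<Union>j\<in>UNIV. (\<odot>) (ent w i j) ` (\<lambda>m. ent m j k) ` A) (mprod (ent w) (ent a) i k)"
      by (subst is_join_UN_iff[where f = "\<lambda>j. ent w i j \<odot> ent a j k"])
        (use p[OF matsD[OF a]] ma mw mat_is_joinD[OF A] in
          \<open>simp_all add: comp_join src_comp tgt_comp\<close>)
    then have "is_join ((\<lambda>m. mprod (ent w) (ent m) i k) ` A) (mprod (ent w) (ent a) i k)"
      unfolding *[symmetric] using sub
      by (subst (asm) is_join_UN_iff[where f = "\<lambda>m. mprod (ent w) (ent m) i k"])
        (auto simp: p matsD a subset_iff)
    moreover have "(\<lambda>m. ent m i k) ` (\<otimes>) w ` A = (\<lambda>m. mprod (ent w) (ent m) i k) ` A"
      unfolding image_image using sub w by (intro image_cong) (auto simp: ent_mult)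
    ultimately show "is_join ((\<lambda>m. ent m i k) ` (\<otimes>) w ` A) (ent (w \<otimes> a) i k)"
      using a w by (simp add: ent_mult)
  qed (use a w sub mult_in in auto)
qed

text \<open>Only a right identity \<open>u\<close> has to be covered by products through
  \<open>e\<close>: since \<open>m = m \<cdot> u\<close>, multiplying the cover by \<open>m\<close>
  displays any \<open>m\<close> as a join of such products. The condition on triple products holds
  because \<open>e\<close> belongs to its own local semigroup.\<close>

lemma sup_enlargementI:
  assumes "pseudogroup U" "e \<in> idems U" "u \<in> carrier U" "\<And>m. m \<in> carrier U \<Longrightarrow> m \<cdot>\<^bsub>U\<^esub> u = m"
    and "sg_compatible U B" "sg_join U B u" "B \<subseteq> {a \<cdot>\<^bsub>U\<^esub> e \<cdot>\<^bsub>U\<^esub> b |a b. a \<in> carrier U \<and> b \<in> carrier U}"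
  shows "sup_enlargement U e"
proof -
  interpret U: pseudogroup U by fact
  have e: "e \<in> carrier U" "e \<cdot>\<^bsub>U\<^esub> e = e" using assms(2) by (auto simp: idems_def)
  note c = U.prod_closed U.prod_assoc e
  have ee: "e \<cdot>\<^bsub>U\<^esub> (e \<cdot>\<^bsub>U\<^esub> x) = e \<cdot>\<^bsub>U\<^esub> x" if "x \<in> carrier U" for x
    using that U.prod_assoc[OF e(1) e(1), of x] e by simp
  define L where "L = carrier (local_sg U e)"
  have L: "L = {e \<cdot>\<^bsub>U\<^esub> x \<cdot>\<^bsub>U\<^esub> e |x. x \<in> carrier U}" by (simp add: L_def local_sg_def)
  have eL: "e \<in> L" unfolding L using e by force
  have LC: "x \<in> carrier U" if "x \<in> L" for x using that by (auto simp: L c)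
  have Le: "e \<cdot>\<^bsub>U\<^esub> x = x" "x \<cdot>\<^bsub>U\<^esub> e = x" if "x \<in> L" for x
    using that by (auto simp: L c ee)
  have "L \<subseteq> set_prod U (set_prod U L (carrier U)) L"
  proof
    fix x assume x: "x \<in> L"
    then have "e \<cdot>\<^bsub>U\<^esub> x \<cdot>\<^bsub>U\<^esub> e = x" using Le by simp
    then show "x \<in> set_prod U (set_prod U L (carrier U)) L"
      using eL LC[OF x] unfolding set_prod_def by (smt (verit) mem_Collect_eq)
  qed
  moreover have "set_prod U (set_prod U L (carrier U)) L \<subseteq> L"
  proof
    fix x assume "x \<in> set_prod U (set_prod U L (carrier U)) L"
    then obtain a b v where *: "a \<in> L" "v \<in> carrier U" "b \<in> L" "x = a \<cdot>\<^bsub>U\<^esub> v \<cdot>\<^bsub>U\<^esub> b"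
      by (auto simp: set_prod_def)
    then have "x = (e \<cdot>\<^bsub>U\<^esub> a) \<cdot>\<^bsub>U\<^esub> v \<cdot>\<^bsub>U\<^esub> (b \<cdot>\<^bsub>U\<^esub> e)" using Le by simp
    then have "x = e \<cdot>\<^bsub>U\<^esub> (a \<cdot>\<^bsub>U\<^esub> v \<cdot>\<^bsub>U\<^esub> b) \<cdot>\<^bsub>U\<^esub> e" using *(1-3) LC by (simp add: c)
    moreover have "a \<cdot>\<^bsub>U\<^esub> v \<cdot>\<^bsub>U\<^esub> b \<in> carrier U" using *(1-3) LC by (simp add: U.prod_closed)
    ultimately show "x \<in> L" unfolding L by blast
  qed
  moreover have "carrier U \<subseteq> join_closure U (set_prod U (set_prod U (carrier U) L) (carrier U))"
  proof
    fix m assume m: "m \<in> carrier U"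
    have BC: "B \<subseteq> carrier U" using assms(5) by (simp add: sg_compatible_def)
    have join: "sg_join U ((\<lambda>b. m \<cdot>\<^bsub>U\<^esub> b) ` B) m"
      using U.join_distrib_left[OF assms(5,6) m] assms(4)[OF m] by simp
    then have "sg_compatible U ((\<lambda>b. m \<cdot>\<^bsub>U\<^esub> b) ` B)"
      using U.cat.is_join_coherent by (simp add: U.sg_compatible_iff U.sg_join_iff)
    moreover have "(\<lambda>b. m \<cdot>\<^bsub>U\<^esub> b) ` B \<subseteq> set_prod U (set_prod U (carrier U) L) (carrier U)"
    proof
      fix y assume "y \<in> (\<lambda>b. m \<cdot>\<^bsub>U\<^esub> b) ` B"
      then obtain a b where ab: "a \<in> carrier U" "b \<in> carrier U" "y = m \<cdot>\<^bsub>U\<^esub> (a \<cdot>\<^bsub>U\<^esub> e \<cdot>\<^bsub>U\<^esub> b)"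
        using assms(7) by blast
      then have "y = (m \<cdot>\<^bsub>U\<^esub> a) \<cdot>\<^bsub>U\<^esub> e \<cdot>\<^bsub>U\<^esub> b" using m by (simp add: c)
      moreover have "m \<cdot>\<^bsub>U\<^esub> a \<in> carrier U" using m ab by (simp add: c)
      ultimately show "y \<in> set_prod U (set_prod U (carrier U) L) (carrier U)"
        using eL ab(2) unfolding set_prod_def by blast
    qed
    ultimately show "m \<in> join_closure U (set_prod U (set_prod U (carrier U) L) (carrier U))"
      using join unfolding join_closure_def by blast
  qed
  moreover have "join_closure U (set_prod U (set_prod U (carrier U) L) (carrier U)) \<subseteq> carrier U"
    by (auto simp: join_closure_def sg_join_def)
  ultimately have "L = set_prod U (set_prod U L (carrier U)) L"
    "carrier U = join_closure U (set_prod U (set_prod U (carrier U) L) (carrier U))"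
    by blast+
  then show ?thesis
    unfolding sup_enlargement_def Let_def L_def[symmetric] using assms(1,2) by blast
qed

text \<open>By \<open>one_cover\<close> the arrows leaving any object \<open>i\<close> have domain
  projections that cover the identity of every object \<open>k\<close>. For a bimodule the cases
  \<open>i \<noteq> k\<close> are the two covering conditions.\<close>

locale unital_matrices = matrices C src tgt comp star ent mk
  for C :: "'w set" and src tgt :: "'w \<Rightarrow> 'i"
    and comp :: "'w \<Rightarrow> 'w \<Rightarrow> 'w" (infixl \<open>\<odot>\<close> 70)
    and star :: "'w \<Rightarrow> 'w" (\<open>_\<^sup>\<star>\<close> [1000] 1000)
    and ent :: "'m \<Rightarrow> 'i \<Rightarrow> 'i \<Rightarrow> 'w" and mk :: "('i \<Rightarrow> 'i \<Rightarrow> 'w) \<Rightarrow> 'm" +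
  fixes one :: "'i \<Rightarrow> 'w"
  assumes one_hom: "one i \<in> hom i i"
    and one_comp [simp]: "a \<in> C \<Longrightarrow> one (src a) \<odot> a = a"
    and comp_one [simp]: "a \<in> C \<Longrightarrow> a \<odot> one (tgt a) = a"
    and one_cover: "is_join ((\<lambda>x. x\<^sup>\<star> \<odot> x) ` hom i k) (one k)"
begin

definition mat_sg :: "'m semigrp" where "mat_sg = \<lparr>carrier = mats, sprod = (\<otimes>)\<rparr>"

definition corner :: "'i \<Rightarrow> 'm" where "corner i = mk (single i i (one i))"

lemma mat_sg_simps [simp]: "carrier mat_sg = mats" "sprod mat_sg = (\<otimes>)"
  by (simp_all add: mat_sg_def)

lemma pseudogroup_mat_sg: "pseudogroup mat_sg"
  unfolding mat_sg_def by (rule pseudogroup_of_category) unfold_locales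

lemma mat_sg_iff:
  "e \<in> idems mat_sg \<longleftrightarrow> mat.idem e" "sg_compatible mat_sg A \<longleftrightarrow> mat.coherent A"
  "sg_join mat_sg A j \<longleftrightarrow> mat.is_join A j"
  unfolding mat_sg_def by (rule one_object_iff[OF mat.inverse_category_axioms])+

context
  notes [simp] = src_comp tgt_comp src_star tgt_star src_zero tgt_zero
begin

section \<open>Corners of the matrix pseudogroup\<close>

lemma one_simps [simp]: "one i \<in> C" "src (one i) = i" "tgt (one i) = i" "one i \<odot> one i = one i"
  using one_hom[of i] one_comp[of "one i"] by (auto simp: hom_iff)

lemma mk_single_in [simp]: "\<lbrakk>a \<in> C; src a = i; tgt a = k\<rbrakk> \<Longrightarrow> mk (single i k a) \<in> mats"
  by (intro mk_mats mat_single)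

lemma mk_single_mult:
  "\<lbrakk>a \<in> C; src a = i; tgt a = k; b \<in> C; src b = k; tgt b = l\<rbrakk>
     \<Longrightarrow> mk (single i k a) \<otimes> mk (single k l b) = mk (single i l (a \<odot> b))"
  by (intro mat_eqI) (simp add: ent_mult mat_single single_mprod_single)

lemma corner_idem: "mat.idem (corner i)"
  by (simp add: mat.idem_def corner_def mk_single_mult)

lemma corner_mult_corner: assumes "m \<in> mats"
  shows "corner i \<otimes> m \<otimes> corner i = mk (single i i (ent m i i))"
proof (intro mat_eqI ext)
  fix j k
  note m = matsD[OF assms]
  have [simp]: "one i \<odot> ent m i i = ent m i i" "ent m i i \<odot> one i = ent m i i"
    using one_comp[of "ent m i i"] comp_one[of "ent m i i"] matD[OF m] by simp_all
  have c: "corner i \<in> mats" by (simp add: corner_def)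
  have "ent (corner i \<otimes> m \<otimes> corner i) j k =
      mprod (mprod (single i i (one i)) (ent m)) (single i i (one i)) j k"
    using assms c by (simp add: ent_mult mult_in) (simp add: corner_def mat_single)
  also have "\<dots> = single i i (ent m i i) j k"
    using m matD[OF m] mat_mprod[OF mat_single[of "one i" i i] m]
    by (simp add: mprod_single_right single_mprod) (simp add: single_def)
  finally show "ent (corner i \<otimes> m \<otimes> corner i) j k = ent (mk (single i i (ent m i i))) j k"
    using matD[OF m] by (simp add: mat_single)
qed

lemma carrier_local_corner:
  "carrier (local_sg mat_sg (corner i)) = (\<lambda>a. mk (single i i a)) ` hom i i"
proof -
  have "{corner i \<otimes> m \<otimes> corner i |m. m \<in> mats} = (\<lambda>a. mk (single i i a)) ` hom i i"
  proof (rule subset_antisym; rule subsetI)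
    fix x assume "x \<in> {corner i \<otimes> m \<otimes> corner i |m. m \<in> mats}"
    then show "x \<in> (\<lambda>a. mk (single i i a)) ` hom i i"
      using corner_mult_corner matD[OF matsD] by (auto simp: hom_iff)
  next
    fix x assume "x \<in> (\<lambda>a. mk (single i i a)) ` hom i i"
    then obtain a where a: "a \<in> C" "src a = i" "tgt a = i" "x = mk (single i i a)"
      by (auto simp: hom_iff)
    then have "x = corner i \<otimes> x \<otimes> corner i"
      using corner_mult_corner[of x i] by (simp add: mat_single) (simp add: single_def)
    moreover have "x \<in> mats" using a by simp
    ultimately show "x \<in> {corner i \<otimes> m \<otimes> corner i |m. m \<in> mats}" by blast
  qed
  then show ?thesis by (simp add: local_sg_def)
qed

lemma isomorphic_corner:
  assumes "bij_betw h (carrier S) (hom i i)"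
    and "\<And>s t. \<lbrakk>s \<in> carrier S; t \<in> carrier S\<rbrakk> \<Longrightarrow> h (s \<cdot>\<^bsub>S\<^esub> t) = h s \<odot> h t"
  shows "sg_isomorphic S (local_sg mat_sg (corner i))"
proof -
  have "inj_on (\<lambda>a. mk (single i i a)) (hom i i)"
  proof (rule inj_onI)
    fix a b assume a: "a \<in> hom i i" "b \<in> hom i i" "mk (single i i a) = mk (single i i b)"
    then have "single i i a = single i i b"
      using ent_mk_mat[OF mat_single] by (metis hom_iff)
    then have "single i i a i i = single i i b i i" by simp
    then show "a = b" by (simp add: single_def)
  qed
  then have "bij_betw (\<lambda>a. mk (single i i a)) (hom i i) (carrier (local_sg mat_sg (corner i)))"
    by (simp add: bij_betw_def carrier_local_corner)
  then have "bij_betw ((\<lambda>a. mk (single i i a)) \<circ> h) (carrier S) (carrier (local_sg mat_sg (corner i)))"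
    using assms(1) bij_betw_trans by blast
  moreover have "((\<lambda>a. mk (single i i a)) \<circ> h) (s \<cdot>\<^bsub>S\<^esub> t) =
      ((\<lambda>a. mk (single i i a)) \<circ> h) s \<cdot>\<^bsub>local_sg mat_sg (corner i)\<^esub> ((\<lambda>a. mk (single i i a)) \<circ> h) t"
    if "s \<in> carrier S" "t \<in> carrier S" for s t
  proof -
    have "h s \<in> hom i i" "h t \<in> hom i i" using assms(1) that by (auto simp: bij_betw_def)
    then show ?thesis
      using assms(2)[OF that] by (simp add: local_sg_def mk_single_mult hom_iff)
  qed
  ultimately show ?thesis unfolding sg_isomorphic_def by blast
qed

text \<open>The identity matrix \<open>D\<close> is, by \<open>one_cover\<close>, the join of the
  single-entry projections collected in \<open>B\<close>. Each of them factors through the corner,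
  as \<open>x\<^sup>\<star>\<close> followed by \<open>one i\<close> and \<open>x\<close> for an
  arrow \<open>x\<close> from \<open>i\<close> to \<open>k\<close>.\<close>

lemma sup_enlargement_corner: "sup_enlargement mat_sg (corner i)"
proof -
  define D where "D = (\<lambda>j k. if j = k then one j else zero j k)"
  define B where "B = {mk (single k k (x\<^sup>\<star> \<odot> x)) |k x. x \<in> hom i k}"
  have one_star: "(one k)\<^sup>\<star> = one k" for k by (rule idem_star) (simp add: idem_def)
  have D: "is_mat D"
    by (auto simp: is_mat_def D_def hom_iff one_star)
  have "B \<subseteq> mats" by (auto simp: B_def hom_iff)
  moreover have "is_join ((\<lambda>m. ent m j k) ` B) (ent (mk D) j k)" for j k
  proof (rule is_joinI)
    show "ent (mk D) j k \<in> C" using D matD by simp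
    fix a assume "a \<in> (\<lambda>m. ent m j k) ` B"
    then obtain l x where x: "x \<in> hom i l" "a = single l l (x\<^sup>\<star> \<odot> x) j k"
      by (auto simp: B_def hom_iff mat_single)
    show "le a (ent (mk D) j k)"
    proof (cases "j = l \<and> k = l")
      case True
      then show ?thesis
        using x D is_joinD(2)[OF one_cover[of i l]] by (auto simp: single_def D_def)
    next
      case False
      then have "a = zero j k" using x by (auto simp: single_def)
      then show ?thesis using matD(1-3)[OF D] D by (simp add: zero_le)
    qed
  next
    fix u assume u: "u \<in> C" "src u = src (ent (mk D) j k)" "tgt u = tgt (ent (mk D) j k)"
      "\<And>a. a \<in> (\<lambda>m. ent m j k) ` B \<Longrightarrow> le a u"
    have jk: "src u = j" "tgt u = k" using u(2,3) D matD(2,3)[OF D] by simp_all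
    show "le (ent (mk D) j k) u"
    proof (cases "j = k")
      case True
      have "le (one j) u"
      proof (rule is_joinD(3)[OF one_cover[of i j]])
        fix a assume "a \<in> (\<lambda>x. x\<^sup>\<star> \<odot> x) ` hom i j"
        then obtain x where x: "x \<in> hom i j" "a = x\<^sup>\<star> \<odot> x" by auto
        then have "mk (single j j a) \<in> B" by (auto simp: B_def)
        then have "ent (mk (single j j a)) j k \<in> (\<lambda>m. ent m j k) ` B" by (rule imageI)
        then have "le (ent (mk (single j j a)) j k) u" by (rule u(4))
        then show "le a u" using x True by (simp add: mat_single hom_iff) (simp add: single_def)
      qed (use u(1) jk True in simp_all)
      then show ?thesis using True D by (simp add: D_def)
    next
      case False
      then show ?thesis using D u(1) jk by (simp add: D_def zero_le)
    qed
  qed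
  ultimately have join: "mat.is_join B (mk D)" by (intro mat_join_of_entries mk_mats D)
  show ?thesis
  proof (rule sup_enlargementI[OF pseudogroup_mat_sg])
    show "corner i \<in> idems mat_sg" by (simp add: mat_sg_iff corner_idem)
    show "mk D \<in> carrier mat_sg" using mk_mats[OF D] by simp
    show "sg_compatible mat_sg B" using mat.is_join_coherent[OF join] by (simp add: mat_sg_iff)
    show "sg_join mat_sg B (mk D)" using join by (simp add: mat_sg_iff)
    show "m \<cdot>\<^bsub>mat_sg\<^esub> mk D = m" if "m \<in> carrier mat_sg" for m
    proof (intro mat_eqI ext)
      fix j k
      have m: "m \<in> mats" "is_mat (ent m)" using that matsD by auto
      have "mprod (ent m) D j k = ent m j k \<odot> D k k"
        by (rule mprod_single[OF m(2) D]) (use matD[OF m(2)] in \<open>simp add: D_def\<close>)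
      also have "\<dots> = ent m j k"
        using comp_one[of "ent m j k"] matD[OF m(2)] by (simp add: D_def)
      finally show "ent (m \<cdot>\<^bsub>mat_sg\<^esub> mk D) j k = ent m j k"
        using m D mk_mats[OF D] by (simp add: ent_mult)
    qed
    show "B \<subseteq> {a \<cdot>\<^bsub>mat_sg\<^esub> corner i \<cdot>\<^bsub>mat_sg\<^esub> b |a b. a \<in> carrier mat_sg \<and> b \<in> carrier mat_sg}"
    proof
      fix b assume "b \<in> B"
      then obtain k x where x: "x \<in> C" "src x = i" "tgt x = k" "b = mk (single k k (x\<^sup>\<star> \<odot> x))"
        by (auto simp: B_def hom_iff)
      have "x\<^sup>\<star> \<odot> one i = x\<^sup>\<star>" using comp_one[of "x\<^sup>\<star>"] x by simp
      then have "b = mk (single k i (x\<^sup>\<star>)) \<otimes> corner i \<otimes> mk (single i k x)"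
        using x by (simp add: corner_def mk_single_mult)
      moreover have "mk (single k i (x\<^sup>\<star>)) \<in> mats" "mk (single i k x) \<in> mats" using x by simp_all
      ultimately show "b \<in> {a \<cdot>\<^bsub>mat_sg\<^esub> corner i \<cdot>\<^bsub>mat_sg\<^esub> b |a b. a \<in> carrier mat_sg \<and> b \<in> carrier mat_sg}"
        by auto
    qed
  qed
qed

end

end

section \<open>The two-object category of a bimodule\<close>

context biaction
begin

lemma linn_lact_right: assumes "s \<in> carrier S" "x \<in> carrier X" "y \<in> carrier X"
  shows "linn X x (lact X s y) = linn X x y \<cdot>\<^bsub>S\<^esub> sg_inv S s"
  using assms by (simp add: linn_swap[of "lact X s y" x] linn_lact lact_closed linn_closed
      S.sg_inv_prod linn_swap[of y x, symmetric])

lemma rinn_ract_left: assumes "x \<in> carrier X" "y \<in> carrier X" "t \<in> carrier T"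
  shows "rinn X (ract X x t) y = sg_inv T t \<cdot>\<^bsub>T\<^esub> rinn X x y"
  using assms by (simp add: rinn_swap[of y "ract X x t"] rinn_ract ract_closed rinn_closed
      T.sg_inv_prod rinn_swap[of y x, symmetric])

lemma linn_linn_self: assumes "x \<in> carrier X" "y \<in> carrier X"
  shows "linn X x y \<cdot>\<^bsub>S\<^esub> linn X y y = linn X x y"
  using linn_lact_right[of "linn X y y" x y] assms
  by (simp add: linn_self linn_closed linn_swap[of y y, symmetric])

lemma rinn_self_rinn: assumes "x \<in> carrier X" "y \<in> carrier X"
  shows "rinn X x x \<cdot>\<^bsub>T\<^esub> rinn X x y = rinn X x y"
  using rinn_ract_left[of x y "rinn X x x"] assms
  by (simp add: rinn_self rinn_closed rinn_swap[of x x, symmetric])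

text \<open>Both \<open>\<langle>xt,y\<rangle>\<close> and \<open>\<langle>x,yt\<^sup>-\<^sup>1\<rangle>\<close> act on \<open>y\<close> as \<open>xt[y,y]\<close>.\<close>

lemma linn_ract: assumes "x \<in> carrier X" "y \<in> carrier X" "t \<in> carrier T"
  shows "linn X (ract X x t) y = linn X x (ract X y (sg_inv T t))"
proof -
  let ?z = "ract X y (sg_inv T t)"
  have z: "?z \<in> carrier X" using assms by (simp add: ract_closed)
  have xt: "ract X x t \<in> carrier X" using assms by (simp add: ract_closed)
  have "lact X (linn X x ?z) y = ract X x (t \<cdot>\<^bsub>T\<^esub> rinn X y y)"
    using assms z by (simp add: linn_rinn rinn_ract_left)
  then have 1: "lact X (linn X x ?z) y = lact X (linn X (ract X x t) y) y"
    using assms xt by (simp add: linn_rinn rinn_closed ract_prod)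
  have "linn X (ract X x t) y = linn X (ract X x t) y \<cdot>\<^bsub>S\<^esub> linn X y y"
    using assms xt by (simp add: linn_linn_self)
  also have "\<dots> = linn X (lact X (linn X x ?z) y) y"
    unfolding 1 using assms xt by (simp add: linn_lact linn_closed)
  also have "\<dots> = linn X x ?z \<cdot>\<^bsub>S\<^esub> linn X y y" using assms z by (simp add: linn_lact linn_closed)
  also have "\<dots> = linn X x (lact X (linn X y y) ?z)"
    using assms z by (simp add: linn_lact_right linn_closed linn_swap[of y y, symmetric])
  also have "lact X (linn X y y) ?z = ?z"
    using assms by (simp add: lact_ract[symmetric] linn_closed linn_self)
  finally show ?thesis .
qed

text \<open>Mirror image of \<open>linn_ract\<close>: both pairings act alike on \<open>x\<close>,
  and each is recovered from that action by pairing with \<open>x\<close>, since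
  \<open>rinn X x x\<close> is a left unit for them.\<close>

lemma rinn_lact: assumes "x \<in> carrier X" "y \<in> carrier X" "s \<in> carrier S"
  shows "rinn X (lact X s x) y = rinn X x (lact X (sg_inv S s) y)"
proof -
  let ?z = "lact X (sg_inv S s) y"
  have z: "?z \<in> carrier X" using assms by (simp add: lact_closed)
  have sx: "lact X s x \<in> carrier X" using assms by (simp add: lact_closed)
  have 1: "ract X x (rinn X x ?z) = ract X x (rinn X (lact X s x) y)"
    using assms z sx
    by (simp add: linn_rinn[symmetric] linn_lact_right linn_lact linn_closed)
      (simp add: linn_rinn[symmetric] linn_closed lact_prod linn_lact_right)
  have "rinn X (lact X s x) y = rinn X (lact X s (ract X x (rinn X x x))) y"
    using assms by (simp add: rinn_self)
  also have "\<dots> = rinn X x x \<cdot>\<^bsub>T\<^esub> rinn X (lact X s x) y"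
    using assms sx by (simp add: lact_ract[symmetric] rinn_closed rinn_ract_left rinn_swap[of x x, symmetric])
  also have "\<dots> = rinn X x (ract X x (rinn X (lact X s x) y))"
    using assms sx by (simp add: rinn_ract rinn_closed)
  also have "\<dots> = rinn X x x \<cdot>\<^bsub>T\<^esub> rinn X x ?z"
    using assms z by (simp add: 1[symmetric] rinn_ract rinn_closed)
  also have "\<dots> = rinn X x ?z" using assms z by (simp add: rinn_self_rinn)
  finally show ?thesis .
qed

lemma linn_idem: "x \<in> carrier X \<Longrightarrow> S.cat.idem (linn X x x)"
  by (simp add: S.cat.idem_def linn_closed linn_linn_self)

lemma rinn_idem: "x \<in> carrier X \<Longrightarrow> T.cat.idem (rinn X x x)"
  by (simp add: T.cat.idem_def rinn_closed rinn_self_rinn)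

end

text \<open>\<open>YY x\<close> stands for the inverse of \<open>XX x\<close>; on the dual bimodule \<open>T\<close> acts on the left by
  \<open>t (YY x) = YY (x t\<^sup>-\<^sup>1)\<close> and \<open>S\<close> on the right by \<open>(YY x) s = YY (s\<^sup>-\<^sup>1 x)\<close>.\<close>

datatype ('a, 'x, 'b) mor = SS (un_SS: 'a) | XX (un_XX: 'x) | YY (un_YY: 'x) | TT (un_TT: 'b)

primrec mor_src :: "('a, 'x, 'b) mor \<Rightarrow> bool" where
  "mor_src (SS s) = False" | "mor_src (XX x) = False" | "mor_src (YY x) = True" | "mor_src (TT t) = True"

primrec mor_tgt :: "('a, 'x, 'b) mor \<Rightarrow> bool" where
  "mor_tgt (SS s) = False" | "mor_tgt (XX x) = True" | "mor_tgt (YY x) = False" | "mor_tgt (TT t) = True"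

context biaction
begin

definition mors :: "('a, 'x, 'b) mor set" where
  "mors = SS ` carrier S \<union> XX ` carrier X \<union> YY ` carrier X \<union> TT ` carrier T"

text \<open>The last equation is a placeholder for pairs that are not composable.\<close>

fun mor_comp :: "('a, 'x, 'b) mor \<Rightarrow> ('a, 'x, 'b) mor \<Rightarrow> ('a, 'x, 'b) mor" where
  "mor_comp (SS s) (SS s') = SS (s \<cdot>\<^bsub>S\<^esub> s')"
| "mor_comp (SS s) (XX x) = XX (lact X s x)"
| "mor_comp (XX x) (YY y) = SS (linn X x y)"
| "mor_comp (XX x) (TT t) = XX (ract X x t)"
| "mor_comp (YY y) (SS s) = YY (lact X (sg_inv S s) y)"
| "mor_comp (YY y) (XX x) = TT (rinn X y x)"
| "mor_comp (TT t) (YY y) = YY (ract X y (sg_inv T t))"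
| "mor_comp (TT t) (TT t') = TT (t \<cdot>\<^bsub>T\<^esub> t')"
| "mor_comp a b = a"

primrec mor_star :: "('a, 'x, 'b) mor \<Rightarrow> ('a, 'x, 'b) mor" where
  "mor_star (SS s) = SS (sg_inv S s)"
| "mor_star (XX x) = YY x"
| "mor_star (YY y) = XX y"
| "mor_star (TT t) = TT (sg_inv T t)"

lemma mors_iff [simp]:
  "SS s \<in> mors \<longleftrightarrow> s \<in> carrier S" "XX x \<in> mors \<longleftrightarrow> x \<in> carrier X"
  "YY x \<in> mors \<longleftrightarrow> x \<in> carrier X" "TT t \<in> mors \<longleftrightarrow> t \<in> carrier T"
  by (auto simp: mors_def)

text \<open>There are sixteen composable shapes. The laws linking the two sides each account for
  one: \<open>linn_rinn\<close> is \<open>XX\<close>, \<open>YY\<close>, \<open>XX\<close>, while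
  \<open>linn_ract\<close> is \<open>XX\<close>, \<open>TT\<close>, \<open>YY\<close> and
  \<open>rinn_lact\<close> is \<open>YY\<close>, \<open>SS\<close>, \<open>XX\<close>.\<close>

lemma mor_comp_assoc:
  assumes "a \<in> mors" "b \<in> mors" "c \<in> mors" "mor_tgt a = mor_src b" "mor_tgt b = mor_src c"
  shows "mor_comp (mor_comp a b) c = mor_comp a (mor_comp b c)"
  using assms
  by (cases a; cases b; cases c)
    (simp_all add: S.prod_assoc T.prod_assoc S.prod_closed T.prod_closed lact_closed ract_closed
      linn_closed rinn_closed lact_prod ract_prod lact_ract linn_lact rinn_ract linn_lact_right
      rinn_ract_left linn_ract rinn_lact linn_rinn S.sg_inv_prod T.sg_inv_prod
      linn_swap[symmetric] rinn_swap[symmetric])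

lemma mor_inverse_category: "inverse_category mors mor_src mor_tgt mor_comp mor_star"
proof
  fix a b c :: "('a, 'x, 'b) mor"
  assume a: "a \<in> mors"
  show "mor_star a \<in> mors" "mor_src (mor_star a) = mor_tgt a" "mor_tgt (mor_star a) = mor_src a"
    "mor_star (mor_star a) = a"
    using a by (cases a; simp)+
  show "mor_comp (mor_comp a (mor_star a)) a = a"
    using a by (cases a)
      (simp_all add: S.sg_inv_right T.sg_inv_right linn_self rinn_self rinn_swap[symmetric])
  assume b: "b \<in> mors"
  {
    assume ab: "mor_src a = mor_src b"
    show "mor_comp (mor_comp a (mor_star a)) (mor_comp b (mor_star b)) =
        mor_comp (mor_comp b (mor_star b)) (mor_comp a (mor_star a))"
      using a b ab
      by (cases a; cases b)
        (simp_all add: S.cat.idem_commute T.cat.idem_commute linn_idem rinn_idem)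
  }
  assume ab: "mor_tgt a = mor_src b"
  show "mor_comp a b \<in> mors" "mor_src (mor_comp a b) = mor_src a" "mor_tgt (mor_comp a b) = mor_tgt b"
    using a b ab
    by (cases a; cases b; simp add: S.prod_closed T.prod_closed lact_closed ract_closed
      linn_closed rinn_closed)+
  show "mor_star (mor_comp a b) = mor_comp (mor_star b) (mor_star a)"
    using a b ab
    by (cases a; cases b)
      (simp_all add: S.sg_inv_prod T.sg_inv_prod linn_swap[symmetric] rinn_swap[symmetric])
  assume "c \<in> mors" "mor_tgt b = mor_src c"
  then show "mor_comp (mor_comp a b) c = mor_comp a (mor_comp b c)"
    using a b ab by (intro mor_comp_assoc)
qed

end

sublocale biaction \<subseteq> mor: inverse_category mors mor_src mor_tgt mor_comp mor_star
  by (rule mor_inverse_category)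

context biaction
begin

section \<open>Order and joins in the category of a biaction\<close>

lemma mor_le_iff:
  "mor.le (SS s) (SS s') \<longleftrightarrow> S.cat.le s s'"
  "mor.le (XX x) (XX y) \<longleftrightarrow> bi_le X x y"
  "mor.le (TT t) (TT t') \<longleftrightarrow> T.cat.le t t'"
  by (simp_all add: mor.le_def S.cat.le_def T.cat.le_def bi_le_def)

lemma mor_hom:
  "mor.hom False False = SS ` carrier S" "mor.hom False True = XX ` carrier X"
  "mor.hom True False = YY ` carrier X" "mor.hom True True = TT ` carrier T"
  unfolding mor.hom_def by (auto simp: mors_def)

text \<open>Used to write a set of parallel arrows as an image under a single constructor.\<close>

lemma mor_parallel:
  "\<lbrakk>a \<in> mors; mor_src a = mor_src (SS s); mor_tgt a = mor_tgt (SS s)\<rbrakk> \<Longrightarrow> a \<in> range SS"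
  "\<lbrakk>a \<in> mors; mor_src a = mor_src (XX x); mor_tgt a = mor_tgt (XX x)\<rbrakk> \<Longrightarrow> a \<in> range XX"
  "\<lbrakk>a \<in> mors; mor_src a = mor_src (YY x); mor_tgt a = mor_tgt (YY x)\<rbrakk> \<Longrightarrow> a \<in> range YY"
  "\<lbrakk>a \<in> mors; mor_src a = mor_src (TT t); mor_tgt a = mor_tgt (TT t)\<rbrakk> \<Longrightarrow> a \<in> range TT"
  by (cases a; simp)+

lemma mor_join_iff:
  "mor.is_join (SS ` A) (SS s) \<longleftrightarrow> S.cat.is_join A s"
  "mor.is_join (XX ` B) (XX x) \<longleftrightarrow> bi_join X B x"
  "mor.is_join (TT ` D) (TT t) \<longleftrightarrow> T.cat.is_join D t"
proof -
  have S: "(\<forall>u\<in>mors. mor_src u = False \<longrightarrow> mor_tgt u = False \<longrightarrow> P u) \<longleftrightarrow>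
      (\<forall>s\<in>carrier S. P (SS s))" for P
    by (auto simp: mors_def)
  have X: "(\<forall>u\<in>mors. mor_src u = False \<longrightarrow> mor_tgt u = True \<longrightarrow> P u) \<longleftrightarrow>
      (\<forall>s\<in>carrier X. P (XX s))" for P
    by (auto simp: mors_def)
  have T: "(\<forall>u\<in>mors. mor_src u = True \<longrightarrow> mor_tgt u = True \<longrightarrow> P u) \<longleftrightarrow>
      (\<forall>s\<in>carrier T. P (TT s))" for P
    by (auto simp: mors_def)
  show "mor.is_join (SS ` A) (SS s) \<longleftrightarrow> S.cat.is_join A s"
    unfolding mor.is_join_def mor_src.simps mor_tgt.simps S
    by (simp add: S.cat.is_join_def mor_le_iff)
  show "mor.is_join (XX ` B) (XX x) \<longleftrightarrow> bi_join X B x"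
    unfolding mor.is_join_def mor_src.simps mor_tgt.simps X
    by (simp add: bi_join_def mor_le_iff)
  show "mor.is_join (TT ` D) (TT t) \<longleftrightarrow> T.cat.is_join D t"
    unfolding mor.is_join_def mor_src.simps mor_tgt.simps T
    by (simp add: T.cat.is_join_def mor_le_iff)
qed

lemma mor_join_YY_iff: "mor.is_join (YY ` B) (YY x) \<longleftrightarrow> mor.is_join (XX ` B) (XX x)"
  using mor.is_join_star[of "YY ` B" "YY x"] mor.is_join_star[of "XX ` B" "XX x"]
  by (auto simp: image_image)

lemma mor_coherent:
  "mor.coherent (SS ` A) \<Longrightarrow> S.cat.coherent A"
  "mor.coherent (XX ` B) \<Longrightarrow> bi_compatible X B"
  "mor.coherent (TT ` D) \<Longrightarrow> T.cat.coherent D"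
proof -
  show "S.cat.coherent A" if "mor.coherent (SS ` A)"
    using that
    by (simp add: mor.coherent_def S.cat.coherent_def mor.compat_def S.cat.compat_def mor.idem_def
        S.cat.idem_def)
  show "T.cat.coherent D" if "mor.coherent (TT ` D)"
    using that
    by (simp add: mor.coherent_def T.cat.coherent_def mor.compat_def T.cat.compat_def mor.idem_def
        T.cat.idem_def)
  show "bi_compatible X B" if B: "mor.coherent (XX ` B)"
  proof -
    have "mor.compat (XX x) (XX y)" if "x \<in> B" "y \<in> B" for x y
      using mor.coherentD[OF B] that by simp
    then show ?thesis
      using mor.compat_eq mor.compat_eq' mor.compatD(1) unfolding bi_compatible_def by fastforce
  qed
qed

end

context bimodule
begin

section \<open>Existence and distributivity of joins over a bimodule\<close>

lemma mor_join_ex: assumes "A \<subseteq> mor.hom i j" "mor.coherent A"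
  shows "\<exists>a\<in>mor.hom i j. mor.is_join A a"
proof -
  have join: "\<exists>x\<in>carrier X. mor.is_join (XX ` B) (XX x)" if "mor.coherent (XX ` B)" for B
    using bi_join_exists[OF mor_coherent(2)[OF that]] by (auto simp: mor_join_iff bi_join_def)
  have A: "a \<in> mors" "mor_src a = i" "mor_tgt a = j" if "a \<in> A" for a
    using assms(1) that by (auto simp: mor.hom_def)
  consider (SS) "\<not> i" "\<not> j" | (XX) "\<not> i" "j" | (YY) "i" "\<not> j" | (TT) "i" "j" by blast
  then show ?thesis
  proof cases
    case SS
    then obtain B where B: "A = SS ` B"
      using A mor_parallel(1) by (metis mor_src.simps(1) mor_tgt.simps(1) subsetI subset_imageE)
    have "B \<subseteq> carrier S" using A(1) mors_iff B by blast
    then obtain s where s: "s \<in> S.cat.hom () ()" "S.cat.is_join B s"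
      using S.cat.join_ex[OF _ mor_coherent(1), of B "()" "()"] assms(2) B
      by (auto simp: S.cat.hom_def)
    then show ?thesis
      using SS B by (intro bexI[of _ "SS s"]) (auto simp: mor_join_iff mor.hom_def S.cat.hom_def)
  next
    case XX
    then obtain B where B: "A = XX ` B"
      using A mor_parallel(2) by (metis mor_src.simps(2) mor_tgt.simps(2) subsetI subset_imageE)
    then obtain x where "x \<in> carrier X" "mor.is_join A (XX x)" using join[of B] assms(2) by auto
    then show ?thesis using XX by (intro bexI[of _ "XX x"]) (simp_all add: mor.hom_def)
  next
    case YY
    then obtain B where B: "A = YY ` B"
      using A mor_parallel(3) by (metis mor_src.simps(3) mor_tgt.simps(3) subsetI subset_imageE)
    then have "mor.coherent (XX ` B)" using mor.coherent_star[OF assms(2)] by (simp add: image_image)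
    then obtain x where "x \<in> carrier X" "mor.is_join A (YY x)"
      using B join[of B] by (auto simp: mor_join_YY_iff)
    then show ?thesis using YY by (intro bexI[of _ "YY x"]) (simp_all add: mor.hom_def)
  next
    case TT
    then obtain B where B: "A = TT ` B"
      using A mor_parallel(4) by (metis mor_src.simps(4) mor_tgt.simps(4) subsetI subset_imageE)
    have "B \<subseteq> carrier T" using A(1) mors_iff B by blast
    then obtain s where s: "s \<in> T.cat.hom () ()" "T.cat.is_join B s"
      using T.cat.join_ex[OF _ mor_coherent(3), of B "()" "()"] assms(2) B
      by (auto simp: T.cat.hom_def)
    then show ?thesis
      using TT B by (intro bexI[of _ "TT s"]) (auto simp: mor_join_iff mor.hom_def T.cat.hom_def)
  qed
qed

text \<open>Of the eight composable shapes, two are distributivity in \<open>S\<close> and in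
  \<open>T\<close>; the other six use the six distributive laws of a bimodule once each. Where a
  \<open>YY\<close> arises from an action, the law is applied to inverted scalars and moved to
  \<open>XX\<close>; \<open>XX\<close> against \<open>YY\<close> needs \<open>linn_swap\<close>, as
  \<open>linn_join\<close> concerns the first argument.\<close>

lemma mor_comp_join_aux:
  shows "\<lbrakk>mor.is_join (SS ` A) (SS s); w \<in> mors; mor_tgt w = False\<rbrakk>
      \<Longrightarrow> mor.is_join (mor_comp w ` SS ` A) (mor_comp w (SS s))"
    and "\<lbrakk>mor.is_join (XX ` B) (XX x); w \<in> mors; mor_tgt w = False\<rbrakk>
      \<Longrightarrow> mor.is_join (mor_comp w ` XX ` B) (mor_comp w (XX x))"
    and "\<lbrakk>mor.is_join (XX ` B) (XX x); w \<in> mors; mor_tgt w = True\<rbrakk>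
      \<Longrightarrow> mor.is_join (mor_comp w ` YY ` B) (mor_comp w (YY x))"
    and "\<lbrakk>mor.is_join (TT ` D) (TT t); w \<in> mors; mor_tgt w = True\<rbrakk>
      \<Longrightarrow> mor.is_join (mor_comp w ` TT ` D) (mor_comp w (TT t))"
proof -
  assume j: "mor.is_join (SS ` A) (SS s)" and w: "w \<in> mors" "mor_tgt w = False"
  note A = j[unfolded mor_join_iff]
  have AC: "a \<in> carrier S" if "a \<in> A" for a
    using S.cat.is_joinD(2)[OF A that] S.cat.leD(1) by simp
  show "mor.is_join (mor_comp w ` SS ` A) (mor_comp w (SS s))"
  proof (cases w)
    case (SS u)
    then show ?thesis
      using w S.cat.comp_join[OF A, of u] mor_join_iff(1)[of "(\<lambda>a. u \<cdot>\<^bsub>S\<^esub> a) ` A"]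
      by (simp add: image_image)
  next
    case (YY y)
    have "bi_join X ((\<lambda>b. lact X b y) ` sg_inv S ` A) (lact X (sg_inv S s) y)"
      using w YY S.cat.is_join_star[OF A] S.cat.is_join_coherent[OF S.cat.is_join_star[OF A]]
      by (intro join_lact) (auto simp: S.sg_compatible_iff S.sg_join_iff)
    then show ?thesis
      using YY mor_join_iff(2)[of "(\<lambda>a. lact X (sg_inv S a) y) ` A"] mor_join_YY_iff[of "(\<lambda>a. lact X (sg_inv S a) y) ` A"]
      by (simp add: image_image)
  qed (use w in simp_all)
next
  assume j: "mor.is_join (XX ` B) (XX x)" and w: "w \<in> mors" "mor_tgt w = False"
  note B = mor_coherent(2)[OF mor.is_join_coherent[OF j]] j[unfolded mor_join_iff]
  show "mor.is_join (mor_comp w ` XX ` B) (mor_comp w (XX x))"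
  proof (cases w)
    case (SS u)
    then show ?thesis
      using w lact_join[OF _ B, of u] mor_join_iff(2)[of "(\<lambda>a. lact X u a) ` B"]
      by (simp add: image_image)
  next
    case (YY y)
    then show ?thesis
      using w rinn_join[OF B, of y] mor_join_iff(3)[of "(\<lambda>a. rinn X y a) ` B"]
      by (simp add: image_image T.sg_join_iff)
  qed (use w in simp_all)
next
  assume j: "mor.is_join (XX ` B) (XX x)" and w: "w \<in> mors" "mor_tgt w = True"
  note B = mor_coherent(2)[OF mor.is_join_coherent[OF j]] j[unfolded mor_join_iff]
  have BC: "b \<in> carrier X" if "b \<in> B" for b using B(1) that by (auto simp: bi_compatible_def)
  have xC: "x \<in> carrier X" using B(2) by (simp add: bi_join_def)
  show "mor.is_join (mor_comp w ` YY ` B) (mor_comp w (YY x))"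
  proof (cases w)
    case (XX y)
    have y: "y \<in> carrier X" using w XX by simp
    have "S.cat.is_join (sg_inv S ` (\<lambda>a. linn X a y) ` B) (sg_inv S (linn X x y))"
      using linn_join[OF B y] by (intro S.cat.is_join_star) (simp add: S.sg_join_iff)
    moreover have "sg_inv S ` (\<lambda>a. linn X a y) ` B = (\<lambda>a. linn X y a) ` B"
      unfolding image_image by (rule image_cong) (use BC y in \<open>simp_all add: linn_swap[symmetric]\<close>)
    ultimately show ?thesis
      using XX y xC mor_join_iff(1)[of "(\<lambda>a. linn X y a) ` B"]
      by (simp add: image_image linn_swap[symmetric])
  next
    case (TT u)
    then show ?thesis
      using w join_ract[OF B, of "sg_inv T u"] mor_join_iff(2)[of "(\<lambda>a. ract X a (sg_inv T u)) ` B"]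
        mor_join_YY_iff[of "(\<lambda>a. ract X a (sg_inv T u)) ` B"]
      by (simp add: image_image)
  qed (use w in simp_all)
next
  assume j: "mor.is_join (TT ` D) (TT t)" and w: "w \<in> mors" "mor_tgt w = True"
  note D = j[unfolded mor_join_iff]
  show "mor.is_join (mor_comp w ` TT ` D) (mor_comp w (TT t))"
  proof (cases w)
    case (TT u)
    then show ?thesis
      using w T.cat.comp_join[OF D, of u] mor_join_iff(3)[of "(\<lambda>a. u \<cdot>\<^bsub>T\<^esub> a) ` D"]
      by (simp add: image_image)
  next
    case (XX y)
    then show ?thesis
      using w ract_join[of y D t] D T.cat.is_join_coherent[OF D] mor_join_iff(2)[of "(\<lambda>a. ract X y a) ` D"]
      by (simp add: image_image T.sg_compatible_iff T.sg_join_iff)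
  qed (use w in simp_all)
qed

lemma mor_comp_join: assumes "mor.is_join A a" "w \<in> mors" "mor_tgt w = mor_src a"
  shows "mor.is_join (mor_comp w ` A) (mor_comp w a)"
proof -
  have A: "x \<in> mors" "mor_src x = mor_src a" "mor_tgt x = mor_tgt a" if "x \<in> A" for x
    using mor.leD[OF mor.is_joinD(2)[OF assms(1) that]] by auto
  show ?thesis
  proof (cases a)
    case (SS s)
    have "A \<subseteq> range SS" by (intro subsetI mor_parallel(1)[of _ s]) (use A SS in simp_all)
    then obtain B where "A = SS ` B" by (auto elim: subset_imageE)
    then show ?thesis using assms SS mor_comp_join_aux(1) by simp
  next
    case (XX x)
    have "A \<subseteq> range XX" by (intro subsetI mor_parallel(2)[of _ x]) (use A XX in simp_all)
    then obtain B where "A = XX ` B" by (auto elim: subset_imageE)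
    then show ?thesis using assms XX mor_comp_join_aux(2) by simp
  next
    case (YY x)
    have "A \<subseteq> range YY" by (intro subsetI mor_parallel(3)[of _ x]) (use A YY in simp_all)
    then obtain B where "A = YY ` B" by (auto elim: subset_imageE)
    then show ?thesis using assms YY mor_comp_join_aux(3) by (simp add: mor_join_YY_iff)
  next
    case (TT t)
    have "A \<subseteq> range TT" by (intro subsetI mor_parallel(4)[of _ t]) (use A TT in simp_all)
    then obtain B where "A = TT ` B" by (auto elim: subset_imageE)
    then show ?thesis using assms TT mor_comp_join_aux(4) by simp
  qed
qed

text \<open>Quadruples instead of functions on pairs of objects give matrices a carrier type of the
  shape of \<open>enl_univ\<close>. The third component holds the element of \<open>X\<close> that
  names the dual arrow.\<close>

definition mor_ent :: "'a \<times> 'x \<times> 'x \<times> 'b \<Rightarrow> bool \<Rightarrow> bool \<Rightarrow> ('a, 'x, 'b) mor" where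
  "mor_ent m i j = (case m of (s, x, y, t) \<Rightarrow>
     if i then (if j then TT t else YY y) else (if j then XX x else SS s))"

definition mor_mk :: "(bool \<Rightarrow> bool \<Rightarrow> ('a, 'x, 'b) mor) \<Rightarrow> 'a \<times> 'x \<times> 'x \<times> 'b" where
  "mor_mk f = (un_SS (f False False), un_XX (f False True), un_YY (f True False), un_TT (f True True))"

definition mor_one :: "bool \<Rightarrow> ('a, 'x, 'b) mor" where
  "mor_one i = (if i then TT (sg_ident T) else SS (sg_ident S))"

end

sublocale bimodule \<subseteq> mor: matrices mors mor_src mor_tgt mor_comp mor_star mor_ent mor_mk
proof
  fix f :: "bool \<Rightarrow> bool \<Rightarrow> ('a, 'x, 'b) mor" assume f: "\<And>i j. f i j \<in> mor.hom i j"
  show "mor_ent (mor_mk f) = f"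
  proof (intro ext)
    fix i j
    show "mor_ent (mor_mk f) i j = f i j"
      using f[of False False] f[of False True] f[of True False] f[of True True]
      by (cases i; cases j; cases "f i j") (auto simp: mor_ent_def mor_mk_def mor.hom_def)
  qed
qed (auto simp: mor_join_ex mor_comp_join mor_ent_def mor_mk_def split: prod.splits)

context equivalence_bimodule
begin

lemma mor_one_cover: "mor.is_join ((\<lambda>x. mor_comp (mor_star x) x) ` mor.hom i k) (mor_one k)"
proof -
  \<comment> \<open>For \<open>i = k\<close> the identity itself belongs to the family and is its
    greatest element; for \<open>i \<noteq> k\<close> the claim is a covering condition.\<close>
  have "S.cat.is_join ((\<lambda>s. sg_inv S s \<cdot>\<^bsub>S\<^esub> s) ` carrier S) (sg_ident S)"
    using S.idem_le_ident S.cat.idem_domain S.cat.idem_star[OF S.sg_ident(1)] S.cat.idemD(3)[OF S.sg_ident(1)]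
    by (intro S.cat.is_join_greatest) (auto intro!: image_eqI[of _ _ "sg_ident S"])
  moreover have "T.cat.is_join ((\<lambda>s. sg_inv T s \<cdot>\<^bsub>T\<^esub> s) ` carrier T) (sg_ident T)"
    using T.idem_le_ident T.cat.idem_domain T.cat.idem_star[OF T.sg_ident(1)] T.cat.idemD(3)[OF T.sg_ident(1)]
    by (intro T.cat.is_join_greatest) (auto intro!: image_eqI[of _ _ "sg_ident T"])
  ultimately show ?thesis
    using linn_cover rinn_cover unfolding S.sg_join_iff T.sg_join_iff
      mor_join_iff(1,3)[symmetric] image_image
    by (cases i; cases k) (simp_all add: mor_hom image_image mor_one_def)
qed

end

sublocale equivalence_bimodule \<subseteq>
  mor: unital_matrices mors mor_src mor_tgt mor_comp mor_star mor_ent mor_mk mor_one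
proof
  fix i show "mor_one i \<in> mor.hom i i" by (simp add: mor_one_def mor.hom_def)
next
  fix a assume a: "a \<in> mors"
  \<comment> \<open>The actions are unital because \<open>x\<close> is fixed by its own projections,
    which absorb the identities of \<open>S\<close> and \<open>T\<close>.\<close>
  have X: "lact X (sg_ident S) x = x" "ract X x (sg_ident T) = x" if "x \<in> carrier X" for x
  proof -
    show "lact X (sg_ident S) x = x"
      using S.ident_prod[of "linn X x x"] that lact_prod[of "sg_ident S" "linn X x x" x]
      by (simp add: linn_closed linn_self)
    show "ract X x (sg_ident T) = x"
      using T.prod_ident[of "rinn X x x"] that ract_prod[of x "rinn X x x" "sg_ident T"]
      by (simp add: rinn_closed rinn_self)
  qed
  show "mor_comp (mor_one (mor_src a)) a = a" "mor_comp a (mor_one (mor_tgt a)) = a"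
    using a X S.cat.idem_star[OF S.sg_ident(1)] T.cat.idem_star[OF T.sg_ident(1)]
    by (cases a; simp add: mor_one_def)+
qed (rule mor_one_cover)

lemma (in equivalence_bimodule) joint_sup_enlargement_mat_sg:
  "joint_sup_enlargement S T mor.mat_sg"
proof -
  have "bij_betw SS (carrier S) (mor.hom False False)" "bij_betw TT (carrier T) (mor.hom True True)"
    by (auto simp: bij_betw_def inj_on_def mor_hom)
  then have "sg_isomorphic S (local_sg mor.mat_sg (mor.corner False))"
    "sg_isomorphic T (local_sg mor.mat_sg (mor.corner True))"
    by (auto intro: mor.isomorphic_corner)
  then show ?thesis
    unfolding joint_sup_enlargement_def
    using mor.pseudogroup_mat_sg mor.sup_enlargement_corner mor.corner_idem mor.mat_sg_iff(1) by blast
qed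

section \<open>The corner of a joint sup-enlargement\<close>

context inverse_semigroup
begin

text \<open>For idempotents \<open>a\<close> and \<open>b\<close> this is the set
  \<open>aSb\<close>, described by fixed-point equations.\<close>

definition corn :: "'a \<Rightarrow> 'a \<Rightarrow> 'a set" where
  "corn a b = {x \<in> carrier S. a \<cdot> x = x \<and> x \<cdot> b = x}"

lemma corn_prod: "\<lbrakk>x \<in> corn a b; y \<in> corn b' c; a \<in> carrier S; c \<in> carrier S\<rbrakk> \<Longrightarrow> x \<cdot> y \<in> corn a c"
  unfolding corn_def by (auto simp: prod_closed prod_assoc) (metis prod_assoc)

lemma corn_inv: assumes "x \<in> corn a b" "cat.idem a" "cat.idem b" shows "sg_inv S x \<in> corn b a"
proof -
  have x: "x \<in> carrier S" "a \<cdot> x = x" "x \<cdot> b = x" using assms by (auto simp: corn_def)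
  have "sg_inv S x = sg_inv S x \<cdot> a" "sg_inv S x = b \<cdot> sg_inv S x"
    using arg_cong[OF x(2), of "sg_inv S"] arg_cong[OF x(3), of "sg_inv S"] x(1)
      cat.idem_star[OF assms(2)] cat.idem_star[OF assms(3)] cat.idemD(1)[OF assms(2)]
      cat.idemD(1)[OF assms(3)] by (simp_all add: sg_inv_prod)
  then show ?thesis using x(1) by (simp add: corn_def)
qed

lemma carrier_local_sg: assumes "cat.idem e" shows "carrier (local_sg S e) = corn e e"
proof -
  have e: "e \<in> carrier S" "e \<cdot> e = e" using cat.idemD[OF assms] by auto
  have ee: "e \<cdot> (e \<cdot> x) = e \<cdot> x" if "x \<in> carrier S" for x
    using that prod_assoc[OF e(1) e(1), of x] e by simp
  have "{e \<cdot> x \<cdot> e |x. x \<in> carrier S} \<subseteq> corn e e"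
    using e by (auto simp: corn_def prod_closed prod_assoc ee)
  moreover have "x = e \<cdot> x \<cdot> e" if "x \<in> corn e e" for x using that by (simp add: corn_def)
  then have "corn e e \<subseteq> {e \<cdot> x \<cdot> e |x. x \<in> carrier S}" unfolding corn_def by blast
  ultimately show ?thesis by (simp add: local_sg_def)
qed

end

context pseudogroup
begin

text \<open>Multiplication by \<open>a\<close> fixes \<open>A\<close> pointwise, so
  \<open>a \<cdot> j\<close> is a join of \<open>A\<close> as well and equals \<open>j\<close>;
  likewise for \<open>b\<close> on the right.\<close>

lemma corn_join: assumes "A \<subseteq> corn a b" "cat.coherent A" "a \<in> carrier S" "b \<in> carrier S"
  shows "\<exists>j\<in>corn a b. cat.is_join A j"
proof -
  obtain j where j: "cat.is_join A j"
    using cat.join_ex[of A "()" "()"] assms(1,2) by (auto simp: cat.hom_def corn_def)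
  note jC = cat.is_joinD(1)[OF j]
  have "(\<lambda>x. a \<cdot> x) ` A = A" "(\<lambda>x. x \<cdot> b) ` A = A"
    using assms(1) by (auto simp: corn_def subset_iff image_iff)
  then have ab: "cat.is_join A (a \<cdot> j)" "cat.is_join A (j \<cdot> b)"
    using cat.comp_join[OF j assms(3)] cat.join_comp[OF j assms(4)] by simp_all
  have "a \<cdot> j = j" "j \<cdot> b = j"
    by (rule cat.is_join_unique[OF ab(1) j refl refl] cat.is_join_unique[OF ab(2) j refl refl])+
  then show ?thesis using j jC by (auto simp: corn_def)
qed

text \<open>If \<open>u = p b v\<close> is an idempotent below \<open>a\<close> then \<open>x = u p b\<close> satisfies \<open>x x\<^sup>-\<^sup>1 = u\<close>.\<close>

lemma sup_enlargement_cover: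
  assumes "sup_enlargement S b" "cat.idem a"
  shows "cat.is_join ((\<lambda>x. x \<cdot> sg_inv S x) ` corn a b) a"
proof (rule cat.is_joinI)
  have b: "cat.idem b" using assms(1) by (simp add: sup_enlargement_def idems_iff)
  note aC = cat.idemD[OF assms(2)] and bC = cat.idemD[OF b]
  show "a \<in> carrier S" by fact
  show "cat.le y a" if y: "y \<in> (\<lambda>x. x \<cdot> sg_inv S x) ` corn a b" for y
  proof -
    obtain x where x: "x \<in> carrier S" "a \<cdot> x = x" "y = x \<cdot> sg_inv S x"
      using y by (auto simp: corn_def)
    have "a \<cdot> y = y" using x aC prod_assoc[of a x "sg_inv S x"] by simp
    moreover have "cat.idem y" using x by simp
    ultimately show ?thesis
      using cat.idem_commute[of y a] assms(2) by (intro cat.le_of_idem_eq) auto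
  qed
  fix w assume w: "w \<in> carrier S" "\<And>y. y \<in> (\<lambda>x. x \<cdot> sg_inv S x) ` corn a b \<Longrightarrow> cat.le y w"
  have "carrier S = join_closure S (set_prod S (set_prod S (carrier S) (corn b b)) (carrier S))"
    using assms(1) carrier_local_sg[OF b] by (simp add: sup_enlargement_def Let_def)
  then have "a \<in> join_closure S (set_prod S (set_prod S (carrier S) (corn b b)) (carrier S))"
    using aC(1) by simp
  then obtain B where B: "B \<subseteq> set_prod S (set_prod S (carrier S) (corn b b)) (carrier S)"
      "cat.is_join B a"
    by (auto simp: join_closure_def sg_join_iff)
  have "cat.le u w" if u: "u \<in> B" for u
  proof -
    obtain p s v where psv: "p \<in> carrier S" "s \<in> corn b b" "v \<in> carrier S" "u = p \<cdot> s \<cdot> v"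
      using B(1) u by (auto simp: set_prod_def)
    \<comment> \<open>Absorbing the middle factor \<open>s\<close> keeps
      \<open>q \<cdot> b = q\<close>, which places \<open>u \<cdot> q\<close> in
      \<open>corn a b\<close>.\<close>
    define q where "q = p \<cdot> s"
    have s: "s \<in> carrier S" "s \<cdot> b = s" using psv by (auto simp: corn_def)
    have q: "q \<in> carrier S" "q \<cdot> b = q" using psv(1) s bC(1) by (simp_all add: q_def prod_closed prod_assoc)
    have uq: "u = q \<cdot> v" using psv by (simp add: q_def)
    have le: "cat.le u a" using cat.is_joinD(2)[OF B(2) u] .
    then have ui: "cat.idem u" using assms(2) by (rule cat.le_idem)
    note uC = cat.idemD[OF ui]
    have au: "a \<cdot> u = u" using cat.le_idem_eq(1)[OF le assms(2)] .
    have "u \<cdot> q \<in> corn a b"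
      using uC q au aC bC prod_assoc[of a u q] prod_assoc[of u q b] by (simp add: corn_def prod_closed)
    moreover have "(u \<cdot> q) \<cdot> sg_inv S (u \<cdot> q) = u"
    proof -
      have "(q \<cdot> sg_inv S q) \<cdot> u = u" using q psv(3) by (simp add: uq prod_closed prod_assoc)
      then have qu: "u \<cdot> (q \<cdot> sg_inv S q) = u"
        using cat.idem_commute[OF ui, of "q \<cdot> sg_inv S q"] q by simp
      have "(u \<cdot> q) \<cdot> sg_inv S (u \<cdot> q) = (u \<cdot> (q \<cdot> sg_inv S q)) \<cdot> u"
        using uC q cat.idem_star[OF ui] by (simp add: sg_inv_prod prod_closed prod_assoc)
      then show ?thesis using qu uC by simp
    qed
    ultimately have "u \<in> (\<lambda>x. x \<cdot> sg_inv S x) ` corn a b" by force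
    then show ?thesis by (rule w(2))
  qed
  then show "cat.le a w" using cat.is_joinD(3)[OF B(2) w(1)] by simp
qed

end

section \<open>A pseudogroup embedded as a corner\<close>

locale corner_embedding = S: pseudogroup S + U: pseudogroup U
  for S :: "('a, 'm) semigrp_scheme" and U :: "('u, 'k) semigrp_scheme" +
  fixes e :: 'u and h :: "'a \<Rightarrow> 'u"
  assumes e_idem: "U.cat.idem e"
    and h_bij: "bij_betw h (carrier S) (U.corn e e)"
    and h_prod: "\<lbrakk>s \<in> carrier S; t \<in> carrier S\<rbrakk> \<Longrightarrow> h (s \<cdot>\<^bsub>S\<^esub> t) = h s \<cdot>\<^bsub>U\<^esub> h t"
begin

definition h_inv :: "'u \<Rightarrow> 'a" where "h_inv = inv_into (carrier S) h"

lemma e_closed [simp]: "e \<in> carrier U" and e_e [simp]: "e \<cdot>\<^bsub>U\<^esub> e = e"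
  using U.cat.idemD[OF e_idem] by auto

lemma h_corn: "s \<in> carrier S \<Longrightarrow> h s \<in> U.corn e e"
  using h_bij by (auto simp: bij_betw_def)

lemma h_closed [simp]: "s \<in> carrier S \<Longrightarrow> h s \<in> carrier U"
  using h_corn by (simp add: U.corn_def)

lemma h_inv_closed: "x \<in> U.corn e e \<Longrightarrow> h_inv x \<in> carrier S"
  and h_h_inv: "x \<in> U.corn e e \<Longrightarrow> h (h_inv x) = x"
  using h_bij by (auto simp: h_inv_def bij_betw_def inv_into_into f_inv_into_f)

lemma h_eq_iff: "\<lbrakk>s \<in> carrier S; t \<in> carrier S\<rbrakk> \<Longrightarrow> h s = h t \<longleftrightarrow> s = t"
  using h_bij by (auto simp: bij_betw_def inj_on_eq_iff)

lemma h_sg_inv: assumes "s \<in> carrier S" shows "h (sg_inv S s) = sg_inv U (h s)"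
proof (rule U.sg_inv_eq[symmetric])
  show "h s \<cdot>\<^bsub>U\<^esub> h (sg_inv S s) \<cdot>\<^bsub>U\<^esub> h s = h s"
    using assms by (simp add: h_prod[symmetric] S.prod_closed S.sg_inv_right)
  show "h (sg_inv S s) \<cdot>\<^bsub>U\<^esub> h s \<cdot>\<^bsub>U\<^esub> h (sg_inv S s) = h (sg_inv S s)"
    using assms by (simp add: h_prod[symmetric] S.prod_closed S.sg_inv_left)
qed (use assms in simp_all)

lemma h_idem_iff: "s \<in> carrier S \<Longrightarrow> U.cat.idem (h s) \<longleftrightarrow> S.cat.idem s"
  by (simp add: U.cat.idem_def S.cat.idem_def h_prod[symmetric] h_eq_iff S.prod_closed)

lemma h_le_iff: "\<lbrakk>s \<in> carrier S; t \<in> carrier S\<rbrakk> \<Longrightarrow> U.cat.le (h s) (h t) \<longleftrightarrow> S.cat.le s t"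
  by (simp add: U.cat.le_def S.cat.le_def h_prod[symmetric] h_sg_inv[symmetric] h_eq_iff S.prod_closed)

lemma h_coherent: assumes "S.cat.coherent A" shows "U.cat.coherent (h ` A)"
proof -
  have "U.cat.compat (h s) (h t)" if "S.cat.compat s t" for s t
    using S.cat.compatD[OF that]
    by (simp add: U.cat.compat_def h_sg_inv[symmetric] h_prod[symmetric] h_idem_iff S.prod_closed)
  then show ?thesis using assms by (auto simp: U.cat.coherent_def S.cat.coherent_def)
qed

lemma join_of_h_join:
  assumes "A \<subseteq> carrier S" "j \<in> carrier S" "U.cat.is_join (h ` A) (h j)"
  shows "S.cat.is_join A j"
proof (rule S.cat.is_joinI)
  show "S.cat.le a j" if "a \<in> A" for a
    using U.cat.is_joinD(2)[OF assms(3), of "h a"] that assms(1,2) by (auto simp: h_le_iff)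
  fix u assume u: "u \<in> carrier S" "\<And>a. a \<in> A \<Longrightarrow> S.cat.le a u"
  have "U.cat.le (h j) (h u)"
    by (rule U.cat.is_joinD(3)[OF assms(3)]) (use u assms(1) in \<open>auto simp: h_le_iff subset_iff\<close>)
  then show "S.cat.le j u" using u assms(2) by (simp add: h_le_iff)
qed (fact assms(2))

text \<open>An upper bound in \<open>U\<close> need not lie in the corner, so bounds cannot simply
  be pulled back. Instead the join is formed in \<open>U\<close>, where \<open>corn_join\<close>
  places it in the corner; its preimage is a join of \<open>A\<close>, hence
  \<open>j\<close>.\<close>

lemma h_join: assumes "S.cat.is_join A j" shows "U.cat.is_join (h ` A) (h j)"
proof -
  have A: "A \<subseteq> carrier S" using S.cat.is_joinD(2)[OF assms] S.cat.leD(1) by blast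
  have j: "j \<in> carrier S" using S.cat.is_joinD(1)[OF assms] .
  have "h ` A \<subseteq> U.corn e e" using A h_corn by auto
  then obtain k where k: "k \<in> U.corn e e" "U.cat.is_join (h ` A) k"
    using U.corn_join h_coherent[OF S.cat.is_join_coherent[OF assms]] e_closed by blast
  then have "S.cat.is_join A (h_inv k)"
    using A by (intro join_of_h_join) (simp_all add: h_inv_closed h_h_inv)
  then have "h_inv k = j" by (rule S.cat.is_join_unique[OF _ assms refl refl])
  then show ?thesis using k h_h_inv by auto
qed

text \<open>Because \<open>e\<close> is an identity for the corner, its preimage is an idempotent
  above all others.\<close>

lemma h_ident: "h (sg_ident S) = e"
proof -
  have e: "e \<in> U.corn e e" by (simp add: U.corn_def)
  have "sg_ident S = h_inv e"
  proof (rule S.sg_ident_eq)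
    show i: "S.cat.idem (h_inv e)"
      using e_idem by (simp add: h_idem_iff[symmetric] h_inv_closed h_h_inv e)
    show "S.cat.le s (h_inv e)" if s: "S.cat.idem s" for s
    proof (rule S.cat.le_of_idem_eq[OF s i])
      have "h (s \<cdot>\<^bsub>S\<^esub> h_inv e) = h s"
        using s S.cat.idemD(1)[OF s] h_corn[of s]
        by (simp add: h_prod h_inv_closed h_h_inv e) (simp add: U.corn_def)
      then show "s \<cdot>\<^bsub>S\<^esub> h_inv e = s"
        using S.cat.idemD(1)[OF s] by (simp add: h_eq_iff S.prod_closed h_inv_closed e)
    qed simp
  qed
  then show ?thesis by (simp add: h_h_inv e)
qed

end

section \<open>The bimodule between two corners\<close>

locale joint_enlargement =
  S: corner_embedding S U e h + T: corner_embedding T U f g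
  for S :: "('a, 'm) semigrp_scheme" and T :: "('b, 'n) semigrp_scheme"
    and U :: "('u, 'k) semigrp_scheme" (structure) and e h f g +
  assumes enl_e: "sup_enlargement U e" and enl_f: "sup_enlargement U f"
begin

abbreviation cinv :: "'u \<Rightarrow> 'u" where "cinv \<equiv> sg_inv U"

definition corner_bimod :: "('a, 'b, 'u) biact" where
  "corner_bimod = \<lparr>carrier = S.U.corn e f, lact = (\<lambda>s x. h s \<cdot> x), ract = (\<lambda>x t. x \<cdot> g t),
     linn = (\<lambda>x y. S.h_inv (x \<cdot> cinv y)), rinn = (\<lambda>x y. T.h_inv (cinv x \<cdot> y))\<rparr>"

lemma corner_bimod_simps [simp]:
  "carrier corner_bimod = S.U.corn e f" "lact corner_bimod s x = h s \<cdot> x"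
  "ract corner_bimod x t = x \<cdot> g t" "linn corner_bimod x y = S.h_inv (x \<cdot> cinv y)"
  "rinn corner_bimod x y = T.h_inv (cinv x \<cdot> y)"
  by (simp_all add: corner_bimod_def)

lemma XD: "x \<in> S.U.corn e f \<Longrightarrow> x \<in> carrier U"
  by (simp add: S.U.corn_def)

lemma X_lact: "\<lbrakk>s \<in> carrier S; x \<in> S.U.corn e f\<rbrakk> \<Longrightarrow> h s \<cdot> x \<in> S.U.corn e f"
  using S.U.corn_prod[OF S.h_corn] by simp

lemma X_ract: "\<lbrakk>x \<in> S.U.corn e f; t \<in> carrier T\<rbrakk> \<Longrightarrow> x \<cdot> g t \<in> S.U.corn e f"
  using S.U.corn_prod[OF _ T.h_corn] by simp

lemma X_linn: "\<lbrakk>x \<in> S.U.corn e f; y \<in> S.U.corn e f\<rbrakk> \<Longrightarrow> x \<cdot> cinv y \<in> S.U.corn e e"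
  using S.U.corn_prod[OF _ S.U.corn_inv[OF _ S.e_idem T.e_idem]] by simp

lemma X_rinn: "\<lbrakk>x \<in> S.U.corn e f; y \<in> S.U.corn e f\<rbrakk> \<Longrightarrow> cinv x \<cdot> y \<in> S.U.corn f f"
  using S.U.corn_prod[OF S.U.corn_inv[OF _ S.e_idem T.e_idem]] by simp

lemma h_linn [simp]: "\<lbrakk>x \<in> S.U.corn e f; y \<in> S.U.corn e f\<rbrakk> \<Longrightarrow> h (S.h_inv (x \<cdot> cinv y)) = x \<cdot> cinv y"
  by (intro S.h_h_inv X_linn)

lemma g_rinn [simp]: "\<lbrakk>x \<in> S.U.corn e f; y \<in> S.U.corn e f\<rbrakk> \<Longrightarrow> g (T.h_inv (cinv x \<cdot> y)) = cinv x \<cdot> y"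
  by (intro T.h_h_inv X_rinn)

lemma linn_closed [simp]:
  "\<lbrakk>x \<in> S.U.corn e f; y \<in> S.U.corn e f\<rbrakk> \<Longrightarrow> S.h_inv (x \<cdot> cinv y) \<in> carrier S"
  by (intro S.h_inv_closed X_linn)

lemma rinn_closed [simp]:
  "\<lbrakk>x \<in> S.U.corn e f; y \<in> S.U.corn e f\<rbrakk> \<Longrightarrow> T.h_inv (cinv x \<cdot> y) \<in> carrier T"
  by (intro T.h_inv_closed X_rinn)

lemma corner_biaction: "biaction S T corner_bimod"
proof
  note c = S.U.prod_closed S.U.prod_assoc XD S.U.sg_inv_prod X_lact X_ract
  fix s s' x y z t t'
  assume x: "x \<in> carrier corner_bimod"
  then show "lact corner_bimod (linn corner_bimod x x) x = x"
    "ract corner_bimod x (rinn corner_bimod x x) = x"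
    by (simp_all add: c S.U.sg_inv_right[unfolded S.U.prod_assoc])
  {
    assume s: "s \<in> carrier S"
    then show "lact corner_bimod s x \<in> carrier corner_bimod" using x by (simp add: c)
    {
      assume "t \<in> carrier T"
      then show "ract corner_bimod (lact corner_bimod s x) t = lact corner_bimod s (ract corner_bimod x t)"
        using x s by (simp add: c)
    }
    assume "s' \<in> carrier S"
    then show "lact corner_bimod (s \<cdot>\<^bsub>S\<^esub> s') x = lact corner_bimod s (lact corner_bimod s' x)"
      using x s by (simp add: c S.h_prod)
  }
  {
    assume t: "t \<in> carrier T"
    then show "ract corner_bimod x t \<in> carrier corner_bimod" using x by (simp add: c)
    assume "t' \<in> carrier T"
    then show "ract corner_bimod x (t \<cdot>\<^bsub>T\<^esub> t') = ract corner_bimod (ract corner_bimod x t) t'"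
      using x t by (simp add: c T.h_prod)
  }
  assume y: "y \<in> carrier corner_bimod"
  show "linn corner_bimod x y \<in> carrier S" "rinn corner_bimod x y \<in> carrier T"
    using x y by simp_all
  show "linn corner_bimod y x = sg_inv S (linn corner_bimod x y)"
    \<comment> \<open>Equations between pairings are checked in \<open>U\<close>, after applying the
      injective \<open>h\<close> or \<open>g\<close>.\<close>
    using x y by (subst S.h_eq_iff[symmetric]) (simp_all add: S.h_sg_inv c)
  show "rinn corner_bimod y x = sg_inv T (rinn corner_bimod x y)"
    using x y by (subst T.h_eq_iff[symmetric]) (simp_all add: T.h_sg_inv c)
  {
    assume s: "s \<in> carrier S"
    have sx: "h s \<cdot> x \<in> S.U.corn e f" using x s by (simp add: c)
    show "linn corner_bimod (lact corner_bimod s x) y = s \<cdot>\<^bsub>S\<^esub> linn corner_bimod x y"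
      using x y s h_linn[OF sx, of y] linn_closed[OF sx, of y]
      by (subst S.h_eq_iff[symmetric]) (simp_all add: S.h_prod c S.S.prod_closed)
  }
  {
    assume t: "t \<in> carrier T"
    have yt: "y \<cdot> g t \<in> S.U.corn e f" using y t by (simp add: c)
    show "rinn corner_bimod x (ract corner_bimod y t) = rinn corner_bimod x y \<cdot>\<^bsub>T\<^esub> t"
      using x y t g_rinn[OF _ yt, of x] rinn_closed[OF _ yt, of x]
      by (subst T.h_eq_iff[symmetric]) (simp_all add: T.h_prod c T.S.prod_closed)
  }
  assume z: "z \<in> carrier corner_bimod"
  show "lact corner_bimod (linn corner_bimod x y) z = ract corner_bimod x (rinn corner_bimod y z)"
    using x y z by (simp add: c)
qed

lemma X_le_iff:
  "bi_le corner_bimod x y \<longleftrightarrow> x \<in> S.U.corn e f \<and> y \<in> S.U.corn e f \<and> S.U.cat.le x y"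
  by (auto simp: bi_le_def S.U.cat.le_def XD)

lemma X_compatible: assumes "bi_compatible corner_bimod A"
  shows "A \<subseteq> S.U.corn e f" "S.U.cat.coherent A"
proof -
  show A: "A \<subseteq> S.U.corn e f" using assms by (simp add: bi_compatible_def)
  have "S.U.cat.compat x y" if "x \<in> A" "y \<in> A" for x y
    using assms that A by (intro S.U.cat.compat_of_eq) (auto simp: bi_compatible_def XD subset_iff)
  then show "S.U.cat.coherent A" by (simp add: S.U.cat.coherent_def)
qed

lemma X_join_of_join:
  assumes "A \<subseteq> S.U.corn e f" "j \<in> S.U.corn e f" "S.U.cat.is_join A j"
  shows "bi_join corner_bimod A j"
  using assms S.U.cat.is_joinD[OF assms(3)] by (auto simp: bi_join_def X_le_iff XD subset_iff)

text \<open>A \<open>bi_join\<close> is tested only against bounds in \<open>corn e f\<close>. The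
  join in \<open>U\<close> lies there by \<open>corn_join\<close>, so it is a \<open>bi_join\<close>
  as well, and antisymmetry identifies the two.\<close>

lemma join_of_X_join: assumes "bi_compatible corner_bimod A" "bi_join corner_bimod A j"
  shows "A \<subseteq> S.U.corn e f" "j \<in> S.U.corn e f" "S.U.cat.is_join A j"
proof -
  note A = X_compatible[OF assms(1)]
  show "A \<subseteq> S.U.corn e f" "j \<in> S.U.corn e f" using A(1) assms(2) by (auto simp: bi_join_def)
  obtain k where k: "k \<in> S.U.corn e f" "S.U.cat.is_join A k"
    using S.U.corn_join[OF A] by auto
  have "bi_join corner_bimod A k" using A(1) k by (rule X_join_of_join)
  then have "j = k"
    using assms(2) S.U.cat.le_antisym by (auto simp: bi_join_def X_le_iff)
  then show "S.U.cat.is_join A j" using k by simp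
qed

lemma corner_bimodule: "bimodule S T corner_bimod"
proof -
  interpret X: biaction S T corner_bimod by (rule corner_biaction)
  show ?thesis
  proof
    fix A assume A: "bi_compatible corner_bimod A"
    note A' = X_compatible[OF A]
    obtain k where k: "k \<in> S.U.corn e f" "S.U.cat.is_join A k"
      using S.U.corn_join[OF A'] by auto
    then show "\<exists>j. bi_join corner_bimod A j" using X_join_of_join[OF A'(1)] by blast
    fix j assume "bi_join corner_bimod A j"
    note j = join_of_X_join[OF A this]
    {
      fix s assume s: "s \<in> carrier S"
      show "bi_join corner_bimod ((\<lambda>x. lact corner_bimod s x) ` A) (lact corner_bimod s j)"
        using j s S.U.cat.comp_join[OF j(3), of "h s"]
        by (intro X_join_of_join) (auto simp: X_lact XD)
    }
    {
      fix t assume t: "t \<in> carrier T"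
      show "bi_join corner_bimod ((\<lambda>x. ract corner_bimod x t) ` A) (ract corner_bimod j t)"
        using j t S.U.cat.join_comp[OF j(3), of "g t"]
        by (intro X_join_of_join) (auto simp: X_ract XD)
    }
    fix y assume y: "y \<in> carrier corner_bimod"
    have "h ` (\<lambda>x. linn corner_bimod x y) ` A = (\<lambda>x. x \<cdot> cinv y) ` A"
      unfolding image_image by (rule image_cong) (use j(1) y in auto)
    then have "S.S.cat.is_join ((\<lambda>x. linn corner_bimod x y) ` A) (linn corner_bimod j y)"
      using j y S.U.cat.join_comp[OF j(3), of "cinv y"]
      by (intro S.join_of_h_join) (auto simp: XD)
    then show "sg_join S ((\<lambda>x. linn corner_bimod x y) ` A) (linn corner_bimod j y)"
      by (simp add: S.S.sg_join_iff)
    have "g ` (\<lambda>x. rinn corner_bimod y x) ` A = (\<lambda>x. cinv y \<cdot> x) ` A"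
      unfolding image_image by (rule image_cong) (use j(1) y in auto)
    then have "T.S.cat.is_join ((\<lambda>x. rinn corner_bimod y x) ` A) (rinn corner_bimod y j)"
      using j y S.U.cat.comp_join[OF j(3), of "cinv y"]
      by (intro T.join_of_h_join) (auto simp: XD)
    then show "sg_join T ((\<lambda>x. rinn corner_bimod y x) ` A) (rinn corner_bimod y j)"
      by (simp add: T.S.sg_join_iff)
  next
    fix B s x assume "sg_compatible S B" "sg_join S B s" and x: "x \<in> carrier corner_bimod"
    then have B: "S.S.cat.is_join B s" by (simp add: S.S.sg_join_iff)
    have BC: "B \<subseteq> carrier S" "s \<in> carrier S"
      using S.S.cat.is_joinD(1,2)[OF B] S.S.cat.leD(1) by auto
    show "bi_join corner_bimod ((\<lambda>b. lact corner_bimod b x) ` B) (lact corner_bimod s x)"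
      using BC x S.U.cat.join_comp[OF S.h_join[OF B], of x]
      by (intro X_join_of_join) (auto simp: X_lact XD image_image)
  next
    fix x D t assume x: "x \<in> carrier corner_bimod" and "sg_compatible T D" "sg_join T D t"
    then have D: "T.S.cat.is_join D t" by (simp add: T.S.sg_join_iff)
    have DC: "D \<subseteq> carrier T" "t \<in> carrier T"
      using T.S.cat.is_joinD(1,2)[OF D] T.S.cat.leD(1) by auto
    show "bi_join corner_bimod ((\<lambda>c. ract corner_bimod x c) ` D) (ract corner_bimod x t)"
      using DC x S.U.cat.comp_join[OF T.h_join[OF D], of x]
      by (intro X_join_of_join) (auto simp: X_ract XD image_image)
  qed
qed

lemma corner_equivalence_bimodule: "equivalence_bimodule S T corner_bimod"
proof -
  interpret X: bimodule S T corner_bimod by (rule corner_bimodule)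
  show ?thesis
  proof
    have "h ` (\<lambda>x. linn corner_bimod x x) ` carrier corner_bimod = (\<lambda>x. x \<cdot> cinv x) ` S.U.corn e f"
      unfolding image_image by (rule image_cong) auto
    then have "S.S.cat.is_join ((\<lambda>x. linn corner_bimod x x) ` carrier corner_bimod) (sg_ident S)"
      using S.U.sup_enlargement_cover[OF enl_f S.e_idem]
      by (intro S.join_of_h_join) (auto simp: S.h_ident)
    then show "sg_join S ((\<lambda>x. linn corner_bimod x x) ` carrier corner_bimod) (sg_ident S)"
      by (simp add: S.S.sg_join_iff)
    \<comment> \<open>The cover of \<open>f\<close> obtained from \<open>enl_e\<close> runs over
      \<open>corn f e\<close>; inversion matches this set with \<open>corn e f\<close> and exchanges
      range with domain projections.\<close>
    have "cinv ` S.U.corn e f = S.U.corn f e"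
    proof (rule subset_antisym; rule subsetI)
      show "x \<in> S.U.corn f e" if "x \<in> cinv ` S.U.corn e f" for x
        using that S.U.corn_inv[OF _ S.e_idem T.e_idem] by auto
      show "x \<in> cinv ` S.U.corn e f" if x: "x \<in> S.U.corn f e" for x
        using S.U.corn_inv[OF x T.e_idem S.e_idem] x
        by (intro image_eqI[of _ _ "cinv x"]) (simp_all add: S.U.corn_def)
    qed
    then have "(\<lambda>x. x \<cdot> cinv x) ` S.U.corn f e = (\<lambda>x. x \<cdot> cinv x) ` cinv ` S.U.corn e f" by simp
    also have "\<dots> = (\<lambda>x. cinv x \<cdot> x) ` S.U.corn e f"
      unfolding image_image by (rule image_cong) (auto simp: XD)
    also have "\<dots> = g ` (\<lambda>x. rinn corner_bimod x x) ` carrier corner_bimod"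
      unfolding image_image by (rule image_cong) auto
    finally have "T.S.cat.is_join ((\<lambda>x. rinn corner_bimod x x) ` carrier corner_bimod) (sg_ident T)"
      using S.U.sup_enlargement_cover[OF enl_e T.e_idem]
      by (intro T.join_of_h_join) (auto simp: T.h_ident)
    then show "sg_join T ((\<lambda>x. rinn corner_bimod x x) ` carrier corner_bimod) (sg_ident T)"
      by (simp add: T.S.sg_join_iff)
  qed
qed

end

lemma equivalence_bimodule_of_joint_sup_enlargement:
  fixes S :: "('a, 'm) semigrp_scheme" and T :: "('b, 'n) semigrp_scheme"
    and U :: "('u, 'k) semigrp_scheme"
  assumes "pseudogroup S" "pseudogroup T" "joint_sup_enlargement S T U"
  shows "\<exists>X :: ('a, 'b, 'u) biact. equivalence_bimodule S T X"
proof -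
  interpret S: pseudogroup S by fact
  interpret T: pseudogroup T by fact
  interpret U: pseudogroup U using assms(3) by (simp add: joint_sup_enlargement_def)
  obtain e f where ef: "U.cat.idem e" "U.cat.idem f" "sg_isomorphic S (local_sg U e)"
    "sg_isomorphic T (local_sg U f)" "sup_enlargement U e" "sup_enlargement U f"
    using assms(3) by (auto simp: joint_sup_enlargement_def U.idems_iff)
  have prod: "sprod (local_sg U e) = sprod U" for e by (simp add: local_sg_def)
  obtain h where h: "bij_betw h (carrier S) (U.corn e e)"
    "\<And>s t. \<lbrakk>s \<in> carrier S; t \<in> carrier S\<rbrakk> \<Longrightarrow> h (s \<cdot>\<^bsub>S\<^esub> t) = h s \<cdot>\<^bsub>U\<^esub> h t"
    using ef(3) unfolding sg_isomorphic_def prod U.carrier_local_sg[OF ef(1)] by auto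
  obtain g where g: "bij_betw g (carrier T) (U.corn f f)"
    "\<And>s t. \<lbrakk>s \<in> carrier T; t \<in> carrier T\<rbrakk> \<Longrightarrow> g (s \<cdot>\<^bsub>T\<^esub> t) = g s \<cdot>\<^bsub>U\<^esub> g t"
    using ef(4) unfolding sg_isomorphic_def prod U.carrier_local_sg[OF ef(2)] by auto
  interpret joint_enlargement S T U e h f g
    by unfold_locales (use ef h g in auto)
  show ?thesis using corner_equivalence_bimodule by blast
qed

section \<open>Reducing the carrier of a bimodule\<close>

locale bimodule_copy = equivalence_bimodule S T X
  for S :: "('a, 'm) semigrp_scheme" and T :: "('b, 'n) semigrp_scheme"
    and X :: "('a, 'b, 'x, 'k) biact_scheme" +
  fixes \<phi> :: "'x \<Rightarrow> 'y"
  assumes \<phi>_inj: "inj_on \<phi> (carrier X)"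
begin

abbreviation \<psi> :: "'y \<Rightarrow> 'x" where "\<psi> \<equiv> inv_into (carrier X) \<phi>"

definition copy :: "('a, 'b, 'y) biact" where
  "copy = \<lparr>carrier = \<phi> ` carrier X, lact = (\<lambda>s x. \<phi> (lact X s (\<psi> x))),
     ract = (\<lambda>x t. \<phi> (ract X (\<psi> x) t)), linn = (\<lambda>x y. linn X (\<psi> x) (\<psi> y)),
     rinn = (\<lambda>x y. rinn X (\<psi> x) (\<psi> y))\<rparr>"

lemma copy_simps [simp]:
  "carrier copy = \<phi> ` carrier X" "lact copy s x' = \<phi> (lact X s (\<psi> x'))"
  "ract copy x' t = \<phi> (ract X (\<psi> x') t)" "linn copy x' y' = linn X (\<psi> x') (\<psi> y')"
  "rinn copy x' y' = rinn X (\<psi> x') (\<psi> y')"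
  by (simp_all add: copy_def)

lemma \<psi>_\<phi> [simp]: "x \<in> carrier X \<Longrightarrow> \<psi> (\<phi> x) = x"
  by (simp add: \<phi>_inj inv_into_f_f)

lemma \<phi>_eq_iff: "\<lbrakk>x \<in> carrier X; y \<in> carrier X\<rbrakk> \<Longrightarrow> \<phi> x = \<phi> y \<longleftrightarrow> x = y"
  by (simp add: inj_on_eq_iff[OF \<phi>_inj])

lemmas closed = lact_closed ract_closed linn_closed rinn_closed

lemma copy_biaction: "biaction S T copy"
proof (unfold_locales, goal_cases)
  case 3 then show ?case by (auto simp: closed)
qed (auto simp: closed lact_prod ract_prod lact_ract linn_lact linn_self rinn_ract rinn_self linn_rinn
  simp flip: linn_swap rinn_swap)

lemma copy_le_iff: "\<lbrakk>x \<in> carrier X; y \<in> carrier X\<rbrakk> \<Longrightarrow> bi_le copy (\<phi> x) (\<phi> y) \<longleftrightarrow> bi_le X x y"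
  by (simp add: bi_le_def \<phi>_eq_iff closed)

lemma copy_compatible_iff:
  assumes "A \<subseteq> carrier X" shows "bi_compatible copy (\<phi> ` A) \<longleftrightarrow> bi_compatible X A"
proof -
  have "x \<in> carrier X" if "x \<in> A" for x using assms that by auto
  then show ?thesis using assms by (auto simp: bi_compatible_def \<phi>_eq_iff closed)
qed

lemma copy_join_iff:
  assumes "A \<subseteq> carrier X" "j \<in> carrier X"
  shows "bi_join copy (\<phi> ` A) (\<phi> j) \<longleftrightarrow> bi_join X A j"
proof -
  have "x \<in> carrier X" if "x \<in> A" for x using assms that by auto
  then show ?thesis using assms by (simp add: bi_join_def copy_le_iff)
qed

lemma copy_joinE:
  assumes "bi_compatible copy A'" "bi_join copy A' j'"
  obtains A j where "A' = \<phi> ` A" "j' = \<phi> j" "A \<subseteq> carrier X" "j \<in> carrier X"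
    "bi_compatible X A" "bi_join X A j"
proof -
  obtain A where A: "A' = \<phi> ` A" "A \<subseteq> carrier X"
    using assms(1) by (auto simp: bi_compatible_def elim: subset_imageE)
  obtain j where j: "j' = \<phi> j" "j \<in> carrier X"
    using assms(2) by (auto simp: bi_join_def)
  show thesis
    using that[OF A(1) j(1) A(2) j(2)] assms A j copy_compatible_iff copy_join_iff by simp
qed

text \<open>Common form of the four distributive laws for the actions, where the join is taken in
  the bimodule. The pairings take values in \<open>S\<close> and \<open>T\<close>, which the copy
  leaves unchanged.\<close>

lemma copy_join_image:
  assumes "\<And>b. b \<in> B \<Longrightarrow> F b = \<phi> (G b)" "\<And>b. b \<in> B \<Longrightarrow> G b \<in> carrier X" "bi_join X (G ` B) k"
    and "k' = \<phi> k"
  shows "bi_join copy (F ` B) k'"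
proof -
  have "F ` B = \<phi> ` G ` B" using assms(1) by (auto simp: image_image)
  moreover have "k \<in> carrier X" "G ` B \<subseteq> carrier X" using assms(2,3) by (auto simp: bi_join_def)
  ultimately show ?thesis using assms(3,4) copy_join_iff by simp
qed

lemma copy_bimodule: "bimodule S T copy"
proof -
  interpret Y: biaction S T copy by (rule copy_biaction)
  show ?thesis
  proof
    fix A' assume A': "bi_compatible copy A'"
    then obtain A where A: "A' = \<phi> ` A" "A \<subseteq> carrier X"
      by (auto simp: bi_compatible_def elim: subset_imageE)
    then obtain j where "bi_join X A j" using A' copy_compatible_iff bi_join_exists[of A] by auto
    then have "bi_join copy A' (\<phi> j)" using A copy_join_iff by (simp add: bi_join_def)
    then show "\<exists>j. bi_join copy A' j" by blast
    fix j' assume "bi_join copy A' j'"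
    from A' this obtain A j where A: "A' = \<phi> ` A" "j' = \<phi> j" "A \<subseteq> carrier X" "j \<in> carrier X"
      "bi_compatible X A" "bi_join X A j" by (rule copy_joinE)
    have AC: "x \<in> carrier X" if "x \<in> A" for x using A(3) that by auto
    {
      fix s assume s: "s \<in> carrier S"
      show "bi_join copy ((\<lambda>x. lact copy s x) ` A') (lact copy s j')"
        unfolding A(1) image_image
        by (rule copy_join_image[OF _ _ lact_join[OF s A(5,6)]]) (use A(2,4) AC s in \<open>simp_all add: closed\<close>)
    }
    {
      fix t assume t: "t \<in> carrier T"
      show "bi_join copy ((\<lambda>x. ract copy x t) ` A') (ract copy j' t)"
        unfolding A(1) image_image
        by (rule copy_join_image[OF _ _ join_ract[OF A(5,6) t]]) (use A(2,4) AC t in \<open>simp_all add: closed\<close>)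
    }
    fix y' assume "y' \<in> carrier copy"
    then obtain y where y: "y' = \<phi> y" "y \<in> carrier X" by auto
    have "(\<lambda>x. linn copy x y') ` A' = (\<lambda>x. linn X x y) ` A" "(\<lambda>x. rinn copy y' x) ` A' = (\<lambda>x. rinn X y x) ` A"
      unfolding A(1) image_image by (rule image_cong; use AC y in simp)+
    then show "sg_join S ((\<lambda>x. linn copy x y') ` A') (linn copy j' y')"
      "sg_join T ((\<lambda>x. rinn copy y' x) ` A') (rinn copy y' j')"
      using linn_join[OF A(5,6) y(2)] rinn_join[OF A(5,6) y(2)] A(2,4) y by simp_all
  next
    fix B s x' assume B: "sg_compatible S B" "sg_join S B s" and "x' \<in> carrier copy"
    then obtain x where x: "x' = \<phi> x" "x \<in> carrier X" by auto
    have BC: "b \<in> carrier S" if "b \<in> B" for b using B(1) that by (auto simp: sg_compatible_def)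
    show "bi_join copy ((\<lambda>b. lact copy b x') ` B) (lact copy s x')"
      by (rule copy_join_image[OF _ _ join_lact[OF B x(2)]]) (use x BC in \<open>simp_all add: closed\<close>)
  next
    fix x' D t assume "x' \<in> carrier copy" and D: "sg_compatible T D" "sg_join T D t"
    then obtain x where x: "x' = \<phi> x" "x \<in> carrier X" by auto
    have DC: "b \<in> carrier T" if "b \<in> D" for b using D(1) that by (auto simp: sg_compatible_def)
    show "bi_join copy ((\<lambda>c. ract copy x' c) ` D) (ract copy x' t)"
      by (rule copy_join_image[OF _ _ ract_join[OF x(2) D]]) (use x DC in \<open>simp_all add: closed\<close>)
  qed
qed

lemma copy_equivalence_bimodule: "equivalence_bimodule S T copy"
proof -
  interpret Y: bimodule S T copy by (rule copy_bimodule)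
  have "(\<lambda>x. linn copy x x) ` carrier copy = (\<lambda>x. linn X x x) ` carrier X"
    "(\<lambda>x. rinn copy x x) ` carrier copy = (\<lambda>x. rinn X x x) ` carrier X"
    by (auto simp: image_image)
  then show ?thesis using linn_cover rinn_cover by unfold_locales simp_all
qed

end

lemma equivalence_bimodule_on_univ:
  fixes S :: "('a, 'm) semigrp_scheme" and T :: "('b, 'n) semigrp_scheme"
    and X :: "('a, 'b, 'x, 'k) biact_scheme"
  assumes "equivalence_bimodule S T X"
  shows "\<exists>Y :: ('a, 'b, ('a, 'b) bimod_univ) biact. equivalence_bimodule S T Y"
proof -
  interpret equivalence_bimodule S T X by fact
  \<comment> \<open>The choice depends on \<open>x\<close> only through its two projections, so
    elements with equal codes have the same \<open>r\<close>.\<close>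
  define r where "r = (\<lambda>x. SOME z. z \<in> carrier X \<and> linn X z z = linn X x x \<and> rinn X z z = rinn X x x)"
  have r: "r x \<in> carrier X" "linn X (r x) (r x) = linn X x x" "rinn X (r x) (r x) = rinn X x x"
    if "x \<in> carrier X" for x
    using someI[of "\<lambda>z. z \<in> carrier X \<and> linn X z z = linn X x x \<and> rinn X z z = rinn X x x" x] that
    by (auto simp: r_def)
  \<comment> \<open>By \<open>linn_rinn\<close> the left side is \<open>x\<close> acted on by
    \<open>rinn X (r x) (r x)\<close>, which equals \<open>rinn X x x\<close>.\<close>
  have rec: "lact X (linn X x (r x)) (r x) = x" if "x \<in> carrier X" for x
    using r[OF that] that by (simp add: linn_rinn rinn_self)
  interpret bimodule_copy S T X "\<lambda>x. (linn X x x, rinn X x x, linn X x (r x))"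
  proof
    show "inj_on (\<lambda>x. (linn X x x, rinn X x x, linn X x (r x))) (carrier X)"
    proof (rule inj_onI)
      fix x y assume xy: "x \<in> carrier X" "y \<in> carrier X"
        "(linn X x x, rinn X x x, linn X x (r x)) = (linn X y y, rinn X y y, linn X y (r y))"
      then have "r x = r y" by (simp add: r_def)
      moreover have "linn X x (r x) = linn X y (r y)" using xy(3) by simp
      ultimately show "x = y" using rec[OF xy(1)] rec[OF xy(2)] by metis
    qed
  qed
  show ?thesis using copy_equivalence_bimodule by blast
qed

lemma joint_sup_enlargement_of_equivalence_bimodule:
  fixes S :: "('a, 'm) semigrp_scheme" and T :: "('b, 'n) semigrp_scheme"
    and X :: "('a, 'b, 'x, 'k) biact_scheme"
  assumes "equivalence_bimodule S T X"
  shows "\<exists>U :: ('a \<times> 'x \<times> 'x \<times> 'b) semigrp. joint_sup_enlargement S T U"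
  using equivalence_bimodule.joint_sup_enlargement_mat_sg[OF assms] by blast

theorem theorem3:
  fixes S :: "'a semigrp" and T :: "'b semigrp"
  assumes "pseudogroup S" and "pseudogroup T"
  shows "((\<exists>X :: ('a, 'b, ('a, 'b) bimod_univ) biact. equivalence_bimodule S T X) \<longleftrightarrow>
            (\<exists>U :: ('a, 'b) enl_univ semigrp. joint_sup_enlargement S T U))
       \<and> ((\<exists>X :: ('a, 'b, 'x) biact. equivalence_bimodule S T X) \<longrightarrow>
            (\<exists>X :: ('a, 'b, ('a, 'b) bimod_univ) biact. equivalence_bimodule S T X))
       \<and> ((\<exists>U :: 'u semigrp. joint_sup_enlargement S T U) \<longrightarrow>
            (\<exists>U :: ('a, 'b) enl_univ semigrp. joint_sup_enlargement S T U))"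
proof (intro conjI impI iffI; elim exE)
  note shrink = equivalence_bimodule_on_univ
    and enlarge = joint_sup_enlargement_of_equivalence_bimodule
    and corner = equivalence_bimodule_of_joint_sup_enlargement[OF assms]
  show "\<exists>U :: ('a, 'b) enl_univ semigrp. joint_sup_enlargement S T U"
    if "equivalence_bimodule S T X" for X :: "('a, 'b, ('a, 'b) bimod_univ) biact"
    by (rule enlarge[OF that])
  show "\<exists>X :: ('a, 'b, ('a, 'b) bimod_univ) biact. equivalence_bimodule S T X"
    if "joint_sup_enlargement S T U" for U :: "('a, 'b) enl_univ semigrp"
    using corner[OF that] by (elim exE) (rule shrink)
  show "\<exists>X :: ('a, 'b, ('a, 'b) bimod_univ) biact. equivalence_bimodule S T X"
    if "equivalence_bimodule S T X" for X :: "('a, 'b, 'x) biact"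
    by (rule shrink[OF that])
  \<comment> \<open>The given enlargement is not itself re-encoded: its corner bimodule is shrunk,
    and the matrices over the result form a new enlargement.\<close>
  show "\<exists>U :: ('a, 'b) enl_univ semigrp. joint_sup_enlargement S T U"
    if "joint_sup_enlargement S T U" for U :: "'u semigrp"
    using corner[OF that] by (elim exE) (drule shrink, elim exE, rule enlarge)
qed

end
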